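(* Let $A\in\Lambda^{1}(U,\mathrm{End}(V))$ and let $k>0$. The unique nontrivial solution $\phi\in\Lambda^{k}(U,V)$ to the equation $$d^{\nabla}\phi = d\phi + A\wedge\phi = 0$$ with the condition $dH\phi = c\in\mathcal{E}(U,V)\setminus\ker(A\wedge\_)$, $c\neq 0$, is given by $$\phi=\sum_{l=0}^{\infty}(-1)^{l}\,(H(A\wedge\_))^{l}\,c, \qquad ( * )$$ where $(H(A\wedge\_))^{0}=\mathrm{Id}$ and $(H(A\wedge\_))^{l}$ is the $l$-fold composition of the operator $\omega\mapsto H(A\wedge\omega)$. The series $( * )$ is uniformly convergent to a continuous form inside the ball $B(x_{0},r)$ with center $x_{0}$ and radius $r$ given by $r\,\frac{\|A\|_{\infty}}{k}=1$, where the supremum in $\|A\|_\infty$ is taken over the ball. Moreover, $d\phi=-A\wedge\phi$ is a continuous form. The continuous solution is an element of $\Lambda^{k,0}(U,V)\setminus\ker(A\wedge\_)$. Two of the solutions differ by an exact gauge mode, obtained from $( * )$ when $c\in\mathcal{E}(U,V)\cap\ker(A\wedge\_)$, i.e. $\phi=c$.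
   Context: $U\subset\mathbb{R}^{n}$ is a bounded open set, star-shaped with respect to a point $x_{0}\in U$; $V$ is a finite-dimensional real vector space with a chosen basis. $\Lambda^{k}(U,V)$ denotes $V$-valued differential $k$-forms on $U$; $\Lambda^{k,p}(U,V)$ those with $C^{p}$ coefficients ($\Lambda^{k}$ without $p$ is the union over $p=0,\dots,\infty$). $A$ is a smooth $\mathrm{End}(V)$-valued one-form (assumed of constant rank), $A\wedge\_$ is the operator $\omega\mapsto A\wedge\omega$ on $V$-valued forms (matrix action combined with wedge), $\ker(A\wedge\_)$ its kernel, and $d^{\nabla}=d+A\wedge\_$. Solutions are in general only continuous forms with continuous exterior derivative. Homotopy operator: with $\mathcal{K}=(x-x_{0})^{i}\partial_{i}$, for a $k$-form $\omega$, $k\ge 1$, $(H\omega)(x)=\int_{0}^{1}\mathcal{K}(x)\lrcorner\,\omega|_{x_{0}+t(x-x_{0})}\,t^{k-1}\,dt$, and $H=0$ on $0$-forms; it acts componentwise on vector-valued forms. It satisfies $H^{2}=0$ and $dH+Hd=I-s_{x_0}^{*}$, where $s_{x_0}^{*}$ is evaluation at $x_{0}$ on $0$-forms and zero on forms of positive degree. $\mathcal{E}(U,V)=\ker d$ is the space of exact (equivalently closed) forms. An exact gauge mode is a solution of $d^{\nabla}\phi=0$ lying in $\mathcal{E}(U,V)\cap\ker(A\wedge\_)$. Norms: for $\omega=\omega^{i}_{I}\,dx^{I}e_{i}$, $\|\omega\|_{\infty}=\max_{i,I}\sup_{x}|\omega^{i}_{I}(x)|$; for $A=[A^{i}_{j,k}(x)\,dx^{k}]$,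 $\|A\|_{\infty}=\max_{i,j,k}\sup_{x}|A^{i}_{j,k}(x)|$.
   Formalization: Existence fails in general: the series is shown to solve the equation exactly when A∧φ is closed. Solutions differ by an exact gauge mode iff their data c differ by an element of ker(A∧_). Convergence is uniform on compact subsets of the ball, and on the whole ball if c is bounded there. *)

theory Defs
  imports "HOL-Analysis.Analysis"
begin

(* A k-form on a Euclidean space 'a with values in 'b is a function  x |-> (vs |-> \<omega> x vs),  where
   vs lists the k argument vectors. Only lists of length k matter: the values on other lists are
   unconstrained, and forms are compared only on lists of length k (see form_eq). *)

type_synonym ('a, 'b) dform = "'a \<Rightarrow> 'a list \<Rightarrow> 'b"

definition alternating_multilinear ::
    "nat \<Rightarrow> ('a::real_vector list \<Rightarrow> 'b::real_vector) \<Rightarrow> bool" where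
  "alternating_multilinear k f \<longleftrightarrow>
     (\<forall>vs. length vs = k \<longrightarrow>
        (\<forall>i<k. linear (\<lambda>v. f (vs[i := v]))) \<and> (\<not> distinct vs \<longrightarrow> f vs = 0))"

fun Cp_on :: "nat \<Rightarrow> 'a::real_normed_vector set \<Rightarrow> ('a \<Rightarrow> 'b::real_normed_vector) \<Rightarrow> bool" where
  "Cp_on 0 U f \<longleftrightarrow> continuous_on U f"
| "Cp_on (Suc p) U f \<longleftrightarrow>
     (\<forall>x\<in>U. f differentiable (at x)) \<and> (\<forall>v. Cp_on p U (\<lambda>x. frechet_derivative f (at x) v))"

(* The space of k-forms of class C^p on the open set U, for p = 0, 1, ..., \<infinity>. It decreases with p,
   so the union over all p is the space dforms k 0 U of continuous forms. *)
definition dforms :: "nat \<Rightarrow> enat \<Rightarrow> 'a::euclidean_space set \<Rightarrow> ('a, 'b::real_normed_vector) dform set" where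
  "dforms k p U = {\<omega>. (\<forall>x\<in>U. alternating_multilinear k (\<omega> x)) \<and>
     (\<forall>vs. length vs = k \<longrightarrow> (\<forall>q. enat q \<le> p \<longrightarrow> Cp_on q U (\<lambda>x. \<omega> x vs)))}"

definition form_eq :: "nat \<Rightarrow> 'a set \<Rightarrow> ('a, 'b) dform \<Rightarrow> ('a, 'b) dform \<Rightarrow> bool" where
  "form_eq k U \<omega> \<eta> \<longleftrightarrow> (\<forall>x\<in>U. \<forall>vs. length vs = k \<longrightarrow> \<omega> x vs = \<eta> x vs)"

abbreviation zero_form :: "('a, 'b::zero) dform" where
  "zero_form \<equiv> \<lambda>x vs. 0"

abbreviation add_form :: "('a, 'b::plus) dform \<Rightarrow> ('a, 'b) dform \<Rightarrow> ('a, 'b) dform" where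
  "add_form \<omega> \<eta> \<equiv> \<lambda>x vs. \<omega> x vs + \<eta> x vs"

abbreviation diff_form :: "('a, 'b::minus) dform \<Rightarrow> ('a, 'b) dform \<Rightarrow> ('a, 'b) dform" where
  "diff_form \<omega> \<eta> \<equiv> \<lambda>x vs. \<omega> x vs - \<eta> x vs"

abbreviation uminus_form :: "('a, 'b::uminus) dform \<Rightarrow> ('a, 'b) dform" where
  "uminus_form \<omega> \<equiv> \<lambda>x vs. - \<omega> x vs"

(* Maximum over all coefficients of the supremum over S, with value \<infinity> for unbounded forms.
   The list I runs over all lists of k coordinate vectors, not only the increasing ones: permuting I
   does not change the absolute value and repetitions give 0. *)
definition form_norm :: "nat \<Rightarrow> 'a::euclidean_space set \<Rightarrow> ('a, 'v::euclidean_space) dform \<Rightarrow> ennreal" where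
  "form_norm k S \<omega> =
     (SUP I\<in>{I. set I \<subseteq> Basis \<and> length I = k}. SUP i\<in>Basis. SUP x\<in>S. ennreal \<bar>\<omega> x I \<bullet> i\<bar>)"

(* The same for an End('v)-valued 1-form, in terms of its matrix coefficients. *)
definition conn_norm ::
    "'a::euclidean_space set \<Rightarrow> ('a, 'v::euclidean_space \<Rightarrow>\<^sub>L 'v) dform \<Rightarrow> ennreal" where
  "conn_norm S A =
     (SUP i\<in>Basis. SUP j\<in>Basis. SUP b\<in>Basis. SUP x\<in>S. ennreal \<bar>blinfun_apply (A x [b]) j \<bullet> i\<bar>)"

definition del_nth :: "nat \<Rightarrow> 'a list \<Rightarrow> 'a list" where
  "del_nth i vs = take i vs @ drop (Suc i) vs"

definition wedge ::
    "('a, 'v::real_normed_vector \<Rightarrow>\<^sub>L 'v) dform \<Rightarrow> ('a, 'v) dform \<Rightarrow> ('a, 'v) dform" where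
  "wedge A \<omega> = (\<lambda>x vs. \<Sum>i<length vs. (-1)^i *\<^sub>R blinfun_apply (A x [vs ! i]) (\<omega> x (del_nth i vs)))"

(* Classical exterior derivative, for differentiable forms. *)
definition ext_deriv ::
    "('a::real_normed_vector, 'v::real_normed_vector) dform \<Rightarrow> ('a, 'v) dform" where
  "ext_deriv \<omega> = (\<lambda>x vs. \<Sum>i<length vs.
     (-1)^i *\<^sub>R frechet_derivative (\<lambda>y. \<omega> y (del_nth i vs)) (at x) (vs ! i))"

(* The continuous k-form \<omega> has the continuous exterior derivative \<eta>: the pair (\<omega>, \<eta>) is a limit of
   pairs (\<omega>', d\<omega>') with \<omega>' smooth, uniformly on compact subsets of U. By mollification this is the
   distributional exterior derivative, and it agrees with ext_deriv on C^1 forms. *)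
definition has_ext_deriv_on ::
    "nat \<Rightarrow> 'a::euclidean_space set \<Rightarrow> ('a, 'v::euclidean_space) dform \<Rightarrow> ('a, 'v) dform \<Rightarrow> bool" where
  "has_ext_deriv_on k U \<omega> \<eta> \<longleftrightarrow>
     \<omega> \<in> dforms k 0 U \<and> \<eta> \<in> dforms (Suc k) 0 U \<and>
     (\<forall>K \<epsilon>. compact K \<and> K \<subseteq> U \<and> \<epsilon> > 0 \<longrightarrow>
        (\<exists>\<omega>'\<in>dforms k \<infinity> U. form_norm k K (diff_form \<omega>' \<omega>) < ennreal \<epsilon> \<and>
           form_norm (Suc k) K (diff_form (ext_deriv \<omega>') \<eta>) < ennreal \<epsilon>))"

definition closed_forms :: "nat \<Rightarrow> 'a::euclidean_space set \<Rightarrow> ('a, 'v::euclidean_space) dform set" where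
  "closed_forms k U = {\<omega>. has_ext_deriv_on k U \<omega> zero_form}"

definition ker_wedge ::
    "nat \<Rightarrow> 'a::euclidean_space set \<Rightarrow> ('a, 'v::euclidean_space \<Rightarrow>\<^sub>L 'v) dform \<Rightarrow> ('a, 'v) dform set" where
  "ker_wedge k U A = {\<omega> \<in> dforms k 0 U. form_eq (Suc k) U (wedge A \<omega>) zero_form}"

definition cov_constant ::
    "nat \<Rightarrow> 'a::euclidean_space set \<Rightarrow> ('a, 'v::euclidean_space \<Rightarrow>\<^sub>L 'v) dform \<Rightarrow> ('a, 'v) dform \<Rightarrow> bool" where
  "cov_constant k U A \<phi> \<longleftrightarrow>
     (\<exists>\<eta>. has_ext_deriv_on k U \<phi> \<eta> \<and> form_eq (Suc k) U (add_form \<eta> (wedge A \<phi>)) zero_form)"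

definition exact_gauge_modes ::
    "nat \<Rightarrow> 'a::euclidean_space set \<Rightarrow> ('a, 'v::euclidean_space \<Rightarrow>\<^sub>L 'v) dform \<Rightarrow> ('a, 'v) dform set" where
  "exact_gauge_modes k U A = {\<phi> \<in> closed_forms k U \<inter> ker_wedge k U A. cov_constant k U A \<phi>}"

(* k is the degree of the argument \<omega>. *)
definition homotopy_op ::
    "'a::euclidean_space \<Rightarrow> nat \<Rightarrow> ('a, 'v::euclidean_space) dform \<Rightarrow> ('a, 'v) dform" where
  "homotopy_op x0 k \<omega> = (\<lambda>x vs. if k = 0 then 0 else
     integral {0..1} (\<lambda>t. t ^ (k - 1) *\<^sub>R \<omega> (x0 + t *\<^sub>R (x - x0)) ((x - x0) # vs)))"

(* The l-th term of the series; k is the degree of c. *)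
definition series_term ::
    "'a::euclidean_space \<Rightarrow> nat \<Rightarrow> ('a, 'v::euclidean_space \<Rightarrow>\<^sub>L 'v) dform \<Rightarrow> ('a, 'v) dform \<Rightarrow>
     nat \<Rightarrow> ('a, 'v) dform" where
  "series_term x0 k A c l =
     (\<lambda>x vs. (-1)^l *\<^sub>R ((\<lambda>\<omega>. homotopy_op x0 (Suc k) (wedge A \<omega>)) ^^ l) c x vs)"

definition series_sum ::
    "'a::euclidean_space \<Rightarrow> nat \<Rightarrow> ('a, 'v::euclidean_space \<Rightarrow>\<^sub>L 'v) dform \<Rightarrow> ('a, 'v) dform \<Rightarrow>
     ('a, 'v) dform" where
  "series_sum x0 k A c = (\<lambda>x vs. \<Sum>l. series_term x0 k A c l x vs)"

definition series_unif_conv_on ::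
    "'a::euclidean_space set \<Rightarrow> 'a \<Rightarrow> nat \<Rightarrow> ('a, 'v::euclidean_space \<Rightarrow>\<^sub>L 'v) dform \<Rightarrow> ('a, 'v) dform \<Rightarrow>
     bool" where
  "series_unif_conv_on S x0 k A c \<longleftrightarrow>
     (\<lambda>N. form_norm k S (diff_form (\<lambda>x vs. \<Sum>l<N. series_term x0 k A c l x vs) (series_sum x0 k A c)))
       \<longlonglongrightarrow> 0"

(* \<phi> solves d\<phi> + A \<and> \<phi> = 0 subject to d(H\<phi>) = c; meaningful for k > 0. *)
definition solution_with_datum ::
    "nat \<Rightarrow> 'a::euclidean_space set \<Rightarrow> 'a \<Rightarrow> ('a, 'v::euclidean_space \<Rightarrow>\<^sub>L 'v) dform \<Rightarrow>
     ('a, 'v) dform \<Rightarrow> ('a, 'v) dform \<Rightarrow> bool" where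
  "solution_with_datum k U x0 A c \<phi> \<longleftrightarrow>
     cov_constant k U A \<phi> \<and> has_ext_deriv_on (k - 1) U (homotopy_op x0 k \<phi>) c"

end

theory Submission
  imports Defs
begin

text \<open>
  Write H for the homotopy operator with centre x0 and T for the operator that sends \<omega> to
  H (A \<and> \<omega>). Everything rests on the homotopy formula dH + Hd = id in positive degrees. If
  d\<phi> = - A \<and> \<phi> and d(H\<phi>) = c, the formula reads c - T\<phi> = \<phi>, so a solution is a fixed point:
  \<phi> + T\<phi> = c. The series is the Neumann series of (id + T)^(-1) applied to c.

  The Neumann series converges because T integrates along rays and so behaves like a Volterra
  operator. If \<omega> grows at most like |x - x0|^l, then T\<omega> is smaller by a factor of order
  |x - x0| / (l + 1). The l-th term is therefore bounded by C^l / l! (lemma T_pow_form_bound),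
  uniformly on every star-shaped set on which A, c and |x - x0| are bounded. This gives uniform
  convergence and continuity of the sum (series_tail, series_sum_dforms), the fixed point equation
  for it (series_solves_fixed_point), and uniqueness, since a difference \<psi> of two fixed points
  satisfies \<psi> = - T\<psi> and hence |\<psi>| = |T^l \<psi>| for all l (fixed_point_unique).

  Conversely, let \<phi> be a fixed point for a closed form c. Then H\<phi> = Hc because H H = 0, and the
  homotopy formula for c gives d(H\<phi>) = c. Moreover d\<phi> = dc - d(T\<phi>) = - A \<and> \<phi> + H d(A \<and> \<phi>), so \<phi>
  solves the equation as soon as A \<and> \<phi> is closed; this is also necessary, as d d = 0
  (fixed_point_cov_constant_iff). All statements about gauge modes come from the observation that a
  form g with A \<and> g = 0 has T g = 0 and is thus the fixed point with datum g.

  The forms are only continuous and their exterior derivatives are weak, as limits of smooth pairs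
  (\<omega>', d\<omega>'). The homotopy formula passes to such limits, because H is continuous for uniform
  convergence on compact star-shaped sets (has_ext_deriv_on_homotopy). It also shows that the weak
  derivative is unique, without test functions: if \<eta> is an exterior derivative of 0, then H\<eta> is one
  as well, up to sign and in one degree less, so by induction H\<eta> = 0. This holds for homotopy operators
  with any centre y near the point considered, and letting the endpoint of the ray tend to y
  recovers \<eta>(y) = 0 (homotopy_op_zero_imp, has_ext_deriv_on_unique). The same limit of shrinking rays
  yields the symmetry of second derivatives, and with it d d = 0.
\<close>

section \<open>Functions of class C^p\<close>

lemma Cp_on_Suc_imp: "Cp_on (Suc p) U f \<Longrightarrow> Cp_on p U f"
proof (induction p arbitrary: f)
  case 0
  then show ?case
    by (auto intro!: differentiable_imp_continuous_on differentiable_at_imp_differentiable_on)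
next
  case (Suc p)
  then show ?case by auto
qed

lemma Cp_on_subset: "Cp_on p U f \<Longrightarrow> W \<subseteq> U \<Longrightarrow> Cp_on p W f"
  by (induction p arbitrary: f) (auto intro: continuous_on_subset)

lemma Cp_on_cong:
  assumes "open U" and "\<And>x. x \<in> U \<Longrightarrow> f x = g x" and "Cp_on p U f"
  shows "Cp_on p U g"
  using assms(2,3)
proof (induction p arbitrary: f g)
  case 0
  then show ?case by (simp cong: continuous_on_cong)
next
  case (Suc p)
  have d: "(g has_derivative frechet_derivative f (at x)) (at x)" if "x \<in> U" for x
    using has_derivative_transform_within_open[of f _ x UNIV U g] that assms(1) Suc.prems
    by (simp add: frechet_derivative_works)
  have "frechet_derivative f (at x) v = frechet_derivative g (at x) v" if "x \<in> U" for x v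
    using frechet_derivative_at[OF d[OF that]] by simp
  then have "Cp_on p U (\<lambda>x. frechet_derivative g (at x) v)" for v
    using Suc.IH[of "\<lambda>x. frechet_derivative f (at x) v"] Suc.prems(2) by simp
  then show ?case using d by (auto simp: differentiable_def)
qed

text \<open>
  The derivative in the recursive clause of Cp_on is the total function frechet_derivative; this rule
  allows any formula for it.
\<close>

lemma Cp_on_SucI:
  assumes "open U" and "\<And>x. x \<in> U \<Longrightarrow> (f has_derivative f' x) (at x)"
    and "\<And>v. Cp_on p U (\<lambda>x. f' x v)"
  shows "Cp_on (Suc p) U f"
proof -
  have "f' x v = frechet_derivative f (at x) v" if "x \<in> U" for x v
    using frechet_derivative_at[OF assms(2)[OF that]] by simp
  then have "Cp_on p U (\<lambda>x. frechet_derivative f (at x) v)" for v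
    by (intro Cp_on_cong[OF assms(1) _ assms(3)])
  then show ?thesis using assms(2) by (auto simp: differentiable_def)
qed

lemma Cp_on_SucD:
  assumes "Cp_on (Suc p) U f" "x \<in> U"
  shows "(f has_derivative frechet_derivative f (at x)) (at x)"
  using assms by (simp add: frechet_derivative_works)

lemma Cp_on_const: 
  assumes "open U"
  shows "Cp_on p U (\<lambda>x. c)"
proof (induction p arbitrary: c)
  case (Suc p)
  show ?case by (rule Cp_on_SucI[OF assms has_derivative_const]) (rule Suc)
qed simp

lemma Cp_on_lincomb:
  assumes "open U"
  shows "Cp_on p U f \<Longrightarrow> Cp_on p U g \<Longrightarrow> Cp_on p U (\<lambda>x. a *\<^sub>R f x + b *\<^sub>R g x)"
proof (induction p arbitrary: f g)
  case 0
  then show ?case by (auto intro!: continuous_intros)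
next
  case (Suc p)
  show ?case
    by (rule Cp_on_SucI[OF assms, where f' = "\<lambda>x v. a *\<^sub>R frechet_derivative f (at x) v + b *\<^sub>R frechet_derivative g (at x) v"])
      (use Suc in \<open>auto intro!: derivative_eq_intros simp: frechet_derivative_works\<close>)
qed

lemma Cp_on_sum:
  assumes "open U" "\<And>i. i \<in> I \<Longrightarrow> Cp_on p U (f i)"
  shows "Cp_on p U (\<lambda>x. \<Sum>i\<in>I. c i *\<^sub>R f i x)"
  using assms(2)
proof (induction I rule: infinite_finite_induct)
  case (insert i I)
  then show ?case using Cp_on_lincomb[OF assms(1), of p "f i" "\<lambda>x. \<Sum>i\<in>I. c i *\<^sub>R f i x" "c i" 1] by simp
qed (auto intro: Cp_on_const assms)

lemma Cp_on_mult_affine: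
  assumes "open U"
  shows "Cp_on p U f \<Longrightarrow> Cp_on p U (\<lambda>x. ((x - a) \<bullet> b) *\<^sub>R f x)"
proof (induction p arbitrary: f)
  case 0
  then show ?case by (auto intro!: continuous_intros)
next
  case (Suc p)
  show ?case
  proof (rule Cp_on_SucI[OF assms, where f' = "\<lambda>x v. ((x - a) \<bullet> b) *\<^sub>R frechet_derivative f (at x) v + (v \<bullet> b) *\<^sub>R f x"])
    show "((\<lambda>x. ((x - a) \<bullet> b) *\<^sub>R f x) has_derivative
        (\<lambda>v. ((x - a) \<bullet> b) *\<^sub>R frechet_derivative f (at x) v + (v \<bullet> b) *\<^sub>R f x)) (at x)" if "x \<in> U" for x
      by (rule derivative_eq_intros refl Cp_on_SucD[OF Suc.prems that] | simp)+
    show "Cp_on p U (\<lambda>x. ((x - a) \<bullet> b) *\<^sub>R frechet_derivative f (at x) v + (v \<bullet> b) *\<^sub>R f x)" for v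
      using Cp_on_lincomb[OF assms Suc.IH[of "\<lambda>x. frechet_derivative f (at x) v"] Cp_on_Suc_imp[OF Suc.prems], of 1 "v \<bullet> b"]
        Suc.prems by simp
  qed
qed

section \<open>Integrals along rays\<close>

definition star_at :: "'a::real_vector \<Rightarrow> 'a set \<Rightarrow> bool" where
  "star_at x0 U \<longleftrightarrow> x0 \<in> U \<and> (\<forall>x\<in>U. \<forall>t\<in>{0..1}. x0 + t *\<^sub>R (x - x0) \<in> U)"

lemma star_atD: "star_at x0 U \<Longrightarrow> x \<in> U \<Longrightarrow> 0 \<le> t \<Longrightarrow> t \<le> 1 \<Longrightarrow> x0 + t *\<^sub>R (x - x0) \<in> U"
  by (simp add: star_at_def)

lemma convex_imp_star_at:
  assumes "convex W" "y \<in> W" shows "star_at y W"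
proof -
  have "y + t *\<^sub>R (x - y) \<in> W" if "x \<in> W" "t \<in> {0..1}" for x t
  proof -
    have "y + t *\<^sub>R (x - y) = (1 - t) *\<^sub>R y + t *\<^sub>R x" by (simp add: algebra_simps)
    then show ?thesis using convexD_alt[OF assms that(1), of t] that(2) by simp
  qed
  then show ?thesis using assms(2) by (simp add: star_at_def)
qed

definition ray_integral :: "'a::real_vector \<Rightarrow> nat \<Rightarrow> ('a \<Rightarrow> 'b::euclidean_space) \<Rightarrow> 'a \<Rightarrow> 'b" where
  "ray_integral x0 m f x = integral {0..1} (\<lambda>t. t ^ m *\<^sub>R f (x0 + t *\<^sub>R (x - x0)))"

lemma continuous_on_ray:
  fixes f :: "'a::real_normed_vector \<Rightarrow> 'b::real_normed_vector"
  assumes "star_at x0 U" "continuous_on U f" "x \<in> U"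
  shows "continuous_on {0..1} (\<lambda>t::real. f (x0 + t *\<^sub>R (x - x0)))"
  by (rule continuous_on_compose2[OF assms(2)]) (use assms in \<open>auto intro!: continuous_intros star_atD\<close>)

lemma ray_integrable:
  fixes f :: "'a::real_normed_vector \<Rightarrow> 'b::banach"
  assumes "star_at x0 U" "continuous_on U f" "x \<in> U"
  shows "(\<lambda>t. t ^ m *\<^sub>R f (x0 + t *\<^sub>R (x - x0))) integrable_on {0..1::real}"
  by (intro integrable_continuous_interval continuous_intros continuous_on_ray[OF assms])

lemma ray_integral_continuous:
  fixes f :: "'a::euclidean_space \<Rightarrow> 'b::euclidean_space"
  assumes "star_at x0 U" "continuous_on U f"
  shows "continuous_on U (ray_integral x0 m f)"
proof -
  have "continuous_on (U \<times> cbox (0::real) 1) (\<lambda>(x, t). t ^ m *\<^sub>R f (x0 + t *\<^sub>R (x - x0)))"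
    unfolding split_beta
    by (intro continuous_intros continuous_on_compose2[OF assms(2)])
      (auto intro!: star_atD[OF assms(1)])
  from integral_continuous_on_param[OF this] show ?thesis
    by (simp add: ray_integral_def[abs_def])
qed

text \<open>
  Differentiation under the integral sign: the chain rule contributes one factor t, which raises the
  weight from t^m to t^(m+1). The weight is therefore a parameter of ray_integral.
\<close>

lemma ray_integral_has_derivative:
  fixes f :: "'a::euclidean_space \<Rightarrow> 'b::euclidean_space"
  assumes U: "open U" "star_at x0 U" and f: "Cp_on (Suc 0) U f" and x: "x \<in> U"
  shows "(ray_integral x0 m f has_derivative
     (\<lambda>v. ray_integral x0 (Suc m) (\<lambda>y. frechet_derivative f (at y) v) x)) (at x)"
proof -
  obtain e where e: "e > 0" "ball x e \<subseteq> U" using U x openE by blast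
  let ?y = "\<lambda>z t. x0 + t *\<^sub>R (z - x0)"
  define F where "F z t = t ^ Suc m *\<^sub>R Blinfun (frechet_derivative f (at (?y z t)))" for z t
  have yU: "?y z t \<in> U" if "z \<in> ball x e" "t \<in> {0..1}" for z t
    using that e star_atD[OF U(2)] by auto
  have F: "blinfun_apply (F z t) v = t ^ Suc m *\<^sub>R frechet_derivative f (at (?y z t)) v"
    if "z \<in> ball x e" "t \<in> {0..1}" for z t v
    using has_derivative_bounded_linear[OF Cp_on_SucD[OF f yU[OF that]]]
    by (simp add: F_def scaleR_blinfun.rep_eq bounded_linear_Blinfun_apply)
  \<comment> \<open>The Leibniz rule needs joint continuity in the operator norm; in finite dimensions it is enough
      to check it on basis vectors.\<close>
  have c: "continuous_on (ball x e \<times> cbox 0 1) (\<lambda>(z, t). F z t)"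
  proof (rule continuous_on_blinfun_componentwise)
    fix i :: 'a
    have ci: "continuous_on U (\<lambda>y. frechet_derivative f (at y) i)" using f by simp
    have "continuous_on (ball x e \<times> cbox 0 1) (\<lambda>p. snd p ^ Suc m *\<^sub>R frechet_derivative f (at (?y (fst p) (snd p))) i)"
      by (intro continuous_intros continuous_on_compose2[OF ci]) (auto intro!: yU)
    then show "continuous_on (ball x e \<times> cbox 0 1) (\<lambda>p. blinfun_apply (case p of (z, t) \<Rightarrow> F z t) i)"
      by (rule continuous_on_eq) (auto simp: F)
  qed
  have d: "((\<lambda>z. t ^ m *\<^sub>R f (?y z t)) has_derivative blinfun_apply (F z t)) (at z within ball x e)"
    if zt: "z \<in> ball x e" "t \<in> cbox 0 1" for z t
  proof -
    have "(f has_derivative frechet_derivative f (at (?y z t))) (at (?y z t))"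
      using Cp_on_SucD[OF f yU] that by auto
    moreover have "((\<lambda>z. ?y z t) has_derivative (\<lambda>v. t *\<^sub>R v)) (at z)"
      by (auto intro!: derivative_eq_intros)
    ultimately have "((\<lambda>z. f (?y z t)) has_derivative (\<lambda>v. frechet_derivative f (at (?y z t)) (t *\<^sub>R v))) (at z)"
      using diff_chain_at[of "\<lambda>z. ?y z t" _ z f] by (simp add: o_def)
    then have "((\<lambda>z. t ^ m *\<^sub>R f (?y z t)) has_derivative (\<lambda>v. t ^ m *\<^sub>R frechet_derivative f (at (?y z t)) (t *\<^sub>R v))) (at z)"
      by (rule has_derivative_scaleR_right)
    moreover have "(\<lambda>v. t ^ m *\<^sub>R frechet_derivative f (at (?y z t)) (t *\<^sub>R v)) = blinfun_apply (F z t)"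
      using linear_frechet_derivative[of f "at (?y z t)"] f yU[of z t] zt
      by (auto simp: F linear_cmul fun_eq_iff)
    ultimately show ?thesis using has_derivative_at_withinI by metis
  qed
  have cf: "continuous_on U f" using Cp_on_Suc_imp[OF f] by simp
  have "((\<lambda>z. integral (cbox 0 1) (\<lambda>t. t ^ m *\<^sub>R f (?y z t))) has_derivative blinfun_apply (integral (cbox 0 1) (F x)))
    (at x within ball x e)"
  proof (rule leibniz_rule[OF d _ c])
    show "(\<lambda>t. t ^ m *\<^sub>R f (?y z t)) integrable_on cbox 0 1" if "z \<in> ball x e" for z
      using ray_integrable[OF U(2) cf, of z m] that e by auto
  qed (use e in auto)
  moreover have "blinfun_apply (integral (cbox 0 1) (F x)) = (\<lambda>v. ray_integral x0 (Suc m) (\<lambda>y. frechet_derivative f (at y) v) x)"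
  proof
    fix v
    have "continuous_on (cbox 0 1) (F x)"
      using continuous_on_compose2[OF c, of "cbox 0 1" "\<lambda>t. (x, t)"] e
      by (simp add: continuous_on_Pair image_subset_iff)
    then have i: "F x integrable_on cbox 0 1" by (rule integrable_continuous)
    have "blinfun_apply (integral (cbox 0 1) (F x)) v = integral (cbox 0 1) (\<lambda>t. blinfun_apply (F x t) v)"
      using integral_linear[OF i blinfun.bounded_linear_left[of v]] by (simp add: o_def)
    also have "\<dots> = ray_integral x0 (Suc m) (\<lambda>y. frechet_derivative f (at y) v) x"
      unfolding ray_integral_def cbox_interval by (rule integral_cong) (use F[of x] e in auto)
    finally show "blinfun_apply (integral (cbox 0 1) (F x)) v = ray_integral x0 (Suc m) (\<lambda>y. frechet_derivative f (at y) v) x" .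
  qed
  moreover have "(\<lambda>z. integral (cbox 0 1) (\<lambda>t. t ^ m *\<^sub>R f (?y z t))) = ray_integral x0 m f"
    by (simp add: ray_integral_def[abs_def])
  ultimately have "(ray_integral x0 m f has_derivative
     (\<lambda>v. ray_integral x0 (Suc m) (\<lambda>y. frechet_derivative f (at y) v) x)) (at x within ball x e)"
    by simp
  then show ?thesis using e by (simp add: at_within_open[of x "ball x e"])
qed

lemma Cp_on_ray_integral:
  fixes f :: "'a::euclidean_space \<Rightarrow> 'b::euclidean_space"
  assumes U: "open U" "star_at x0 U"
  shows "Cp_on p U f \<Longrightarrow> Cp_on p U (ray_integral x0 m f)"
proof (induction p arbitrary: f m)
  case 0
  then show ?case using ray_integral_continuous[OF U(2)] by simp
next
  case (Suc p)
  have "Cp_on (Suc 0) U f" using Suc.prems Cp_on_Suc_imp[of _ U "\<lambda>x. frechet_derivative f (at x) _"]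
    by (induction p) auto
  show ?case
    by (rule Cp_on_SucI[OF U(1) ray_integral_has_derivative[OF U]])
      (use Suc \<open>Cp_on (Suc 0) U f\<close> in auto)
qed

lemma has_integral_power_01: "((\<lambda>t::real. t ^ m) has_integral 1 / (m + 1)) {0..1}"
proof -
  have "((\<lambda>t. t ^ Suc m / real (Suc m)) has_vector_derivative t ^ m) (at t within {0..1})" for t :: real
    using DERIV_cdivide[OF DERIV_pow[of "Suc m" t "{0..1}"], of "real (Suc m)"]
    by (simp del: of_nat_Suc power_Suc add: has_real_derivative_iff_has_vector_derivative)
  then have "((\<lambda>t::real. t ^ m) has_integral 1 ^ Suc m / real (Suc m) - 0 ^ Suc m / real (Suc m)) {0..1}"
    by (intro fundamental_theorem_of_calculus) auto
  then show ?thesis by (simp add: add.commute)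
qed

text \<open>
  As h tends to 0 the ray from y to y + h u shrinks to y, and the ray integral tends to g(y) / (m + 1).
  This recovers a continuous function from its integrals over short rays.
\<close>

lemma ray_integral_zero_imp:
  fixes g :: "'a::euclidean_space \<Rightarrow> 'b::euclidean_space"
  assumes "\<delta> > 0" and g: "continuous_on S g" and S: "\<And>h. 0 \<le> h \<Longrightarrow> h \<le> \<delta> \<Longrightarrow> y + h *\<^sub>R u \<in> S"
    and z: "\<And>h. 0 < h \<Longrightarrow> h \<le> \<delta> \<Longrightarrow> ray_integral y m g (y + h *\<^sub>R u) = 0"
  shows "g y = 0"
proof -
  let ?F = "\<lambda>h. ray_integral y m g (y + h *\<^sub>R u)"
  have "continuous_on ({0..\<delta>} \<times> cbox (0::real) 1) (\<lambda>(h, t). t ^ m *\<^sub>R g (y + t *\<^sub>R (y + h *\<^sub>R u - y)))"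
    unfolding split_beta
  proof (intro continuous_intros continuous_on_compose2[OF g])
    show "(\<lambda>p. y + snd p *\<^sub>R (y + fst p *\<^sub>R u - y)) ` ({0..\<delta>} \<times> cbox 0 1) \<subseteq> S"
    proof safe
      fix h t :: real assume "h \<in> {0..\<delta>}" "t \<in> cbox 0 1"
      then have "0 \<le> t * h" "t * h \<le> \<delta>" using mult_mono[of t 1 h \<delta>] by auto
      then show "y + snd (h, t) *\<^sub>R (y + fst (h, t) *\<^sub>R u - y) \<in> S" using S[of "t * h"] by simp
    qed
  qed
  from integral_continuous_on_param[OF this] have c: "continuous_on {0..\<delta>} ?F"
    by (simp add: ray_integral_def[abs_def])
  have "?F 0 = 0"
  proof (rule continuous_constant_on_closure[of "{0<..<\<delta>}" ?F 0 0])
    show "continuous_on (closure {0<..<\<delta>}) ?F" using c assms(1) by simp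
  qed (use z assms(1) in auto)
  then have "integral {0..1} (\<lambda>t::real. t ^ m *\<^sub>R g y) = 0" by (simp add: ray_integral_def)
  moreover have "integral {0..1} (\<lambda>t::real. t ^ m *\<^sub>R g y) = (1 / (m + 1)) *\<^sub>R g y"
  proof (rule integral_unique)
    show "((\<lambda>t::real. t ^ m *\<^sub>R g y) has_integral (1 / (m + 1)) *\<^sub>R g y) {0..1}"
      using has_integral_linear[OF has_integral_power_01 bounded_linear_scaleR_left[of "g y"]] by (simp add: o_def add.commute)
  qed
  ultimately show ?thesis by simp
qed

section \<open>Alternating sums over argument lists\<close>

lemma del_nth_0 [simp]: "del_nth 0 (v # ws) = ws"
  by (simp add: del_nth_def)

lemma del_nth_Suc [simp]: "del_nth (Suc i) (v # ws) = v # del_nth i ws"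
  by (simp add: del_nth_def)

lemma length_del_nth [simp]: "i < length vs \<Longrightarrow> length (del_nth i vs) = length vs - 1"
  by (simp add: del_nth_def)

text \<open>
  The common shape of the exterior derivative and of the wedge product with a one-form: one argument
  is fed to the one-form slot, the others to the form, with alternating signs.
\<close>

definition alt_sum :: "('a \<Rightarrow> 'a list \<Rightarrow> 'b::real_vector) \<Rightarrow> 'a list \<Rightarrow> 'b" where
  "alt_sum g vs = (\<Sum>i<length vs. (-1) ^ i *\<^sub>R g (vs ! i) (del_nth i vs))"

lemma alt_sum_Nil [simp]: "alt_sum g [] = 0"
  by (simp add: alt_sum_def)

text \<open>
  Expansion along the first argument. It turns statements on alternating sums into inductions on the
  argument list and spares manipulations of double sums over indices.
\<close>

lemma alt_sum_Cons: "alt_sum g (v # ws) = g v ws - alt_sum (\<lambda>u us. g u (v # us)) ws"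
  by (simp add: alt_sum_def sum.lessThan_Suc_shift sum_negf del: sum.lessThan_Suc)

lemma alt_sum_cong:
  assumes "\<And>v us. length us = length vs - 1 \<Longrightarrow> v \<in> set vs \<Longrightarrow> f v us = g v us"
  shows "alt_sum f vs = alt_sum g vs"
  unfolding alt_sum_def by (rule sum.cong) (auto simp: assms)

lemma alt_sum_lincomb:
  "alt_sum (\<lambda>v us. a *\<^sub>R f v us + b *\<^sub>R g v us) vs = a *\<^sub>R alt_sum f vs + b *\<^sub>R alt_sum g vs"
  by (simp add: alt_sum_def scaleR_add_right sum.distrib scaleR_sum_right mult.commute)

lemma alt_sum_add: "alt_sum (\<lambda>v us. f v us + g v us) vs = alt_sum f vs + alt_sum g vs"
  using alt_sum_lincomb[of 1 f 1 g] by simp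

lemma alt_sum_diff: "alt_sum (\<lambda>v us. f v us - g v us) vs = alt_sum f vs - alt_sum g vs"
  using alt_sum_lincomb[of 1 f "-1" g] by simp

lemma wedge_alt_sum: "wedge A \<omega> x = alt_sum (\<lambda>v ws. blinfun_apply (A x [v]) (\<omega> x ws))"
  by (simp add: wedge_def alt_sum_def fun_eq_iff)

lemma ext_deriv_alt_sum: "ext_deriv \<omega> x = alt_sum (\<lambda>v ws. frechet_derivative (\<lambda>y. \<omega> y ws) (at x) v)"
  by (simp add: ext_deriv_def alt_sum_def fun_eq_iff)

section \<open>Alternating multilinear maps\<close>

lemma alternating_multilinear_cong:
  assumes "\<And>vs. length vs = k \<Longrightarrow> f vs = g vs"
  shows "alternating_multilinear k f = alternating_multilinear k g"
  unfolding alternating_multilinear_def using assms by simp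

lemma alternating_linear: "alternating_multilinear k f \<Longrightarrow> length vs = k \<Longrightarrow> i < k \<Longrightarrow> linear (\<lambda>v. f (vs[i := v]))"
  by (simp add: alternating_multilinear_def)

lemma alternating_linear_mid: 
  assumes "alternating_multilinear k f" "length a + Suc (length c) = k"
  shows "linear (\<lambda>v. f (a @ v # c))"
  using alternating_linear[OF assms(1), of "a @ 0 # c" "length a"] assms(2) by simp

lemma alternating_linear_Cons: 
  assumes "alternating_multilinear (Suc k) f" "length c = k"
  shows "linear (\<lambda>v. f (v # c))"
  using alternating_linear_mid[OF assms(1), of "[]" c] assms(2) by simp

lemma alternating_not_distinct: "alternating_multilinear k f \<Longrightarrow> length vs = k \<Longrightarrow> \<not> distinct vs \<Longrightarrow> f vs = 0"
  by (simp add: alternating_multilinear_def)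

lemma alternating_Cons: 
  assumes "alternating_multilinear (Suc k) f" 
  shows "alternating_multilinear k (\<lambda>us. f (v # us))"
  unfolding alternating_multilinear_def
proof (intro allI impI conjI)
  fix vs :: "'a list" and i assume vs: "length vs = k" 
  show "linear (\<lambda>w. f (v # vs[i := w]))" if "i < k"
    using alternating_linear[OF assms, of "v # vs" "Suc i"] vs that by simp
  show "f (v # vs) = 0" if "\<not> distinct vs"
    using alternating_not_distinct[OF assms, of "v # vs"] vs that by simp
qed

lemma alternating_lincomb:
  assumes "alternating_multilinear k f" "alternating_multilinear k g"
  shows "alternating_multilinear k (\<lambda>vs. a *\<^sub>R f vs + b *\<^sub>R g vs)"
  using assms unfolding alternating_multilinear_def
  by (auto intro!: linear_compose_add linear_compose_scale_right)

lemma alternating_diff: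
  assumes "alternating_multilinear k f" "alternating_multilinear k g"
  shows "alternating_multilinear k (\<lambda>vs. f vs - g vs)"
  using alternating_lincomb[OF assms, of 1 "-1"] by simp

text \<open>
  Polarisation: the form vanishes when both arguments equal u + v, u or v.
\<close>

lemma alternating_swap:
  assumes f: "alternating_multilinear k f" and l: "length a + Suc (Suc (length c)) = k"
  shows "f (a @ u # v # c) = - f (a @ v # u # c)"
proof -
  let ?g = "\<lambda>u v. f (a @ u # v # c)"
  have 1: "linear (\<lambda>u. ?g u v)" for v using alternating_linear_mid[OF f, of a "v # c"] l by simp
  have 2: "linear (\<lambda>v. ?g u v)" for u using alternating_linear_mid[OF f, of "a @ [u]" c] l by simp
  have 0: "?g w w = 0" for w using alternating_not_distinct[OF f, of "a @ w # w # c"] l by simp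
  have "?g (u + v) (u + v) = ?g u u + ?g u v + (?g v u + ?g v v)"
    by (simp only: linear_add[OF 1] linear_add[OF 2]) simp
  then show ?thesis by (simp add: 0 eq_neg_iff_add_eq_0)
qed

lemma alternating_move:
  assumes "alternating_multilinear k f" "length b + length a + Suc (length c) = k"
  shows "f (b @ v # a @ c) = (-1) ^ length a *\<^sub>R f (b @ a @ v # c)"
  using assms(2)
proof (induction a arbitrary: b)
  case (Cons x a)
  have "f (b @ v # (x # a) @ c) = - f (b @ x # v # a @ c)"
    using alternating_swap[OF assms(1), of b "a @ c" v x] Cons.prems by simp
  also have "\<dots> = - ((-1) ^ length a *\<^sub>R f ((b @ [x]) @ a @ v # c))"
    using Cons.IH[of "b @ [x]"] Cons.prems by simp
  finally show ?case by simp
qed simp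

text \<open>
  Each summand of the alternating sum of f over its own arguments equals f: the sign of the cyclic
  permutation cancels the sign in the sum.
\<close>

lemma alternating_move_front:
  assumes "alternating_multilinear k f" "length vs = k" "i < k"
  shows "f ((vs ! i) # del_nth i vs) = (-1) ^ i *\<^sub>R f vs"
  using alternating_move[OF assms(1), of "[]" "take i vs" "drop (Suc i) vs" "vs ! i"] assms(2,3)
  by (simp add: del_nth_def id_take_nth_drop[symmetric])

lemma alt_sum_of_alternating:
  assumes "alternating_multilinear k f" "length vs = k"
  shows "alt_sum (\<lambda>v us. f (v # us)) vs = real k *\<^sub>R f vs"
proof -
  have "alt_sum (\<lambda>v us. f (v # us)) vs = (\<Sum>i<k. (-1) ^ i *\<^sub>R (-1) ^ i *\<^sub>R f vs)"
    unfolding alt_sum_def using assms by (intro sum.cong) (auto simp: alternating_move_front)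
  also have "\<dots> = (\<Sum>i<k. f vs)" by (simp flip: power_mult_distrib)
  finally show ?thesis by (simp add: scaleR_conv_of_real sum_constant_scaleR)
qed

lemma linear_alt_sum_slot:
  assumes "\<And>us. length us = k \<Longrightarrow> linear (\<lambda>v. g v us)"
    and "\<And>v. alternating_multilinear k (g v)" and "length vs = Suc k" "i < Suc k"
  shows "linear (\<lambda>v. alt_sum g (vs[i := v]))"
  using assms
proof (induction vs arbitrary: g k i)
  case (Cons w ws)
  show ?case
  proof (cases i)
    case 0
    have "linear (\<lambda>v. alt_sum (\<lambda>u us. g u (v # us)) ws)"
      unfolding alt_sum_def
    proof (intro linear_compose_sum ballI linear_compose_scale_right)
      fix j assume j: "j \<in> {..<length ws}"
      then obtain k' where k': "k = Suc k'" using Cons.prems by (cases k) auto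
      then show "linear (\<lambda>x. g (ws ! j) (x # del_nth j ws))"
        using alternating_linear_Cons[of k' "g (ws ! j)"] Cons.prems j by simp
    qed
    then show ?thesis using Cons.prems 0 by (simp add: alt_sum_Cons linear_compose_sub)
  next
    case (Suc i')
    then obtain k' where k': "k = Suc k'" using Cons.prems by (cases k) auto
    have "linear (\<lambda>v. alt_sum (\<lambda>u us. g u (w # us)) (ws[i' := v]))"
      using Cons.prems Suc k' by (intro Cons.IH[of k']) (auto intro: alternating_Cons)
    moreover have "linear (\<lambda>v. g w (ws[i' := v]))"
      using Cons.prems Suc by (intro alternating_linear[of k]) auto
    ultimately show ?thesis using Suc by (simp add: alt_sum_Cons linear_compose_sub)
  qed
qed simp

text \<open>
  If the repeated entry lies in the tail, both terms of the expansion along the first argument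
  vanish, the second by induction. If the first entry w occurs again at position j of the tail, the
  only surviving summand of the second term is the one with index j, and moving w back to its place
  shows that it cancels the first term.
\<close>

lemma alt_sum_not_distinct:
  assumes "\<And>v. alternating_multilinear k (g v)" and "length vs = Suc k" "\<not> distinct vs"
  shows "alt_sum g vs = 0"
  using assms
proof (induction vs arbitrary: g k)
  case (Cons w ws)
  then obtain k' where k': "k = Suc k'" by (cases k) auto
  show ?case
  proof (cases "distinct ws")
    case False
    have "alt_sum (\<lambda>u us. g u (w # us)) ws = 0"
      using Cons.prems k' False by (intro Cons.IH[of k']) (auto intro: alternating_Cons)
    moreover have "g w ws = 0" using alternating_not_distinct Cons.prems False by auto
    ultimately show ?thesis by (simp add: alt_sum_Cons)
  next
    case True
    then have "w \<in> set ws" using Cons.prems by simp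
    then obtain j where j: "j < length ws" "ws ! j = w" by (auto simp: in_set_conv_nth)
    have "alt_sum (\<lambda>u us. g u (w # us)) ws = (\<Sum>i<length ws. if i = j then g w ws else 0)"
      unfolding alt_sum_def
    proof (rule sum.cong)
      fix i assume i: "i \<in> {..<length ws}"
      show "(-1) ^ i *\<^sub>R g (ws ! i) (w # del_nth i ws) = (if i = j then g w ws else 0)"
      proof (cases "i = j")
        case True
        then show ?thesis using alternating_move_front[OF Cons.prems(1)[of w], of ws j] j Cons.prems
          by (simp flip: power_mult_distrib)
      next
        case False
        have "w \<in> set (del_nth i ws)"
        proof (cases "j < i")
          case True
          then have "w = take i ws ! j" "j < length (take i ws)" using j i by auto
          then have "w \<in> set (take i ws)" using nth_mem by metis
          then show ?thesis by (simp add: del_nth_def)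
        next
          case F: False
          then have "w = drop (Suc i) ws ! (j - Suc i)" "j - Suc i < length (drop (Suc i) ws)"
            using j i False by auto
          then have "w \<in> set (drop (Suc i) ws)" using nth_mem by metis
          then show ?thesis by (simp add: del_nth_def)
        qed
        then have "g (ws ! i) (w # del_nth i ws) = 0"
          using alternating_not_distinct[OF Cons.prems(1)] i Cons.prems by auto
        then show ?thesis using False by simp
      qed
    qed simp
    also have "\<dots> = g w ws" using j by simp
    finally show ?thesis by (simp add: alt_sum_Cons)
  qed
qed simp

lemma alternating_alt_sum:
  assumes "\<And>us. length us = k \<Longrightarrow> linear (\<lambda>v. g v us)" "\<And>v. alternating_multilinear k (g v)"
  shows "alternating_multilinear (Suc k) (alt_sum g)"
  unfolding alternating_multilinear_def
  using linear_alt_sum_slot[of k g] alt_sum_not_distinct[of k g] assms by blast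

text \<open>
  The combinatorial core of d d = 0. Expanding both sums along the first argument w leaves
  two sums with w in the first or in the second slot of B, which cancel by symmetry, and a double sum
  over the tail, which vanishes by induction.
\<close>

lemma alt_sum_symmetric:
  assumes "\<And>u v us. length us + 2 = length vs \<Longrightarrow> B u v us = B v u us"
  shows "alt_sum (\<lambda>u us. alt_sum (B u) us) vs = 0"
  using assms
proof (induction vs arbitrary: B)
  case (Cons w ws)
  have "alt_sum (\<lambda>u us. alt_sum (B u) (w # us)) ws
      = alt_sum (\<lambda>u us. B u w us) ws - alt_sum (\<lambda>u us. alt_sum (\<lambda>v us. B u v (w # us)) us) ws"
    by (simp add: alt_sum_Cons alt_sum_diff)
  also have "alt_sum (\<lambda>u us. alt_sum (\<lambda>v us. B u v (w # us)) us) ws = 0"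
    using Cons.prems by (intro Cons.IH) auto
  also have "alt_sum (\<lambda>u us. B u w us) ws = alt_sum (B w) ws"
    by (rule alt_sum_cong) (use Cons.prems in \<open>cases ws; auto\<close>)
  finally show ?case by (simp add: alt_sum_Cons)
qed simp

section \<open>Bounds from values on basis vectors\<close>

text \<open>
  With the sum norm on vectors, bounds on the values at basis vectors extend to all arguments with the
  same constant, and basis vectors have norm 1.
\<close>

definition l1_norm :: "'a::euclidean_space \<Rightarrow> real" where
  "l1_norm v = (\<Sum>b\<in>Basis. \<bar>v \<bullet> b\<bar>)"

lemma l1_norm_nonneg [simp]: "0 \<le> l1_norm v"
  by (simp add: l1_norm_def sum_nonneg)

lemma l1_norm_scaleR: "l1_norm (c *\<^sub>R v) = \<bar>c\<bar> * l1_norm v"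
  by (simp add: l1_norm_def abs_mult sum_distrib_left)

lemma l1_norm_Basis: "b \<in> Basis \<Longrightarrow> l1_norm b = 1"
  by (simp add: l1_norm_def inner_Basis if_distrib[of abs] cong: if_cong)

lemma continuous_on_l1_norm: "continuous_on S (\<lambda>x. l1_norm (x - a))"
  unfolding l1_norm_def by (intro continuous_intros)

lemma l1_norm_le: "l1_norm (v :: 'a::euclidean_space) \<le> real DIM('a) * norm v"
proof -
  have "l1_norm v \<le> (\<Sum>b\<in>(Basis::'a set). norm v)" unfolding l1_norm_def by (intro sum_mono Basis_le_norm)
  then show ?thesis by simp
qed

lemma norm_linear_le_l1:
  fixes f :: "'a::euclidean_space \<Rightarrow> 'b::real_normed_vector"
  assumes "linear f" "\<And>b. b \<in> Basis \<Longrightarrow> norm (f b) \<le> M"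
  shows "norm (f v) \<le> M * l1_norm v"
proof -
  have "f v = f (\<Sum>b\<in>Basis. (v \<bullet> b) *\<^sub>R b)" by (simp add: euclidean_representation)
  also have "\<dots> = (\<Sum>b\<in>Basis. (v \<bullet> b) *\<^sub>R f b)"
    by (simp add: linear_sum[OF assms(1)] linear_cmul[OF assms(1)])
  also have "norm \<dots> \<le> (\<Sum>b\<in>Basis. M * \<bar>v \<bullet> b\<bar>)"
    by (rule sum_norm_le) (use assms(2) in \<open>auto simp: mult.commute[of M] intro: mult_left_mono\<close>)
  finally show ?thesis by (simp add: l1_norm_def sum_distrib_left)
qed

abbreviation l1_prod :: "'a::euclidean_space list \<Rightarrow> real" where
  "l1_prod vs \<equiv> prod_list (map l1_norm vs)"

lemma l1_prod_nonneg [simp]: "0 \<le> l1_prod vs"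
  by (induction vs) auto

lemma l1_prod_Basis: "set I \<subseteq> Basis \<Longrightarrow> l1_prod I = 1"
  by (induction I) (auto simp: l1_norm_Basis)

lemma l1_prod_del_nth: "i < length vs \<Longrightarrow> l1_norm (vs ! i) * l1_prod (del_nth i vs) = l1_prod vs"
  by (subst (3) id_take_nth_drop[of i vs]) (auto simp: del_nth_def)

lemma alternating_bound_of_Basis:
  fixes f :: "'a::euclidean_space list \<Rightarrow> 'b::real_normed_vector"
  assumes "alternating_multilinear k f" "\<And>I. set I \<subseteq> Basis \<Longrightarrow> length I = k \<Longrightarrow> norm (f I) \<le> M" "length vs = k"
  shows "norm (f vs) \<le> M * l1_prod vs"
  using assms
proof (induction vs arbitrary: k f M)
  case Nil
  then show ?case by (metis list.map(1) prod_list.Nil mult.right_neutral empty_set empty_subsetI)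
next
  case (Cons v vs)
  then obtain k' where k': "k = Suc k'" by (cases k) auto
  have "norm (f (v # vs)) \<le> (M * l1_prod vs) * l1_norm v"
  proof (rule norm_linear_le_l1)
    show "linear (\<lambda>v. f (v # vs))" using Cons.prems k' by (intro alternating_linear_Cons[of k']) auto
    show "norm (f (b # vs)) \<le> M * l1_prod vs" if "b \<in> Basis" for b
      using Cons.IH[of k' "\<lambda>us. f (b # us)" M] Cons.prems k' that by (auto intro: alternating_Cons)
  qed
  then show ?case by (simp add: mult_ac)
qed

lemma norm_alt_sum_le:
  assumes "\<And>v us. length us + 1 = length vs \<Longrightarrow> norm (g v us) \<le> M * (l1_norm v * l1_prod us)"
  shows "norm (alt_sum g vs) \<le> real (length vs) * M * l1_prod vs"
proof -
  have "norm (alt_sum g vs) \<le> (\<Sum>i<length vs. M * l1_prod vs)"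
    unfolding alt_sum_def
  proof (rule sum_norm_le)
    fix i assume i: "i \<in> {..<length vs}"
    then have "norm (g (vs ! i) (del_nth i vs)) \<le> M * (l1_norm (vs ! i) * l1_prod (del_nth i vs))"
      by (intro assms) auto
    then show "norm ((-1) ^ i *\<^sub>R g (vs ! i) (del_nth i vs)) \<le> M * l1_prod vs"
      using i by (simp add: l1_prod_del_nth power_abs)
  qed
  then show ?thesis by simp
qed

section \<open>Forms and their exterior derivative\<close>

lemma dforms_alternating: "\<omega> \<in> dforms k p U \<Longrightarrow> x \<in> U \<Longrightarrow> alternating_multilinear k (\<omega> x)"
  by (simp add: dforms_def)

lemma dforms_Cp: "\<omega> \<in> dforms k p U \<Longrightarrow> enat q \<le> p \<Longrightarrow> length vs = k \<Longrightarrow> Cp_on q U (\<lambda>x. \<omega> x vs)"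
  by (simp add: dforms_def)

lemma dforms_smooth: "\<omega> \<in> dforms k \<infinity> U \<Longrightarrow> length vs = k \<Longrightarrow> Cp_on q U (\<lambda>x. \<omega> x vs)"
  by (simp add: dforms_def)

lemma dforms_continuous: "\<omega> \<in> dforms k p U \<Longrightarrow> length vs = k \<Longrightarrow> continuous_on U (\<lambda>x. \<omega> x vs)"
  using dforms_Cp[of \<omega> k p U 0 vs] by (simp add: zero_enat_def[symmetric])

lemma dforms_0_iff:
  "\<omega> \<in> dforms k 0 U \<longleftrightarrow> (\<forall>x\<in>U. alternating_multilinear k (\<omega> x)) \<and>
     (\<forall>vs. length vs = k \<longrightarrow> continuous_on U (\<lambda>x. \<omega> x vs))"
  by (auto simp: dforms_def zero_enat_def)

lemma dforms_imp_continuous: "\<omega> \<in> dforms k p U \<Longrightarrow> \<omega> \<in> dforms k 0 U"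
  using dforms_continuous[of \<omega> k p U] by (auto simp: dforms_0_iff dforms_alternating)

lemma dforms_subset: "\<omega> \<in> dforms k p U \<Longrightarrow> W \<subseteq> U \<Longrightarrow> \<omega> \<in> dforms k p W"
  using Cp_on_subset by (fastforce simp: dforms_def)

lemma dforms_lincomb:
  assumes "open U" "\<omega> \<in> dforms k p U" "\<eta> \<in> dforms k p U"
  shows "(\<lambda>x vs. a *\<^sub>R \<omega> x vs + b *\<^sub>R \<eta> x vs) \<in> dforms k p U"
  using assms by (auto simp: dforms_def intro!: alternating_lincomb Cp_on_lincomb)

lemma dforms_zero: "open U \<Longrightarrow> zero_form \<in> dforms k p U"
  by (auto simp: dforms_def alternating_multilinear_def intro!: Cp_on_const linear_zero)

lemma dforms_cong:
  assumes "form_eq k U \<omega> \<eta>" "\<omega> \<in> dforms k 0 U"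
  shows "\<eta> \<in> dforms k 0 U"
  unfolding dforms_0_iff
proof (intro conjI ballI allI impI)
  show "alternating_multilinear k (\<eta> x)" if "x \<in> U" for x
    using alternating_multilinear_cong[of k "\<omega> x" "\<eta> x"] dforms_alternating[OF assms(2) that] assms(1) that
    by (simp add: form_eq_def)
  show "continuous_on U (\<lambda>x. \<eta> x vs)" if "length vs = k" for vs
    using dforms_continuous[OF assms(2) that] assms(1) that continuous_on_cong[of U U "\<lambda>x. \<omega> x vs" "\<lambda>x. \<eta> x vs"]
    by (simp add: form_eq_def)
qed

lemma form_eq_sym: "form_eq k U \<omega> \<eta> \<Longrightarrow> form_eq k U \<eta> \<omega>"
  by (simp add: form_eq_def)

lemma linear_expand_Basis:
  fixes f :: "'a::euclidean_space \<Rightarrow> 'b::real_vector"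
  assumes "linear f" shows "f v = (\<Sum>b\<in>Basis. (v \<bullet> b) *\<^sub>R f b)"
proof -
  have "f v = f (\<Sum>b\<in>Basis. (v \<bullet> b) *\<^sub>R b)" by (simp add: euclidean_representation)
  then show ?thesis by (simp only: linear_sum[OF assms(1)] linear_cmul[OF assms(1)])
qed

lemma frechet_derivative_lincomb:
  assumes "f differentiable (at x)" "g differentiable (at x)"
  shows "frechet_derivative (\<lambda>y. a *\<^sub>R f y + b *\<^sub>R g y) (at x) v
     = a *\<^sub>R frechet_derivative f (at x) v + b *\<^sub>R frechet_derivative g (at x) v"
proof -
  have "((\<lambda>y. a *\<^sub>R f y + b *\<^sub>R g y) has_derivative
     (\<lambda>v. a *\<^sub>R frechet_derivative f (at x) v + b *\<^sub>R frechet_derivative g (at x) v)) (at x)"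
    using assms by (auto intro!: derivative_eq_intros simp: frechet_derivative_works)
  from frechet_derivative_at[OF this] show ?thesis by metis
qed

lemma frechet_derivative_cong_open:
  assumes "open U" "x \<in> U" "\<And>y. y \<in> U \<Longrightarrow> f y = g y" "f differentiable (at x)"
  shows "frechet_derivative f (at x) = frechet_derivative g (at x)"
  using frechet_derivative_transform_within_open[of f x U g] assms by blast

lemma alternating_frechet_derivative:
  assumes U: "open U" "x \<in> U" and \<omega>: "\<omega> \<in> dforms k p U" "1 \<le> p"
  shows "alternating_multilinear k (\<lambda>ws. frechet_derivative (\<lambda>y. \<omega> y ws) (at x) v)"
  unfolding alternating_multilinear_def
proof (intro allI impI conjI)
  have d: "(\<lambda>y. \<omega> y ws) differentiable (at x)" if "length ws = k" for ws
    using dforms_Cp[OF \<omega>(1), of "Suc 0" ws] \<omega>(2) that U by (simp add: one_enat_def)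
  fix vs :: "'a list" assume l: "length vs = k"
  show "frechet_derivative (\<lambda>y. \<omega> y vs) (at x) v = 0" if "\<not> distinct vs"
    using frechet_derivative_cong_open[OF U, of "\<lambda>y. 0" "\<lambda>y. \<omega> y vs"] alternating_not_distinct[OF dforms_alternating[OF \<omega>(1)] l that]
    by (simp add: fun_eq_iff)
  fix i assume i: "i < k"
  have "frechet_derivative (\<lambda>y. \<omega> y (vs[i := a *\<^sub>R u + b *\<^sub>R w])) (at x) v =
     a *\<^sub>R frechet_derivative (\<lambda>y. \<omega> y (vs[i := u])) (at x) v + b *\<^sub>R frechet_derivative (\<lambda>y. \<omega> y (vs[i := w])) (at x) v" for a b u w
  proof -
    have "\<omega> y (vs[i := a *\<^sub>R u + b *\<^sub>R w]) = a *\<^sub>R \<omega> y (vs[i := u]) + b *\<^sub>R \<omega> y (vs[i := w])" if "y \<in> U" for y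
    proof -
      note L = alternating_linear[OF dforms_alternating[OF \<omega>(1) that] l i]
      show ?thesis by (simp only: linear_add[OF L] linear_cmul[OF L])
    qed
    from frechet_derivative_cong_open[OF U this] d l
    show ?thesis by (simp add: frechet_derivative_lincomb)
  qed
  from this[of 1 _ 1] this[of _ _ 0]
  show "linear (\<lambda>w. frechet_derivative (\<lambda>y. \<omega> y (vs[i := w])) (at x) v)"
    by (auto intro!: linearI)
qed

lemma ext_deriv_dforms:
  assumes U: "open U" and \<omega>: "\<omega> \<in> dforms k \<infinity> U"
  shows "ext_deriv \<omega> \<in> dforms (Suc k) \<infinity> U"
proof -
  have "alternating_multilinear (Suc k) (ext_deriv \<omega> x)" if "x \<in> U" for x
    unfolding ext_deriv_alt_sum
  proof (rule alternating_alt_sum)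
    show "linear (\<lambda>v. frechet_derivative (\<lambda>y. \<omega> y us) (at x) v)" if "length us = k" for us
      using dforms_smooth[OF \<omega> that, of "Suc 0"] \<open>x \<in> U\<close> by (simp add: linear_frechet_derivative)
  qed (use alternating_frechet_derivative[OF U that \<omega>] in auto)
  moreover have "Cp_on q U (\<lambda>x. ext_deriv \<omega> x vs)" if "length vs = Suc k" for q vs
    unfolding ext_deriv_def
  proof (rule Cp_on_sum[OF U])
    fix i assume "i \<in> {..<length vs}"
    then have "Cp_on (Suc q) U (\<lambda>y. \<omega> y (del_nth i vs))" using that by (intro dforms_smooth[OF \<omega>]) auto
    then show "Cp_on q U (\<lambda>x. frechet_derivative (\<lambda>y. \<omega> y (del_nth i vs)) (at x) (vs ! i))" by simp
  qed
  ultimately show ?thesis by (simp add: dforms_def)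
qed

lemma ext_deriv_lincomb:
  assumes "\<omega> \<in> dforms k \<infinity> U" "\<eta> \<in> dforms k \<infinity> U" "x \<in> U" "length vs = Suc k"
  shows "ext_deriv (\<lambda>x vs. a *\<^sub>R \<omega> x vs + b *\<^sub>R \<eta> x vs) x vs = a *\<^sub>R ext_deriv \<omega> x vs + b *\<^sub>R ext_deriv \<eta> x vs"
  unfolding ext_deriv_alt_sum alt_sum_lincomb[symmetric]
proof (rule alt_sum_cong)
  fix v us assume "length (us :: 'a list) = length vs - 1"
  then have "Cp_on (Suc 0) U (\<lambda>y. \<omega> y us)" "Cp_on (Suc 0) U (\<lambda>y. \<eta> y us)"
    using dforms_smooth[OF assms(1), of us "Suc 0"] dforms_smooth[OF assms(2), of us "Suc 0"] assms(4) by auto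
  then show "frechet_derivative (\<lambda>y. a *\<^sub>R \<omega> y us + b *\<^sub>R \<eta> y us) (at x) v =
     a *\<^sub>R frechet_derivative (\<lambda>y. \<omega> y us) (at x) v + b *\<^sub>R frechet_derivative (\<lambda>y. \<eta> y us) (at x) v"
    using assms(3) by (intro frechet_derivative_lincomb) auto
qed

section \<open>The homotopy formula for smooth forms\<close>

lemma ray_integral_cong:
  fixes x0 :: "'a::euclidean_space"
  assumes "star_at x0 U" "x \<in> U" "\<And>y. y \<in> U \<Longrightarrow> f y = g y"
  shows "ray_integral x0 m f x = ray_integral x0 m g x"
  unfolding ray_integral_def by (rule integral_cong) (use assms star_atD in fastforce)

lemma ray_integral_lincomb:
  fixes x0 :: "'a::euclidean_space"
  assumes "star_at x0 U" "x \<in> U" "continuous_on U f" "continuous_on U g"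
  shows "ray_integral x0 m (\<lambda>y. a *\<^sub>R f y + b *\<^sub>R g y) x = a *\<^sub>R ray_integral x0 m f x + b *\<^sub>R ray_integral x0 m g x"
proof -
  note i = integrable_cmul[OF ray_integrable[OF assms(1) _ assms(2), of _ m]]
  have "ray_integral x0 m (\<lambda>y. a *\<^sub>R f y + b *\<^sub>R g y) x =
     integral {0..1} (\<lambda>t. a *\<^sub>R (t ^ m *\<^sub>R f (x0 + t *\<^sub>R (x - x0))) + b *\<^sub>R (t ^ m *\<^sub>R g (x0 + t *\<^sub>R (x - x0))))"
    unfolding ray_integral_def by (simp add: algebra_simps)
  also have "\<dots> = a *\<^sub>R ray_integral x0 m f x + b *\<^sub>R ray_integral x0 m g x"
    unfolding ray_integral_def using i[OF assms(3), of a] i[OF assms(4), of b]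
    by (simp only: integral_add integral_cmul)
  finally show ?thesis .
qed

lemma ray_integral_linear:
  fixes x0 :: "'a::euclidean_space"
  assumes "star_at x0 U" "x \<in> U" "\<And>y. y \<in> U \<Longrightarrow> linear (f y)" "\<And>v. continuous_on U (\<lambda>y. f y v)"
  shows "linear (\<lambda>v. ray_integral x0 m (\<lambda>y. f y v) x)"
proof -
  have "ray_integral x0 m (\<lambda>y. f y (a *\<^sub>R u + b *\<^sub>R w)) x = 
     a *\<^sub>R ray_integral x0 m (\<lambda>y. f y u) x + b *\<^sub>R ray_integral x0 m (\<lambda>y. f y w) x" for a b u w
    unfolding ray_integral_lincomb[OF assms(1,2,4,4), symmetric]
    by (rule ray_integral_cong[OF assms(1,2)]) (simp add: assms(3) linear_add linear_cmul)
  from this[of 1 _ 1] this[of _ _ 0] show ?thesis by (auto intro!: linearI)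
qed

lemma alt_sum_ray_integral:
  fixes x0 :: "'a::euclidean_space"
  assumes "star_at x0 U" "x \<in> U" "\<And>v us. length us + 1 = length vs \<Longrightarrow> continuous_on U (\<lambda>y. g y v us)"
  shows "alt_sum (\<lambda>v us. ray_integral x0 m (\<lambda>y. g y v us) x) vs = ray_integral x0 m (\<lambda>y. alt_sum (g y) vs) x"
proof -
  have "ray_integral x0 m (\<lambda>y. alt_sum (g y) vs) x =
     integral {0..1} (\<lambda>t. \<Sum>i<length vs. (-1) ^ i *\<^sub>R (t ^ m *\<^sub>R g (x0 + t *\<^sub>R (x - x0)) (vs ! i) (del_nth i vs)))"
    by (simp add: ray_integral_def alt_sum_def scaleR_sum_right mult.commute)
  also have "\<dots> = (\<Sum>i<length vs. integral {0..1} (\<lambda>t. (-1) ^ i *\<^sub>R (t ^ m *\<^sub>R g (x0 + t *\<^sub>R (x - x0)) (vs ! i) (del_nth i vs))))"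
    by (intro integral_sum integrable_cmul ray_integrable[OF assms(1) _ assms(2)] assms(3)) auto
  finally show ?thesis by (simp only: alt_sum_def ray_integral_def integral_cmul)
qed

text \<open>
  The fundamental theorem of calculus for t^n f(x0 + t (x - x0)). The value at t = 0 survives only for
  n = 0, which separates degree 0 from positive degrees in the homotopy formula.
\<close>

lemma ray_integral_FTC:
  fixes f :: "'a::euclidean_space \<Rightarrow> 'b::euclidean_space"
  assumes U: "star_at x0 U" "x \<in> U" and f: "Cp_on (Suc 0) U f"
  shows "real n *\<^sub>R ray_integral x0 (n - 1) f x + ray_integral x0 n (\<lambda>y. frechet_derivative f (at y) (x - x0)) x
     = f x - 0 ^ n *\<^sub>R f x0"
proof -
  let ?y = "\<lambda>t. x0 + t *\<^sub>R (x - x0)"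
  have "((\<lambda>t. t ^ n *\<^sub>R f (?y t)) has_vector_derivative
     (real n * t ^ (n - 1)) *\<^sub>R f (?y t) + t ^ n *\<^sub>R frechet_derivative f (at (?y t)) (x - x0)) (at t within {0..1})"
    if "t \<in> {0..1}" for t
  proof -
    have "(f has_derivative frechet_derivative f (at (?y t))) (at (?y t))"
      using Cp_on_SucD[OF f] star_atD[OF U] that by auto
    moreover have "(?y has_vector_derivative (x - x0)) (at t)"
      by (auto intro!: derivative_eq_intros)
    ultimately have "((\<lambda>t. f (?y t)) has_vector_derivative frechet_derivative f (at (?y t)) (x - x0)) (at t)"
      using vector_derivative_diff_chain_within[of ?y "x - x0" t UNIV f] has_derivative_at_withinI by (force simp: o_def)
    moreover have "((\<lambda>t. t ^ n) has_real_derivative real n * t ^ (n - 1)) (at t)"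
      using DERIV_pow[of n t] by simp
    ultimately have "((\<lambda>t. t ^ n *\<^sub>R f (?y t)) has_vector_derivative
       t ^ n *\<^sub>R frechet_derivative f (at (?y t)) (x - x0) + (real n * t ^ (n - 1)) *\<^sub>R f (?y t)) (at t)"
      by (intro has_vector_derivative_scaleR)
    then show ?thesis by (simp add: has_vector_derivative_at_within add.commute)
  qed
  from fundamental_theorem_of_calculus[OF zero_le_one this]
  have "((\<lambda>t. (real n * t ^ (n - 1)) *\<^sub>R f (?y t) + t ^ n *\<^sub>R frechet_derivative f (at (?y t)) (x - x0))
     has_integral f x - 0 ^ n *\<^sub>R f x0) {0..1}" by simp
  from integral_unique[OF this]
  have "integral {0..1} (\<lambda>t. real n *\<^sub>R (t ^ (n - 1) *\<^sub>R f (?y t)) + t ^ n *\<^sub>R frechet_derivative f (at (?y t)) (x - x0))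
     = f x - 0 ^ n *\<^sub>R f x0" by simp
  moreover have "(\<lambda>t. t ^ (n - 1) *\<^sub>R f (?y t)) integrable_on {0..1}"
    using ray_integrable[OF U(1) _ U(2)] Cp_on_Suc_imp[OF f] by simp
  moreover have "(\<lambda>t. t ^ n *\<^sub>R frechet_derivative f (at (?y t)) (x - x0)) integrable_on {0..1}"
    using ray_integrable[OF U(1) _ U(2), of "\<lambda>y. frechet_derivative f (at y) (x - x0)"] f by simp
  ultimately show ?thesis
    unfolding ray_integral_def by (simp only: integral_add integrable_cmul integral_cmul)
qed

lemma homotopy_op_eq: "homotopy_op x0 (Suc m) \<omega> x vs = ray_integral x0 m (\<lambda>y. \<omega> y ((x - x0) # vs)) x"
  by (simp add: homotopy_op_def ray_integral_def)

lemma ray_integral_form_linear: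
  assumes "star_at x0 U" "x \<in> U" "\<omega> \<in> dforms (Suc m) p U" "length vs = m"
  shows "linear (\<lambda>v. ray_integral x0 n (\<lambda>y. \<omega> y (v # vs)) x)"
proof (rule ray_integral_linear[OF assms(1,2)])
  show "linear (\<lambda>v. \<omega> y (v # vs))" if "y \<in> U" for y
    using alternating_linear_Cons[OF dforms_alternating[OF assms(3) that] assms(4)] .
  show "continuous_on U (\<lambda>y. \<omega> y (v # vs))" for v
    using dforms_continuous[OF assms(3), of "v # vs"] assms(4) by simp
qed

text \<open>
  The point x enters the homotopy operator both as the endpoint of the ray and as the first argument of
  the form. Expanding this argument in coordinates separates the two roles, so that differentiability
  reduces to that of ray integrals and of linear functions.
\<close>

lemma homotopy_op_expand:
  assumes "star_at x0 U" "x \<in> U" "\<omega> \<in> dforms (Suc m) p U" "length vs = m"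
  shows "homotopy_op x0 (Suc m) \<omega> x vs = (\<Sum>b\<in>Basis. ((x - x0) \<bullet> b) *\<^sub>R ray_integral x0 m (\<lambda>y. \<omega> y (b # vs)) x)"
  unfolding homotopy_op_eq by (rule linear_expand_Basis[OF ray_integral_form_linear[OF assms]])

lemma homotopy_op_dforms:
  fixes \<omega> :: "('a::euclidean_space, 'v::euclidean_space) dform"
  assumes U: "open U" "star_at x0 U" and \<omega>: "\<omega> \<in> dforms (Suc m) p U"
  shows "homotopy_op x0 (Suc m) \<omega> \<in> dforms m p U"
proof -
  have "Cp_on q U (\<lambda>x. homotopy_op x0 (Suc m) \<omega> x vs)" if "length vs = m" "enat q \<le> p" for q vs
  proof (rule Cp_on_cong[OF U(1)])
    have "Cp_on q U (\<lambda>x. \<Sum>b\<in>Basis. 1 *\<^sub>R (((x - x0) \<bullet> b) *\<^sub>R ray_integral x0 m (\<lambda>y. \<omega> y (b # vs)) x))"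
      by (intro Cp_on_sum U(1) Cp_on_mult_affine Cp_on_ray_integral U dforms_Cp[OF \<omega>]) (use that in auto)
    then show "Cp_on q U (\<lambda>x. \<Sum>b\<in>Basis. ((x - x0) \<bullet> b) *\<^sub>R ray_integral x0 m (\<lambda>y. \<omega> y (b # vs)) x)" by simp
  qed (simp add: homotopy_op_expand[OF U(2) _ \<omega> that(1)])
  moreover have "alternating_multilinear m (homotopy_op x0 (Suc m) \<omega> x)" if x: "x \<in> U" for x
    unfolding alternating_multilinear_def
  proof (intro allI impI conjI)
    fix vs :: "'a list" and i assume l: "length vs = m"
    show "linear (\<lambda>v. homotopy_op x0 (Suc m) \<omega> x (vs[i := v]))" if "i < m"
      unfolding homotopy_op_eq
    proof (rule ray_integral_linear[OF U(2) x])
      show "linear (\<lambda>v. \<omega> y ((x - x0) # vs[i := v]))" if "y \<in> U" for y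
        using alternating_linear[OF dforms_alternating[OF \<omega> that], of "(x - x0) # vs" "Suc i"] l \<open>i < m\<close> by simp
    qed (use l in \<open>auto intro: dforms_continuous[OF \<omega>]\<close>)
    show "homotopy_op x0 (Suc m) \<omega> x vs = 0" if "\<not> distinct vs"
    proof -
      have "ray_integral x0 m (\<lambda>y. \<omega> y ((x - x0) # vs)) x = ray_integral x0 m (\<lambda>y. 0) x"
        by (rule ray_integral_cong[OF U(2) x]) (use alternating_not_distinct[OF dforms_alternating[OF \<omega>]] l that in auto)
      then show ?thesis by (simp add: homotopy_op_eq ray_integral_def)
    qed
  qed
  ultimately show ?thesis by (simp add: dforms_def)
qed

text \<open>
  The two summands come from the two occurrences of x: the first differentiates the argument x - x0,
  the second the endpoint of the ray.
\<close>

lemma homotopy_op_has_derivative: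
  fixes \<omega> :: "('a::euclidean_space, 'v::euclidean_space) dform"
  assumes U: "open U" "star_at x0 U" "x \<in> U" and \<omega>: "\<omega> \<in> dforms (Suc m) p U" "1 \<le> p" and l: "length ws = m"
  shows "((\<lambda>z. homotopy_op x0 (Suc m) \<omega> z ws) has_derivative
     (\<lambda>v. ray_integral x0 m (\<lambda>y. \<omega> y (v # ws)) x +
       ray_integral x0 (Suc m) (\<lambda>y. frechet_derivative (\<lambda>z. \<omega> z ((x - x0) # ws)) (at y) v) x)) (at x)"
proof (rule has_derivative_transform_within_open[OF _ U(1,3)])
  let ?D = "\<lambda>b v. ray_integral x0 (Suc m) (\<lambda>y. frechet_derivative (\<lambda>z. \<omega> z (b # ws)) (at y) v) x"
  let ?R = "\<lambda>b. ray_integral x0 m (\<lambda>y. \<omega> y (b # ws))"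
  have C: "Cp_on (Suc 0) U (\<lambda>y. \<omega> y (b # ws))" for b
    using \<omega> l by (intro dforms_Cp) (auto simp: one_enat_def)
  have 1: "?R v x = (\<Sum>b\<in>Basis. (v \<bullet> b) *\<^sub>R ?R b x)" for v
    by (rule linear_expand_Basis[OF ray_integral_form_linear[OF U(2,3) \<omega>(1) l]])
  have 2: "?D u v = (\<Sum>b\<in>Basis. (u \<bullet> b) *\<^sub>R ?D b v)" for u v
  proof (rule linear_expand_Basis[OF ray_integral_linear[OF U(2,3)]])
    show "linear (\<lambda>u. frechet_derivative (\<lambda>z. \<omega> z (u # ws)) (at y) v)" if "y \<in> U" for y
      using alternating_linear_Cons[OF alternating_frechet_derivative[OF U(1) that \<omega>] l] .
    show "continuous_on U (\<lambda>y. frechet_derivative (\<lambda>z. \<omega> z (u # ws)) (at y) v)" for u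
      using C[of u] by simp
  qed
  have "((\<lambda>z. \<Sum>b\<in>Basis. ((z - x0) \<bullet> b) *\<^sub>R ?R b z) has_derivative
     (\<lambda>v. \<Sum>b\<in>Basis. ((x - x0) \<bullet> b) *\<^sub>R ?D b v + (v \<bullet> b) *\<^sub>R ?R b x)) (at x)"
    by (auto intro!: derivative_eq_intros ray_integral_has_derivative[OF U(1,2) C U(3)])
  moreover have "(\<Sum>b\<in>Basis. ((x - x0) \<bullet> b) *\<^sub>R ?D b v + (v \<bullet> b) *\<^sub>R ?R b x) = ?R v x + ?D (x - x0) v" for v
    unfolding sum.distrib 1[of v, symmetric] 2[of "x - x0" v, symmetric] by (rule add.commute)
  ultimately show "((\<lambda>z. \<Sum>b\<in>Basis. ((z - x0) \<bullet> b) *\<^sub>R ?R b z) has_derivative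
     (\<lambda>v. ?R v x + ?D (x - x0) v)) (at x)" by simp
qed (simp add: homotopy_op_expand[OF U(2) _ \<omega>(1) l])

text \<open>
  Antisymmetrising the derivative of the homotopy operator gives (m + 1) times the ray integral
  of \<omega> from the first summand, since \<omega> is alternating. The second summand cancels against all but
  the leading term of H d\<omega>. What remains is the integral of the derivative of
  t^(m+1) \<omega>(x0 + t (x - x0)).
\<close>

lemma smooth_homotopy_formula:
  fixes \<omega> :: "('a::euclidean_space, 'v::euclidean_space) dform"
  assumes U: "open U" "star_at x0 U" "x \<in> U" and \<omega>: "\<omega> \<in> dforms (Suc m) \<infinity> U" and l: "length vs = Suc m"
  shows "ext_deriv (homotopy_op x0 (Suc m) \<omega>) x vs + homotopy_op x0 (Suc (Suc m)) (ext_deriv \<omega>) x vs = \<omega> x vs"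
proof -
  let ?u = "x - x0"
  let ?D = "\<lambda>y v ws. frechet_derivative (\<lambda>z. \<omega> z ws) (at y) v"
  have C: "Cp_on (Suc 0) U (\<lambda>y. \<omega> y ws)" "continuous_on U (\<lambda>y. \<omega> y ws)" "continuous_on U (\<lambda>y. ?D y v ws)"
    if "length ws = Suc m" for ws v
    using dforms_continuous[OF \<omega> that] dforms_smooth[OF \<omega> that, of "Suc 0"] by simp_all
  have cs: "continuous_on U (\<lambda>y. alt_sum (\<lambda>v ws. ?D y v (?u # ws)) vs)"
    unfolding alt_sum_def by (intro continuous_intros C) (use l in auto)
  have "ext_deriv (homotopy_op x0 (Suc m) \<omega>) x vs =
     alt_sum (\<lambda>v ws. ray_integral x0 m (\<lambda>y. \<omega> y (v # ws)) x + ray_integral x0 (Suc m) (\<lambda>y. ?D y v (?u # ws)) x) vs"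
    unfolding ext_deriv_alt_sum
  proof (rule alt_sum_cong)
    fix v us assume "length (us :: 'a list) = length vs - 1"
    then have "length us = m" using l by simp
    from frechet_derivative_at[OF homotopy_op_has_derivative[OF U \<omega> _ this]]
    show "frechet_derivative (\<lambda>z. homotopy_op x0 (Suc m) \<omega> z us) (at x) v = 
      ray_integral x0 m (\<lambda>y. \<omega> y (v # us)) x + ray_integral x0 (Suc m) (\<lambda>y. ?D y v (?u # us)) x"
      by (simp add: fun_eq_iff)
  qed
  also have "\<dots> = ray_integral x0 m (\<lambda>y. alt_sum (\<lambda>v ws. \<omega> y (v # ws)) vs) x +
     ray_integral x0 (Suc m) (\<lambda>y. alt_sum (\<lambda>v ws. ?D y v (?u # ws)) vs) x"
    unfolding alt_sum_add using l
    by (subst (1 2) alt_sum_ray_integral[OF U(2,3)]) (auto intro: C)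
  also have "ray_integral x0 m (\<lambda>y. alt_sum (\<lambda>v ws. \<omega> y (v # ws)) vs) x = ray_integral x0 m (\<lambda>y. real (Suc m) *\<^sub>R \<omega> y vs) x"
    by (rule ray_integral_cong[OF U(2,3)]) (rule alt_sum_of_alternating[OF dforms_alternating[OF \<omega>] l])
  also have "\<dots> = real (Suc m) *\<^sub>R ray_integral x0 m (\<lambda>y. \<omega> y vs) x"
    using ray_integral_lincomb[OF U(2,3) C(2)[OF l] C(2)[OF l], of m "Suc m" 0] by simp
  finally have 1: "ext_deriv (homotopy_op x0 (Suc m) \<omega>) x vs = real (Suc m) *\<^sub>R ray_integral x0 m (\<lambda>y. \<omega> y vs) x +
     ray_integral x0 (Suc m) (\<lambda>y. alt_sum (\<lambda>v ws. ?D y v (?u # ws)) vs) x" .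
  have "homotopy_op x0 (Suc (Suc m)) (ext_deriv \<omega>) x vs =
     ray_integral x0 (Suc m) (\<lambda>y. 1 *\<^sub>R ?D y ?u vs + (-1) *\<^sub>R alt_sum (\<lambda>v ws. ?D y v (?u # ws)) vs) x"
    by (simp add: homotopy_op_eq ext_deriv_alt_sum alt_sum_Cons)
  also have "\<dots> = ray_integral x0 (Suc m) (\<lambda>y. ?D y ?u vs) x -
      ray_integral x0 (Suc m) (\<lambda>y. alt_sum (\<lambda>v ws. ?D y v (?u # ws)) vs) x"
    by (subst ray_integral_lincomb[OF U(2,3) C(3)[OF l] cs]) simp
  finally have 2: "homotopy_op x0 (Suc (Suc m)) (ext_deriv \<omega>) x vs = \<dots>" .
  show ?thesis using ray_integral_FTC[OF U(2,3) C(1)[OF l], of "Suc m"] by (simp add: 1 2 del: of_nat_Suc)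
qed

text \<open>
  In degree 0 the evaluation at the centre appears.
\<close>

lemma smooth_homotopy_formula_0:
  fixes \<omega> :: "('a::euclidean_space, 'v::euclidean_space) dform"
  assumes U: "star_at x0 U" "x \<in> U" and \<omega>: "\<omega> \<in> dforms 0 \<infinity> U"
  shows "homotopy_op x0 (Suc 0) (ext_deriv \<omega>) x [] = \<omega> x [] - \<omega> x0 []"
  using ray_integral_FTC[OF U dforms_smooth[OF \<omega>], of "[]" 0]
  by (simp add: homotopy_op_eq ext_deriv_alt_sum alt_sum_Cons)

section \<open>Forms annihilated by homotopy operators\<close>

lemma open_ray_segment:
  fixes y u :: "'a::real_normed_vector"
  assumes "open U" "y \<in> U"
  obtains \<delta> where "\<delta> > 0" "\<And>h. 0 \<le> h \<Longrightarrow> h \<le> \<delta> \<Longrightarrow> y + h *\<^sub>R u \<in> U"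
proof -
  obtain e where e: "e > 0" "ball y e \<subseteq> U" using assms openE by blast
  show ?thesis
  proof
    show "e / (norm u + 1) / 2 > 0" using e by (simp add: add_nonneg_pos)
    fix h assume h: "0 \<le> h" "h \<le> e / (norm u + 1) / 2"
    have "h * norm u \<le> h * (norm u + 1)" using h by (intro mult_left_mono) auto
    also have "\<dots> \<le> e / (norm u + 1) / 2 * (norm u + 1)" using h by (intro mult_right_mono) auto
    also have "\<dots> = e / 2" using add_nonneg_pos[OF norm_ge_zero[of u] zero_less_one]
      by (simp del: divide_divide_eq_left add: field_simps)
    finally have "h * norm u < e" using e by simp
    then show "y + h *\<^sub>R u \<in> U" using e h by (auto simp: dist_norm)
  qed
qed

text \<open>
  For x = y + h u, linearity of \<eta> in its first argument makes the homotopy operator equal to h times a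
  ray integral of \<eta> with first argument u. Divide by h and let h tend to 0.
\<close>

lemma homotopy_op_zero_imp:
  fixes \<eta> :: "('a::euclidean_space, 'v::euclidean_space) dform"
  assumes U: "open U" "star_at y U" and \<eta>: "\<eta> \<in> dforms (Suc m) 0 U" and l: "length vs = m"
    and z: "\<And>x. x \<in> U \<Longrightarrow> homotopy_op y (Suc m) \<eta> x vs = 0"
  shows "\<eta> y (u # vs) = 0"
proof -
  have "y \<in> U" using U(2) by (simp add: star_at_def)
  then obtain \<delta> where \<delta>: "\<delta> > 0" "\<And>h. 0 \<le> h \<Longrightarrow> h \<le> \<delta> \<Longrightarrow> y + h *\<^sub>R u \<in> U"
    using open_ray_segment[OF U(1)] by metis
  show ?thesis
  proof (rule ray_integral_zero_imp[of \<delta> U "\<lambda>p. \<eta> p (u # vs)" y u m, OF \<delta>(1) _ \<delta>(2)])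
    show "continuous_on U (\<lambda>p. \<eta> p (u # vs))" using \<eta> l by (intro dforms_continuous) auto
    fix h assume h: "0 < h" "h \<le> \<delta>"
    then have "h *\<^sub>R ray_integral y m (\<lambda>p. \<eta> p (u # vs)) (y + h *\<^sub>R u) = homotopy_op y (Suc m) \<eta> (y + h *\<^sub>R u) vs"
      using linear_cmul[OF ray_integral_form_linear[OF U(2) _ \<eta> l, of "y + h *\<^sub>R u" m], of h u] \<delta>(2)[of h]
      by (simp add: homotopy_op_eq)
    also have "\<dots> = 0" using z \<delta>(2)[of h] h by simp
    finally show "ray_integral y m (\<lambda>p. \<eta> p (u # vs)) (y + h *\<^sub>R u) = 0" using h by simp
  qed auto
qed

section \<open>Second derivatives and the square of the exterior derivative\<close>

text \<open>
  Apply the homotopy operator centred at y to the one-form df: the result is f - f(y). Its derivative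
  in direction v, computed by homotopy_op_has_derivative, and the fundamental theorem of calculus
  applied to the function Df v, give two expressions for Df(x) v. Comparing them,
  the ray integrals of D(Df u) v and D(Df v) u from y to y + h u agree for all small h, and shrinking
  the rays to y gives the claim.
\<close>

lemma frechet_derivative_symmetric:
  fixes f :: "'a::euclidean_space \<Rightarrow> 'v::euclidean_space"
  assumes "open U" "y \<in> U" and f: "Cp_on (Suc (Suc 0)) U f"
  shows "frechet_derivative (\<lambda>p. frechet_derivative f (at p) u) (at y) v
       = frechet_derivative (\<lambda>p. frechet_derivative f (at p) v) (at y) u"
proof -
  obtain e where e: "e > 0" "ball y e \<subseteq> U" using assms openE by blast
  define W where "W = ball y e"
  have W: "open W" "star_at y W" "y \<in> W" "W \<subseteq> U" using e by (auto simp: W_def intro: convex_imp_star_at)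
  have fW: "Cp_on (Suc (Suc 0)) W f" using Cp_on_subset[OF f W(4)] .
  let ?D = "\<lambda>v p. frechet_derivative f (at p) v"
  have C: "Cp_on (Suc 0) W f" "Cp_on (Suc 0) W (?D v)" for v using Cp_on_Suc_imp[OF fW] fW by auto
  \<comment> \<open>The one-form df on argument lists of length 1.\<close>
  define \<omega> where "\<omega> = (\<lambda>p vs. ?D (hd vs) p)"
  have "alternating_multilinear (Suc 0) (\<omega> p)" if "p \<in> W" for p
    using linear_frechet_derivative[of f "at p"] C(1) that
    by (auto simp: alternating_multilinear_def \<omega>_def length_Suc_conv)
  moreover have "Cp_on q W (\<lambda>p. \<omega> p vs)" if "enat q \<le> 1" for q vs
    using C(2)[of "hd vs"] Cp_on_Suc_imp[OF C(2), of "hd vs"] that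
    by (auto simp: \<omega>_def one_enat_def le_Suc_eq)
  ultimately have \<omega>: "\<omega> \<in> dforms (Suc 0) 1 W" by (simp add: dforms_def)
  have swap: "ray_integral y 1 (\<lambda>p. frechet_derivative (?D (x - y)) (at p) v) x
      = ray_integral y 1 (\<lambda>p. frechet_derivative (?D v) (at p) (x - y)) x" if x: "x \<in> W" for x
  proof -
    have h: "homotopy_op y (Suc 0) \<omega> z [] = f z - f y" if "z \<in> W" for z
      using ray_integral_FTC[OF W(2) that C(1), of 0] by (simp add: homotopy_op_eq \<omega>_def)
    have "((\<lambda>z. f z - f y) has_derivative (\<lambda>v. ray_integral y 0 (?D v) x
        + ray_integral y (Suc 0) (\<lambda>p. frechet_derivative (?D (x - y)) (at p) v) x)) (at x)"
      using has_derivative_transform_within_open[OF homotopy_op_has_derivative[OF W(1,2) x \<omega> _ list.size(3)] W(1) x h]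
      by (simp add: \<omega>_def)
    moreover have "((\<lambda>z. f z - f y) has_derivative (\<lambda>v. ?D v x)) (at x)"
      using Cp_on_SucD[OF C(1) x] by (auto intro!: derivative_eq_intros)
    ultimately have "?D v x = ray_integral y 0 (?D v) x
        + ray_integral y (Suc 0) (\<lambda>p. frechet_derivative (?D (x - y)) (at p) v) x"
      using has_derivative_unique by (metis (no_types, lifting))
    then show ?thesis using ray_integral_FTC[OF W(2) x C(2), of 1 v] by simp
  qed
  obtain \<delta> where \<delta>: "\<delta> > 0" "\<And>h. 0 \<le> h \<Longrightarrow> h \<le> \<delta> \<Longrightarrow> y + h *\<^sub>R u \<in> W"
    using open_ray_segment[OF W(1,3)] by metis
  let ?A = "\<lambda>p. frechet_derivative (?D u) (at p) v" and ?B = "\<lambda>p. frechet_derivative (?D v) (at p) u"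
  have cA: "continuous_on W ?A" and cB: "continuous_on W ?B" using fW by simp_all
  have "1 *\<^sub>R ?A y + (- 1) *\<^sub>R ?B y = 0"
  proof (rule ray_integral_zero_imp[of \<delta> W "\<lambda>p. 1 *\<^sub>R ?A p + (- 1) *\<^sub>R ?B p" y u 1, OF \<delta>(1) _ \<delta>(2)])
    show "continuous_on W (\<lambda>p. 1 *\<^sub>R ?A p + (- 1) *\<^sub>R ?B p)" by (intro continuous_intros cA cB)
    fix h assume h: "0 < h" "h \<le> \<delta>"
    define x where "x = y + h *\<^sub>R u"
    have x: "x \<in> W" "x - y = h *\<^sub>R u" using h \<delta>(2)[of h] by (auto simp: x_def)
    have "ray_integral y 1 (\<lambda>p. h *\<^sub>R ?A p + 0 *\<^sub>R ?A p) x = ray_integral y 1 (\<lambda>p. frechet_derivative (?D (x - y)) (at p) v) x"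
    proof (rule ray_integral_cong[OF W(2) x(1)])
      fix p assume p: "p \<in> W"
      have "linear (\<lambda>w. frechet_derivative (\<lambda>z. \<omega> z [w]) (at p) v)"
        by (rule alternating_linear_Cons[OF alternating_frechet_derivative[OF W(1) p \<omega>]]) auto
      from linear_cmul[OF this, of h u]
      show "h *\<^sub>R ?A p + 0 *\<^sub>R ?A p = frechet_derivative (?D (x - y)) (at p) v" by (simp add: \<omega>_def x)
    qed
    also have "\<dots> = ray_integral y 1 (\<lambda>p. frechet_derivative (?D v) (at p) (x - y)) x" by (rule swap[OF x(1)])
    also have "\<dots> = ray_integral y 1 (\<lambda>p. h *\<^sub>R ?B p + 0 *\<^sub>R ?B p) x"
    proof (rule ray_integral_cong[OF W(2) x(1)])
      fix p assume p: "p \<in> W"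
      then have "linear (frechet_derivative (?D v) (at p))" using C(2)[of v] by (simp add: linear_frechet_derivative)
      from linear_cmul[OF this, of h u]
      show "frechet_derivative (?D v) (at p) (x - y) = h *\<^sub>R ?B p + 0 *\<^sub>R ?B p" by (simp add: x)
    qed
    finally have "h *\<^sub>R ray_integral y 1 ?A x = h *\<^sub>R ray_integral y 1 ?B x"
      by (simp only: ray_integral_lincomb[OF W(2) x(1) cA cA] ray_integral_lincomb[OF W(2) x(1) cB cB]) simp
    then show "ray_integral y 1 (\<lambda>p. 1 *\<^sub>R ?A p + (- 1) *\<^sub>R ?B p) (y + h *\<^sub>R u) = 0"
      using h unfolding x_def[symmetric] by (simp only: ray_integral_lincomb[OF W(2) x(1) cA cB]) simp
  qed auto
  then show ?thesis by simp
qed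

lemma ext_deriv_ext_deriv:
  fixes \<omega> :: "('a::euclidean_space, 'v::euclidean_space) dform"
  assumes U: "open U" "x \<in> U" and \<omega>: "\<omega> \<in> dforms k \<infinity> U" and l: "length vs = Suc (Suc k)"
  shows "ext_deriv (ext_deriv \<omega>) x vs = 0"
proof -
  let ?D = "\<lambda>ws p v. frechet_derivative (\<lambda>y. \<omega> y ws) (at p) v"
  have "ext_deriv (ext_deriv \<omega>) x vs =
     alt_sum (\<lambda>u us. alt_sum (\<lambda>w ws. frechet_derivative (\<lambda>p. ?D ws p w) (at x) u) us) vs"
    unfolding ext_deriv_alt_sum[of "ext_deriv \<omega>"]
  proof (rule alt_sum_cong)
    fix u us assume "length (us :: 'a list) = length vs - 1"
    then have "(\<lambda>p. ?D (del_nth i us) p (us ! i)) differentiable (at x)" if "i < length us" for i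
      using dforms_smooth[OF \<omega>, of "del_nth i us" "Suc (Suc 0)"] that l U by simp
    then have "((\<lambda>y. ext_deriv \<omega> y us) has_derivative (\<lambda>u. \<Sum>i<length us. (-1) ^ i *\<^sub>R
        frechet_derivative (\<lambda>p. ?D (del_nth i us) p (us ! i)) (at x) u)) (at x)"
      unfolding ext_deriv_def
      by (intro has_derivative_sum has_derivative_scaleR_right) (simp add: frechet_derivative_works)
    from frechet_derivative_at[OF this]
    show "frechet_derivative (\<lambda>y. ext_deriv \<omega> y us) (at x) u =
        alt_sum (\<lambda>w ws. frechet_derivative (\<lambda>p. ?D ws p w) (at x) u) us"
      by (simp add: alt_sum_def fun_eq_iff)
  qed
  also have "\<dots> = 0"
    by (rule alt_sum_symmetric) (use l in \<open>auto intro!: frechet_derivative_symmetric[OF U] dforms_smooth[OF \<omega>] simp del: Cp_on.simps\<close>)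
  finally show ?thesis .
qed

section \<open>Continuous forms with continuous exterior derivative\<close>

text \<open>
  Unlike the extended real valued form_norm, this bound is taken over all argument lists and is stable
  under linear combinations. For alternating forms the two are equivalent up to the dimension of the target
  (form_norm_le_of_bound, bound_of_form_norm).
\<close>

definition form_bound :: "nat \<Rightarrow> 'a::euclidean_space set \<Rightarrow> real \<Rightarrow> ('a, 'b::real_normed_vector) dform \<Rightarrow> bool" where
  "form_bound k S M \<omega> \<longleftrightarrow> (\<forall>x\<in>S. \<forall>vs. length vs = k \<longrightarrow> norm (\<omega> x vs) \<le> M * l1_prod vs)"

lemma form_boundD: "form_bound k S M \<omega> \<Longrightarrow> x \<in> S \<Longrightarrow> length vs = k \<Longrightarrow> norm (\<omega> x vs) \<le> M * l1_prod vs"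
  by (simp add: form_bound_def)

lemma form_bound_mono: "form_bound k S M \<omega> \<Longrightarrow> M \<le> N \<Longrightarrow> T \<subseteq> S \<Longrightarrow> form_bound k T N \<omega>"
  unfolding form_bound_def by (meson l1_prod_nonneg mult_right_mono order_trans subsetD)

lemma form_bound_lincomb:
  assumes "form_bound k S M \<omega>" "form_bound k S N \<eta>"
  shows "form_bound k S (\<bar>a\<bar> * M + \<bar>b\<bar> * N) (\<lambda>x vs. a *\<^sub>R \<omega> x vs + b *\<^sub>R \<eta> x vs)"
  unfolding form_bound_def
proof (intro ballI allI impI)
  fix x vs assume x: "x \<in> S" and l: "length (vs :: 'a list) = k"
  have "norm (a *\<^sub>R \<omega> x vs + b *\<^sub>R \<eta> x vs) \<le> \<bar>a\<bar> * norm (\<omega> x vs) + \<bar>b\<bar> * norm (\<eta> x vs)"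
    using norm_triangle_ineq[of "a *\<^sub>R \<omega> x vs" "b *\<^sub>R \<eta> x vs"] by simp
  also have "\<dots> \<le> \<bar>a\<bar> * (M * l1_prod vs) + \<bar>b\<bar> * (N * l1_prod vs)"
    using form_boundD[OF assms(1) x l] form_boundD[OF assms(2) x l] by (intro add_mono mult_left_mono) auto
  finally show "norm (a *\<^sub>R \<omega> x vs + b *\<^sub>R \<eta> x vs) \<le> (\<bar>a\<bar> * M + \<bar>b\<bar> * N) * l1_prod vs"
    by (simp add: algebra_simps)
qed

lemma form_bound_cong:
  assumes "form_bound k S M \<omega>" "\<And>x vs. x \<in> S \<Longrightarrow> length vs = k \<Longrightarrow> \<omega> x vs = \<eta> x vs"
  shows "form_bound k S M \<eta>"
  using assms by (simp add: form_bound_def)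

lemma form_norm_le_of_bound:
  assumes "form_bound k S M \<omega>"
  shows "form_norm k S \<omega> \<le> ennreal M"
  unfolding form_norm_def
proof (intro SUP_least ennreal_leI)
  fix I :: "'a list" and i :: 'b and x
  assume *: "I \<in> {I. set I \<subseteq> Basis \<and> length I = k}" "i \<in> Basis" "x \<in> S"
  have "\<bar>\<omega> x I \<bullet> i\<bar> \<le> norm (\<omega> x I)" using * by (simp add: Basis_le_norm)
  also have "\<dots> \<le> M" using form_boundD[OF assms, of x I] * by (simp add: l1_prod_Basis)
  finally show "\<bar>\<omega> x I \<bullet> i\<bar> \<le> M" .
qed

lemma bound_of_form_norm:
  fixes \<omega> :: "('a::euclidean_space, 'b::euclidean_space) dform"
  assumes "form_norm k S \<omega> \<le> ennreal M" "0 \<le> M" "\<And>x. x \<in> S \<Longrightarrow> alternating_multilinear k (\<omega> x)"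
  shows "form_bound k S (real DIM('b) * M) \<omega>"
  unfolding form_bound_def
proof (intro ballI allI impI)
  fix x and vs :: "'a list" assume x: "x \<in> S" and l: "length vs = k"
  show "norm (\<omega> x vs) \<le> real DIM('b) * M * l1_prod vs"
  proof (rule alternating_bound_of_Basis[OF assms(3)[OF x] _ l])
    fix I :: "'a list" assume I: "set I \<subseteq> Basis" "length I = k"
    have "\<bar>\<omega> x I \<bullet> i\<bar> \<le> M" if i: "i \<in> Basis" for i
    proof -
      have "ennreal \<bar>\<omega> x I \<bullet> i\<bar> \<le> form_norm k S \<omega>"
        unfolding form_norm_def using I i x by (intro SUP_upper2[of I] SUP_upper2[of i] SUP_upper2[of x]) auto
      then have "ennreal \<bar>\<omega> x I \<bullet> i\<bar> \<le> ennreal M" using assms(1) by (rule order_trans)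
      then show ?thesis using assms(2) by simp
    qed
    then have "(\<Sum>i\<in>Basis. \<bar>\<omega> x I \<bullet> i\<bar>) \<le> (\<Sum>i\<in>(Basis :: 'b set). M)" by (intro sum_mono)
    then show "norm (\<omega> x I) \<le> real DIM('b) * M"
      using norm_le_l1[of "\<omega> x I"] by simp
  qed
qed

lemma has_ext_deriv_onI:
  assumes "\<omega> \<in> dforms k 0 U" "\<eta> \<in> dforms (Suc k) 0 U"
    and "\<And>K \<epsilon>. compact K \<Longrightarrow> K \<subseteq> U \<Longrightarrow> \<epsilon> > 0 \<Longrightarrow> \<exists>\<omega>'\<in>dforms k \<infinity> U.
       form_bound k K \<epsilon> (diff_form \<omega>' \<omega>) \<and> form_bound (Suc k) K \<epsilon> (diff_form (ext_deriv \<omega>') \<eta>)"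
  shows "has_ext_deriv_on k U \<omega> \<eta>"
  unfolding has_ext_deriv_on_def
proof (intro conjI assms(1,2) allI impI)
  fix K and \<epsilon> :: real assume *: "compact K \<and> K \<subseteq> U \<and> 0 < \<epsilon>"
  then obtain \<omega>' where w: "\<omega>' \<in> dforms k \<infinity> U" "form_bound k K (\<epsilon>/2) (diff_form \<omega>' \<omega>)"
    "form_bound (Suc k) K (\<epsilon>/2) (diff_form (ext_deriv \<omega>') \<eta>)" using assms(3)[of K "\<epsilon>/2"] by auto
  have "ennreal (\<epsilon>/2) < ennreal \<epsilon>" using * by (simp add: ennreal_less_iff)
  then show "\<exists>\<omega>'\<in>dforms k \<infinity> U. form_norm k K (diff_form \<omega>' \<omega>) < ennreal \<epsilon> \<and>
      form_norm (Suc k) K (diff_form (ext_deriv \<omega>') \<eta>) < ennreal \<epsilon>"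
    by (intro bexI[OF _ w(1)] conjI order_le_less_trans[OF form_norm_le_of_bound[OF w(2)]]
        order_le_less_trans[OF form_norm_le_of_bound[OF w(3)]])
qed

lemma has_ext_deriv_on_dforms:
  assumes "has_ext_deriv_on k U \<omega> \<eta>"
  shows "\<omega> \<in> dforms k 0 U" "\<eta> \<in> dforms (Suc k) 0 U"
  using assms by (auto simp: has_ext_deriv_on_def)

lemma has_ext_deriv_onE:
  fixes \<omega> :: "('a::euclidean_space, 'v::euclidean_space) dform"
  assumes h: "has_ext_deriv_on k U \<omega> \<eta>" and U: "open U" and K: "compact K" "K \<subseteq> U" "\<epsilon> > 0"
  obtains \<omega>' where "\<omega>' \<in> dforms k \<infinity> U" "form_bound k K \<epsilon> (diff_form \<omega>' \<omega>)"
    "form_bound (Suc k) K \<epsilon> (diff_form (ext_deriv \<omega>') \<eta>)"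
proof -
  let ?e = "\<epsilon> / real DIM('v)"
  have e: "?e > 0" using K by (simp add: DIM_positive)
  obtain \<omega>' where w: "\<omega>' \<in> dforms k \<infinity> U" "form_norm k K (diff_form \<omega>' \<omega>) < ennreal ?e"
    "form_norm (Suc k) K (diff_form (ext_deriv \<omega>') \<eta>) < ennreal ?e"
    using h K e unfolding has_ext_deriv_on_def by blast
  show ?thesis
  proof
    show "\<omega>' \<in> dforms k \<infinity> U" by fact
    have "form_bound k K (real DIM('v) * ?e) (diff_form \<omega>' \<omega>)"
      by (rule bound_of_form_norm[OF less_imp_le[OF w(2)]])
        (use e K in \<open>auto intro!: alternating_diff dforms_alternating[OF w(1)]
            dforms_alternating[OF has_ext_deriv_on_dforms(1)[OF h]]\<close>)
    then show "form_bound k K \<epsilon> (diff_form \<omega>' \<omega>)" by simp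
    have "form_bound (Suc k) K (real DIM('v) * ?e) (diff_form (ext_deriv \<omega>') \<eta>)"
      by (rule bound_of_form_norm[OF less_imp_le[OF w(3)]])
        (use e K in \<open>auto intro!: alternating_diff dforms_alternating[OF ext_deriv_dforms[OF U w(1)]]
            dforms_alternating[OF has_ext_deriv_on_dforms(2)[OF h]]\<close>)
    then show "form_bound (Suc k) K \<epsilon> (diff_form (ext_deriv \<omega>') \<eta>)" by simp
  qed
qed

lemma has_ext_deriv_on_lincomb:
  fixes \<omega> :: "('a::euclidean_space, 'v::euclidean_space) dform"
  assumes U: "open U" and h1: "has_ext_deriv_on k U \<omega> \<eta>" and h2: "has_ext_deriv_on k U \<omega>2 \<eta>2"
  shows "has_ext_deriv_on k U (\<lambda>x vs. a *\<^sub>R \<omega> x vs + b *\<^sub>R \<omega>2 x vs) (\<lambda>x vs. a *\<^sub>R \<eta> x vs + b *\<^sub>R \<eta>2 x vs)"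
proof (rule has_ext_deriv_onI)
  fix K \<epsilon> assume K: "compact K" "K \<subseteq> U" "(\<epsilon>::real) > 0"
  define e where "e = \<epsilon> / (\<bar>a\<bar> + \<bar>b\<bar> + 1)"
  have e: "e > 0" using K by (simp add: e_def add_nonneg_pos)
  have "(\<bar>a\<bar> + \<bar>b\<bar>) * e \<le> (\<bar>a\<bar> + \<bar>b\<bar> + 1) * e" using e by (intro mult_right_mono) auto
  also have "\<dots> = \<epsilon>" unfolding e_def using add_nonneg_pos[of "\<bar>a\<bar> + \<bar>b\<bar>" 1] by simp
  finally have le: "\<bar>a\<bar> * e + \<bar>b\<bar> * e \<le> \<epsilon>" by (simp add: algebra_simps)
  obtain \<omega>' where w: "\<omega>' \<in> dforms k \<infinity> U" "form_bound k K e (diff_form \<omega>' \<omega>)"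
    "form_bound (Suc k) K e (diff_form (ext_deriv \<omega>') \<eta>)" using has_ext_deriv_onE[OF h1 U K(1,2) e] .
  obtain \<omega>2' where w2: "\<omega>2' \<in> dforms k \<infinity> U" "form_bound k K e (diff_form \<omega>2' \<omega>2)"
    "form_bound (Suc k) K e (diff_form (ext_deriv \<omega>2') \<eta>2)" using has_ext_deriv_onE[OF h2 U K(1,2) e] .
  show "\<exists>\<omega>'\<in>dforms k \<infinity> U. form_bound k K \<epsilon> (diff_form \<omega>' (\<lambda>x vs. a *\<^sub>R \<omega> x vs + b *\<^sub>R \<omega>2 x vs)) \<and>
      form_bound (Suc k) K \<epsilon> (diff_form (ext_deriv \<omega>') (\<lambda>x vs. a *\<^sub>R \<eta> x vs + b *\<^sub>R \<eta>2 x vs))"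
  proof (intro bexI conjI)
    show "(\<lambda>x vs. a *\<^sub>R \<omega>' x vs + b *\<^sub>R \<omega>2' x vs) \<in> dforms k \<infinity> U" by (rule dforms_lincomb[OF U w(1) w2(1)])
    show "form_bound k K \<epsilon> (diff_form (\<lambda>x vs. a *\<^sub>R \<omega>' x vs + b *\<^sub>R \<omega>2' x vs) (\<lambda>x vs. a *\<^sub>R \<omega> x vs + b *\<^sub>R \<omega>2 x vs))"
      by (rule form_bound_cong[OF form_bound_mono[OF form_bound_lincomb[OF w(2) w2(2)] le order_refl]]) (simp add: algebra_simps)
    show "form_bound (Suc k) K \<epsilon> (diff_form (ext_deriv (\<lambda>x vs. a *\<^sub>R \<omega>' x vs + b *\<^sub>R \<omega>2' x vs)) (\<lambda>x vs. a *\<^sub>R \<eta> x vs + b *\<^sub>R \<eta>2 x vs))"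
    proof (rule form_bound_cong[OF form_bound_mono[OF form_bound_lincomb[OF w(3) w2(3)] le order_refl]])
      fix x and vs :: "'a list" assume "x \<in> K" "length vs = Suc k"
      then show "a *\<^sub>R (ext_deriv \<omega>' x vs - \<eta> x vs) + b *\<^sub>R (ext_deriv \<omega>2' x vs - \<eta>2 x vs) =
         ext_deriv (\<lambda>x vs. a *\<^sub>R \<omega>' x vs + b *\<^sub>R \<omega>2' x vs) x vs - (a *\<^sub>R \<eta> x vs + b *\<^sub>R \<eta>2 x vs)"
        using ext_deriv_lincomb[OF w(1) w2(1)] K by (auto simp: algebra_simps)
    qed
  qed
qed (intro dforms_lincomb[OF U] has_ext_deriv_on_dforms[OF h1] has_ext_deriv_on_dforms[OF h2])+

lemma has_ext_deriv_on_cong: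
  assumes U: "open U" and h: "has_ext_deriv_on k U \<omega> \<eta>" and eq: "form_eq k U \<omega> \<omega>2" "form_eq (Suc k) U \<eta> \<eta>2"
  shows "has_ext_deriv_on k U \<omega>2 \<eta>2"
proof (rule has_ext_deriv_onI)
  fix K \<epsilon> assume K: "compact K" "K \<subseteq> U" "(\<epsilon>::real) > 0"
  obtain \<omega>' where w: "\<omega>' \<in> dforms k \<infinity> U" "form_bound k K \<epsilon> (diff_form \<omega>' \<omega>)"
    "form_bound (Suc k) K \<epsilon> (diff_form (ext_deriv \<omega>') \<eta>)" using has_ext_deriv_onE[OF h U K] .
  have "form_bound k K \<epsilon> (diff_form \<omega>' \<omega>2)"
    by (rule form_bound_cong[OF w(2)]) (use eq K in \<open>auto simp: form_eq_def\<close>)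
  moreover have "form_bound (Suc k) K \<epsilon> (diff_form (ext_deriv \<omega>') \<eta>2)"
    by (rule form_bound_cong[OF w(3)]) (use eq K in \<open>auto simp: form_eq_def\<close>)
  ultimately show "\<exists>\<omega>'\<in>dforms k \<infinity> U. form_bound k K \<epsilon> (diff_form \<omega>' \<omega>2) \<and>
      form_bound (Suc k) K \<epsilon> (diff_form (ext_deriv \<omega>') \<eta>2)" using w(1) by blast
qed (use dforms_cong eq has_ext_deriv_on_dforms[OF h] in blast)+

lemma has_ext_deriv_on_subset:
  assumes U: "open U" and h: "has_ext_deriv_on k U \<omega> \<eta>" and W: "W \<subseteq> U"
  shows "has_ext_deriv_on k W \<omega> \<eta>"
proof (rule has_ext_deriv_onI)
  fix K \<epsilon> assume K: "compact K" "K \<subseteq> W" "(\<epsilon>::real) > 0"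
  obtain \<omega>' where "\<omega>' \<in> dforms k \<infinity> U" "form_bound k K \<epsilon> (diff_form \<omega>' \<omega>)"
    "form_bound (Suc k) K \<epsilon> (diff_form (ext_deriv \<omega>') \<eta>)" using has_ext_deriv_onE[OF h U K(1) _ K(3)] K(2) W by blast
  then show "\<exists>\<omega>'\<in>dforms k \<infinity> W. form_bound k K \<epsilon> (diff_form \<omega>' \<omega>) \<and>
      form_bound (Suc k) K \<epsilon> (diff_form (ext_deriv \<omega>') \<eta>)" using dforms_subset[OF _ W] by blast
qed (use dforms_subset[OF _ W] has_ext_deriv_on_dforms[OF h] in auto)

text \<open>
  If the pairs (\<omega>', d\<omega>') approximate (\<omega>, \<eta>), the pairs (d\<omega>', 0) approximate (\<eta>, 0).
\<close>

lemma has_ext_deriv_on_imp_closed: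
  fixes \<omega> :: "('a::euclidean_space, 'v::euclidean_space) dform"
  assumes U: "open U" and h: "has_ext_deriv_on k U \<omega> \<eta>"
  shows "\<eta> \<in> closed_forms (Suc k) U"
  unfolding closed_forms_def mem_Collect_eq
proof (rule has_ext_deriv_onI)
  fix K \<epsilon> assume K: "compact K" "K \<subseteq> U" "(\<epsilon>::real) > 0"
  obtain \<omega>' where w: "\<omega>' \<in> dforms k \<infinity> U" "form_bound k K \<epsilon> (diff_form \<omega>' \<omega>)"
    "form_bound (Suc k) K \<epsilon> (diff_form (ext_deriv \<omega>') \<eta>)" using has_ext_deriv_onE[OF h U K] .
  have "form_bound (Suc (Suc k)) K \<epsilon> (diff_form (ext_deriv (ext_deriv \<omega>')) zero_form)"
    using ext_deriv_ext_deriv[OF U _ w(1)] K by (auto simp: form_bound_def subset_iff)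
  then show "\<exists>\<omega>'\<in>dforms (Suc k) \<infinity> U. form_bound (Suc k) K \<epsilon> (diff_form \<omega>' \<eta>) \<and>
      form_bound (Suc (Suc k)) K \<epsilon> (diff_form (ext_deriv \<omega>') zero_form)"
    using w(3) ext_deriv_dforms[OF U w(1)] by blast
qed (use has_ext_deriv_on_dforms[OF h] dforms_zero[OF U] in auto)

section \<open>The homotopy formula for continuous forms\<close>

text \<open>
  The value of the homotopy operator at x depends on the whole ray from x0 to x, so uniform estimates on K need the
  union of all rays to K, which is still a compact subset of U.
\<close>

lemma compact_ray_hull:
  fixes K :: "'a::euclidean_space set"
  assumes "star_at x0 U" "compact K" "K \<subseteq> U"
  obtains S where "compact S" "S \<subseteq> U" "K \<subseteq> S" "star_at x0 S"
proof
  define S where "S = insert x0 ((\<lambda>(t, x). x0 + t *\<^sub>R (x - x0)) ` ({0..1::real} \<times> K))"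
  show "compact S" unfolding S_def
    by (intro compact_insert compact_continuous_image)
       (auto simp: split_beta intro!: continuous_intros compact_Times assms(2))
  show "S \<subseteq> U" using assms by (auto simp: S_def star_at_def)
  have "x \<in> S" if "x \<in> K" for x
    unfolding S_def using that by (intro insertI2 image_eqI[where x = "(1, x)"]) auto
  then show "K \<subseteq> S" by blast
  have "x0 + s *\<^sub>R (x - x0) \<in> S" if x: "x \<in> S" "s \<in> {0..1}" for x s
  proof (cases "x = x0")
    case False
    then obtain t z where "t \<in> {0..1}" "z \<in> K" "x = x0 + t *\<^sub>R (z - x0)" using x by (auto simp: S_def)
    then show ?thesis unfolding S_def using x(2)
      by (intro insertI2 image_eqI[where x = "(s * t, z)"]) (auto simp: mult_le_one)
  qed (simp add: S_def)
  then show "star_at x0 S" by (simp add: star_at_def S_def)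
qed

lemma homotopy_op_lincomb:
  fixes \<omega> :: "('a::euclidean_space, 'v::euclidean_space) dform"
  assumes "star_at x0 U" "x \<in> U" "\<omega> \<in> dforms (Suc m) 0 U" "\<eta> \<in> dforms (Suc m) 0 U" "length vs = m"
  shows "homotopy_op x0 (Suc m) (\<lambda>x vs. a *\<^sub>R \<omega> x vs + b *\<^sub>R \<eta> x vs) x vs =
     a *\<^sub>R homotopy_op x0 (Suc m) \<omega> x vs + b *\<^sub>R homotopy_op x0 (Suc m) \<eta> x vs"
  unfolding homotopy_op_eq using assms
  by (intro ray_integral_lincomb[OF assms(1,2)]) (auto intro: dforms_continuous)

lemma homotopy_op_cong:
  fixes \<omega> :: "('a::euclidean_space, 'v::euclidean_space) dform"
  assumes "star_at x0 U" "x \<in> U" "form_eq (Suc m) U \<omega> \<eta>" "length vs = m"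
  shows "homotopy_op x0 (Suc m) \<omega> x vs = homotopy_op x0 (Suc m) \<eta> x vs"
  unfolding homotopy_op_eq using assms
  by (intro ray_integral_cong[OF assms(1,2)]) (auto simp: form_eq_def)

lemma norm_ray_integral_le:
  fixes f :: "'a::euclidean_space \<Rightarrow> 'b::euclidean_space"
  assumes "star_at x0 S" "continuous_on S f" "x \<in> S"
    and "\<And>t. 0 \<le> t \<Longrightarrow> t \<le> 1 \<Longrightarrow> norm (f (x0 + t *\<^sub>R (x - x0))) \<le> B * t ^ l" "0 \<le> B"
  shows "norm (ray_integral x0 m f x) \<le> B / (real l + 1)"
proof -
  have i: "((\<lambda>t. B * t ^ l) has_integral B * (1 / (real l + 1))) {0..1}"
    by (rule has_integral_mult_right[OF has_integral_power_01])
  have "norm (ray_integral x0 m f x) \<le> integral {0..1} (\<lambda>t. B * t ^ l)"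
    unfolding ray_integral_def
  proof (rule integral_norm_bound_integral[OF ray_integrable[OF assms(1-3)]])
    show "(\<lambda>t. B * t ^ l) integrable_on {0..1}" using i by blast
    fix t :: real assume t: "t \<in> {0..1}"
    have "norm (t ^ m *\<^sub>R f (x0 + t *\<^sub>R (x - x0))) \<le> 1 * norm (f (x0 + t *\<^sub>R (x - x0)))"
      using mult_right_mono[OF power_le_one[of t m] norm_ge_zero] t by simp
    also have "\<dots> \<le> B * t ^ l" using assms(4) t by simp
    finally show "norm (t ^ m *\<^sub>R f (x0 + t *\<^sub>R (x - x0))) \<le> B * t ^ l" .
  qed
  then show ?thesis using integral_unique[OF i] by simp
qed

text \<open>
  The constant does not depend on derivatives of the form, so H is continuous for uniform convergence on S.
\<close>

lemma homotopy_op_bound: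
  fixes \<omega> :: "('a::euclidean_space, 'v::euclidean_space) dform"
  assumes S: "star_at x0 S" and R: "\<And>x. x \<in> S \<Longrightarrow> l1_norm (x - x0) \<le> R"
    and \<omega>: "\<omega> \<in> dforms (Suc m) 0 S" "form_bound (Suc m) S M \<omega>" "0 \<le> M"
  shows "form_bound m S (M * R) (homotopy_op x0 (Suc m) \<omega>)"
  unfolding form_bound_def
proof (intro ballI allI impI)
  fix x and vs :: "'a list" assume x: "x \<in> S" and l: "length vs = m"
  have "norm (ray_integral x0 m (\<lambda>y. \<omega> y ((x - x0) # vs)) x) \<le> (M * l1_norm (x - x0) * l1_prod vs) / (real 0 + 1)"
    using dforms_continuous[OF \<omega>(1)] form_boundD[OF \<omega>(2) star_atD[OF S x], of _ "(x - x0) # vs"] l \<omega>(3)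
    by (intro norm_ray_integral_le[OF S _ x, where l = 0]) (auto simp: mult.assoc)
  also have "\<dots> \<le> M * R * l1_prod vs" using R[OF x] \<omega>(3) by (simp add: mult_left_mono mult_right_mono)
  finally show "norm (homotopy_op x0 (Suc m) \<omega> x vs) \<le> M * R * l1_prod vs" by (simp add: homotopy_op_eq)
qed

lemma compact_l1_bound:
  fixes S :: "'a::euclidean_space set"
  assumes "compact S"
  obtains R where "0 \<le> R" "\<And>x. x \<in> S \<Longrightarrow> l1_norm (x - x0) \<le> R"
proof -
  have "bounded ((\<lambda>x. l1_norm (x - x0)) ` S)"
    by (intro compact_imp_bounded compact_continuous_image continuous_on_l1_norm assms)
  then obtain R where R: "\<And>x. x \<in> S \<Longrightarrow> \<bar>l1_norm (x - x0)\<bar> \<le> R" by (auto simp: bounded_iff)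
  show ?thesis by (rule that[of "max R 0"]) (use R in fastforce)+
qed

text \<open>
  Smooth approximants \<omega>' of (\<omega>, \<eta>) yield approximants H\<omega>', because d(H\<omega>') = \<omega>' - H d\<omega>' and H preserves
  uniform convergence on a compact set that contains all rays to K.
\<close>

lemma has_ext_deriv_on_homotopy:
  fixes \<omega> :: "('a::euclidean_space, 'v::euclidean_space) dform"
  assumes U: "open U" "star_at x0 U" and h: "has_ext_deriv_on (Suc m) U \<omega> \<eta>"
  shows "has_ext_deriv_on m U (homotopy_op x0 (Suc m) \<omega>) (diff_form \<omega> (homotopy_op x0 (Suc (Suc m)) \<eta>))"
proof (rule has_ext_deriv_onI)
  note d = has_ext_deriv_on_dforms[OF h]
  show "homotopy_op x0 (Suc m) \<omega> \<in> dforms m 0 U" by (rule homotopy_op_dforms[OF U d(1)])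
  show "diff_form \<omega> (homotopy_op x0 (Suc (Suc m)) \<eta>) \<in> dforms (Suc m) 0 U"
    using dforms_lincomb[OF U(1) d(1) homotopy_op_dforms[OF U d(2)], of 1 "-1"] by simp
  fix K \<epsilon> assume K: "compact K" "K \<subseteq> U" "(\<epsilon>::real) > 0"
  obtain S where S: "compact S" "S \<subseteq> U" "K \<subseteq> S" "star_at x0 S" using compact_ray_hull[OF U(2) K(1,2)] .
  obtain R where R: "0 \<le> R" "\<And>x. x \<in> S \<Longrightarrow> l1_norm (x - x0) \<le> R" using compact_l1_bound[OF S(1), of x0] by blast
  define e where "e = \<epsilon> / (1 + R)"
  have "e * (1 + R) = \<epsilon>" using R(1) by (simp add: e_def)
  moreover have "e > 0" using R(1) K by (simp add: e_def)
  ultimately have e: "e > 0" "e * R \<le> \<epsilon>" "e + e * R \<le> \<epsilon>" by (simp_all add: distrib_left)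
  obtain \<omega>' where w: "\<omega>' \<in> dforms (Suc m) \<infinity> U" "form_bound (Suc m) S e (diff_form \<omega>' \<omega>)"
    "form_bound (Suc (Suc m)) S e (diff_form (ext_deriv \<omega>') \<eta>)" using has_ext_deriv_onE[OF h U(1) S(1,2) e(1)] .
  note w0 = dforms_imp_continuous[OF w(1)] and dw = dforms_imp_continuous[OF ext_deriv_dforms[OF U(1) w(1)]]
  have 1: "form_bound m S (e * R) (homotopy_op x0 (Suc m) (diff_form \<omega>' \<omega>))"
    using dforms_lincomb[OF U(1) w0 d(1), of 1 "-1"] e
    by (intro homotopy_op_bound[OF S(4) R(2) _ w(2)]) (auto intro: dforms_subset[OF _ S(2)])
  have 2: "form_bound (Suc m) S (e * R) (homotopy_op x0 (Suc (Suc m)) (diff_form (ext_deriv \<omega>') \<eta>))"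
    using dforms_lincomb[OF U(1) dw d(2), of 1 "-1"] e
    by (intro homotopy_op_bound[OF S(4) R(2) _ w(3)]) (auto intro: dforms_subset[OF _ S(2)])
  show "\<exists>\<omega>'\<in>dforms m \<infinity> U. form_bound m K \<epsilon> (diff_form \<omega>' (homotopy_op x0 (Suc m) \<omega>)) \<and>
     form_bound (Suc m) K \<epsilon> (diff_form (ext_deriv \<omega>') (diff_form \<omega> (homotopy_op x0 (Suc (Suc m)) \<eta>)))"
  proof (intro bexI conjI)
    show "homotopy_op x0 (Suc m) \<omega>' \<in> dforms m \<infinity> U" by (rule homotopy_op_dforms[OF U w(1)])
    show "form_bound m K \<epsilon> (diff_form (homotopy_op x0 (Suc m) \<omega>') (homotopy_op x0 (Suc m) \<omega>))"
    proof (rule form_bound_cong[OF form_bound_mono[OF 1 e(2) S(3)]])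
      fix x and vs :: "'a list" assume "x \<in> K" "length vs = m"
      then show "homotopy_op x0 (Suc m) (diff_form \<omega>' \<omega>) x vs = homotopy_op x0 (Suc m) \<omega>' x vs - homotopy_op x0 (Suc m) \<omega> x vs"
        using homotopy_op_lincomb[OF U(2) _ w0 d(1), of x vs 1 "-1"] K by auto
    qed
    show "form_bound (Suc m) K \<epsilon> (diff_form (ext_deriv (homotopy_op x0 (Suc m) \<omega>')) (diff_form \<omega> (homotopy_op x0 (Suc (Suc m)) \<eta>)))"
    proof (rule form_bound_cong[OF form_bound_mono[OF form_bound_lincomb[OF w(2) 2, of 1 "-1"] _ S(3)]])
      fix x and vs :: "'a list" assume x: "x \<in> K" and l: "length vs = Suc m"
      have "homotopy_op x0 (Suc (Suc m)) (diff_form (ext_deriv \<omega>') \<eta>) x vs =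
         homotopy_op x0 (Suc (Suc m)) (ext_deriv \<omega>') x vs - homotopy_op x0 (Suc (Suc m)) \<eta> x vs"
        using homotopy_op_lincomb[OF U(2) _ dw d(2) l, of x 1 "-1"] K x by auto
      moreover have "ext_deriv (homotopy_op x0 (Suc m) \<omega>') x vs + homotopy_op x0 (Suc (Suc m)) (ext_deriv \<omega>') x vs = \<omega>' x vs"
        using smooth_homotopy_formula[OF U _ w(1) l] K x by blast
      ultimately show "1 *\<^sub>R (\<omega>' x vs - \<omega> x vs) + (- 1) *\<^sub>R homotopy_op x0 (Suc (Suc m)) (diff_form (ext_deriv \<omega>') \<eta>) x vs =
         ext_deriv (homotopy_op x0 (Suc m) \<omega>') x vs - (\<omega> x vs - homotopy_op x0 (Suc (Suc m)) \<eta> x vs)"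
        by (simp add: algebra_simps)
    qed (use e in auto)
  qed
qed

lemma has_ext_deriv_on_homotopy_0:
  fixes \<omega> :: "('a::euclidean_space, 'v::euclidean_space) dform"
  assumes U: "open U" "star_at x0 U" and h: "has_ext_deriv_on 0 U \<omega> \<eta>" and x: "x \<in> U"
  shows "homotopy_op x0 (Suc 0) \<eta> x [] = \<omega> x [] - \<omega> x0 []"
proof -
  note d = has_ext_deriv_on_dforms[OF h]
  obtain S where S: "compact S" "S \<subseteq> U" "{x} \<subseteq> S" "star_at x0 S" using compact_ray_hull[OF U(2), of "{x}"] x by auto
  obtain R where R: "0 \<le> R" "\<And>x. x \<in> S \<Longrightarrow> l1_norm (x - x0) \<le> R" using compact_l1_bound[OF S(1), of x0] by blast
  have x0: "x0 \<in> S" using S(4) by (simp add: star_at_def)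
  have "norm (\<omega> x [] - \<omega> x0 [] - homotopy_op x0 (Suc 0) \<eta> x []) \<le> 0 + \<epsilon>" if "\<epsilon> > 0" for \<epsilon>
  proof -
    define e where "e = \<epsilon> / (2 + R)"
    have "e * (2 + R) = \<epsilon>" using R(1) by (simp add: e_def)
    moreover have "e > 0" using R(1) that by (simp add: e_def)
    moreover define r where "r = e * R"
    ultimately have e: "e > 0" "e + e + r = \<epsilon>" by (simp_all add: distrib_left)
    obtain \<omega>' where w: "\<omega>' \<in> dforms 0 \<infinity> U" "form_bound 0 S e (diff_form \<omega>' \<omega>)"
      "form_bound (Suc 0) S e (diff_form (ext_deriv \<omega>') \<eta>)" using has_ext_deriv_onE[OF h U(1) S(1,2) e(1)] .
    note dw = dforms_imp_continuous[OF ext_deriv_dforms[OF U(1) w(1)]]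
    have "form_bound 0 S (e * R) (homotopy_op x0 (Suc 0) (diff_form (ext_deriv \<omega>') \<eta>))"
      using dforms_lincomb[OF U(1) dw d(2), of 1 "-1"] e
      by (intro homotopy_op_bound[OF S(4) R(2) _ w(3)]) (auto intro: dforms_subset[OF _ S(2)])
    then have 1: "norm (homotopy_op x0 (Suc 0) (diff_form (ext_deriv \<omega>') \<eta>) x []) \<le> r"
      using form_boundD[of 0 S _ _ x "[]"] S(3) by (auto simp: r_def)
    have 2: "norm (\<omega>' x [] - \<omega> x []) \<le> e" "norm (\<omega>' x0 [] - \<omega> x0 []) \<le> e"
      using form_boundD[OF w(2), of _ "[]"] S(3) x0 by auto
    have "homotopy_op x0 (Suc 0) (diff_form (ext_deriv \<omega>') \<eta>) x [] = (\<omega>' x [] - \<omega>' x0 []) - homotopy_op x0 (Suc 0) \<eta> x []"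
      using homotopy_op_lincomb[OF U(2) x dw d(2), of "[]" 1 "-1"] smooth_homotopy_formula_0[OF U(2) x w(1)] by simp
    then have "\<omega> x [] - \<omega> x0 [] - homotopy_op x0 (Suc 0) \<eta> x [] =
        homotopy_op x0 (Suc 0) (diff_form (ext_deriv \<omega>') \<eta>) x [] - (\<omega>' x [] - \<omega> x []) + (\<omega>' x0 [] - \<omega> x0 [])"
      by (simp add: algebra_simps)
    also have "norm \<dots> \<le> r + e + e"
      by (intro norm_triangle_le norm_triangle_le_diff add_mono 1 2)
    finally show ?thesis using e(2) by simp
  qed
  then have "norm (\<omega> x [] - \<omega> x0 [] - homotopy_op x0 (Suc 0) \<eta> x []) \<le> 0" by (rule field_le_epsilon)
  then show ?thesis by simp
qed

section \<open>Uniqueness of the exterior derivative\<close>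

text \<open>
  In a convex set every point y may serve as the centre of a homotopy operator H. By the homotopy
  formula 0 = H 0 has the exterior derivative - H\<eta>, so H\<eta> = 0 by induction on the degree; in degree 0
  the formula gives H\<eta> = 0 at once. Then homotopy_op_zero_imp yields \<eta>(y) = 0.
\<close>

lemma has_ext_deriv_on_zero_convex:
  fixes \<eta> :: "('a::euclidean_space, 'v::euclidean_space) dform"
  assumes "open W" "convex W"
  shows "has_ext_deriv_on k W zero_form \<eta> \<Longrightarrow> y \<in> W \<Longrightarrow> length vs = Suc k \<Longrightarrow> \<eta> y vs = 0"
proof (induction k arbitrary: \<eta> y vs)
  case 0
  note st = convex_imp_star_at[OF assms(2) 0(2)]
  obtain u where u: "vs = [u]" using 0 by (auto simp: length_Suc_conv)
  have "\<eta> y (u # []) = 0"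
    by (rule homotopy_op_zero_imp[OF assms(1) st has_ext_deriv_on_dforms(2)[OF 0(1)]])
      (simp_all add: has_ext_deriv_on_homotopy_0[OF assms(1) st 0(1)])
  then show ?case using u by simp
next
  case (Suc m)
  note st = convex_imp_star_at[OF assms(2) Suc.prems(2)]
  obtain u us where u: "vs = u # us" "length us = Suc m" using Suc.prems by (auto simp: length_Suc_conv)
  have "homotopy_op y (Suc m) zero_form = (zero_form :: ('a, 'v) dform)"
    by (simp add: fun_eq_iff homotopy_op_eq ray_integral_def)
  then have "has_ext_deriv_on m W zero_form (diff_form zero_form (homotopy_op y (Suc (Suc m)) \<eta>))"
    using has_ext_deriv_on_homotopy[OF assms(1) st Suc.prems(1)] by simp
  from Suc.IH[OF this] have "homotopy_op y (Suc (Suc m)) \<eta> x us = 0" if "x \<in> W" for x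
    using that u by simp
  then show ?case using homotopy_op_zero_imp[OF assms(1) st has_ext_deriv_on_dforms(2)[OF Suc.prems(1)]] u by simp
qed

lemma has_ext_deriv_on_unique:
  fixes \<omega> :: "('a::euclidean_space, 'v::euclidean_space) dform"
  assumes U: "open U" and "has_ext_deriv_on k U \<omega> \<eta>1" "has_ext_deriv_on k U \<omega> \<eta>2"
  shows "form_eq (Suc k) U \<eta>1 \<eta>2"
  unfolding form_eq_def
proof (intro ballI allI impI)
  fix x and vs :: "'a list" assume x: "x \<in> U" and l: "length vs = Suc k"
  have "has_ext_deriv_on k U zero_form (\<lambda>x vs. 1 *\<^sub>R \<eta>1 x vs + (- 1) *\<^sub>R \<eta>2 x vs)"
    using has_ext_deriv_on_lincomb[OF assms, of 1 "-1"] by simp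
  moreover obtain e where e: "e > 0" "ball x e \<subseteq> U" using U x openE by blast
  ultimately have "has_ext_deriv_on k (ball x e) zero_form (\<lambda>x vs. 1 *\<^sub>R \<eta>1 x vs + (- 1) *\<^sub>R \<eta>2 x vs)"
    using has_ext_deriv_on_subset[OF U] by blast
  from has_ext_deriv_on_zero_convex[OF open_ball convex_ball this _ l, of x] e
  show "\<eta>1 x vs = \<eta>2 x vs" by simp
qed

section \<open>Wedge products with the connection form\<close>

lemma alternating_compose_linear:
  assumes "linear L" "alternating_multilinear k f"
  shows "alternating_multilinear k (\<lambda>vs. L (f vs))"
  using assms unfolding alternating_multilinear_def
  by (auto simp: linear_0 dest: linear_compose[of _ L, unfolded o_def])

lemma wedge_dforms:
  assumes A: "A \<in> dforms 1 0 U" and \<omega>: "\<omega> \<in> dforms k 0 U"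
  shows "wedge A \<omega> \<in> dforms (Suc k) 0 U"
  unfolding dforms_0_iff
proof (intro conjI ballI allI impI)
  fix x assume x: "x \<in> U"
  show "alternating_multilinear (Suc k) (wedge A \<omega> x)"
    unfolding wedge_alt_sum
  proof (rule alternating_alt_sum)
    have "linear (\<lambda>v. A x [v])"
      using alternating_linear_Cons[of 0 "A x" "[]"] dforms_alternating[OF A x] by simp
    then show "linear (\<lambda>v. blinfun_apply (A x [v]) (\<omega> x us))" for us
      using linear_compose[OF _ bounded_linear.linear[OF blinfun.bounded_linear_left]] by (auto simp: o_def)
    show "alternating_multilinear k (\<lambda>ws. blinfun_apply (A x [v]) (\<omega> x ws))" for v
      by (rule alternating_compose_linear[OF _ dforms_alternating[OF \<omega> x]])
        (rule bounded_linear.linear[OF blinfun.bounded_linear_right])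
  qed
next
  fix vs :: "'a list" assume l: "length vs = Suc k"
  show "continuous_on U (\<lambda>x. wedge A \<omega> x vs)"
    unfolding wedge_def
    by (intro continuous_intros dforms_continuous[OF A] dforms_continuous[OF \<omega>]) (use l in auto)
qed

lemma wedge_lincomb:
  "wedge A (\<lambda>x vs. a *\<^sub>R \<omega> x vs + b *\<^sub>R \<eta> x vs) x vs = a *\<^sub>R wedge A \<omega> x vs + b *\<^sub>R wedge A \<eta> x vs"
  unfolding wedge_alt_sum alt_sum_lincomb[symmetric] by (simp add: blinfun.bilinear_simps)

lemma wedge_cong: "form_eq k U \<omega> \<eta> \<Longrightarrow> form_eq (Suc k) U (wedge A \<omega>) (wedge A \<eta>)"
  unfolding form_eq_def wedge_alt_sum by (intro ballI allI impI alt_sum_cong) simp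

lemma norm_wedge_le:
  assumes "form_bound 1 S a A" "x \<in> S" "0 \<le> a" "0 \<le> M"
    and "\<And>ws. length ws + 1 = length vs \<Longrightarrow> norm (\<omega> x ws) \<le> M * l1_prod ws"
  shows "norm (wedge A \<omega> x vs) \<le> real (length vs) * (a * M) * l1_prod vs"
  unfolding wedge_alt_sum
proof (rule norm_alt_sum_le)
  fix v and us :: "'a list" assume l: "length us + 1 = length vs"
  have "norm (blinfun_apply (A x [v]) (\<omega> x us)) \<le> norm (A x [v]) * norm (\<omega> x us)" by (rule norm_blinfun)
  also have "\<dots> \<le> (a * l1_norm v) * (M * l1_prod us)"
    using form_boundD[OF assms(1,2), of "[v]"] assms(3,5) l by (intro mult_mono) auto
  finally show "norm (blinfun_apply (A x [v]) (\<omega> x us)) \<le> a * M * (l1_norm v * l1_prod us)"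
    by (simp add: mult_ac)
qed

lemma compact_form_bound:
  fixes \<omega> :: "('a::euclidean_space, 'b::real_normed_vector) dform"
  assumes "compact S" "S \<subseteq> U" and \<omega>: "\<omega> \<in> dforms k 0 U"
  obtains M where "0 \<le> M" "form_bound k S M \<omega>"
proof -
  let ?I = "{I. set I \<subseteq> (Basis :: 'a set) \<and> length I = k}"
  have fin: "finite ?I" by (rule finite_lists_length_eq) simp
  have "\<exists>B. \<forall>x\<in>S. norm (\<omega> x I) \<le> B" if "I \<in> ?I" for I
  proof -
    have "bounded ((\<lambda>x. \<omega> x I) ` S)"
      using that by (intro compact_imp_bounded compact_continuous_image assms(1)
          continuous_on_subset[OF dforms_continuous[OF \<omega>] assms(2)]) auto
    then show ?thesis by (auto simp: bounded_iff)
  qed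
  then obtain B where B: "\<And>I x. I \<in> ?I \<Longrightarrow> x \<in> S \<Longrightarrow> norm (\<omega> x I) \<le> B I" by metis
  show ?thesis
  proof
    show "0 \<le> (\<Sum>I\<in>?I. \<bar>B I\<bar>)" by (simp add: sum_nonneg)
    show "form_bound k S (\<Sum>I\<in>?I. \<bar>B I\<bar>) \<omega>"
      unfolding form_bound_def
    proof (intro ballI allI impI)
      fix x and vs :: "'a list" assume x: "x \<in> S" and l: "length vs = k"
      then have "alternating_multilinear k (\<omega> x)" using dforms_alternating[OF \<omega>] assms(2) by blast
      then show "norm (\<omega> x vs) \<le> (\<Sum>I\<in>?I. \<bar>B I\<bar>) * l1_prod vs"
      proof (rule alternating_bound_of_Basis[OF _ _ l])
        fix I :: "'a list" assume I: "set I \<subseteq> Basis" "length I = k"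
        have "norm (\<omega> x I) \<le> \<bar>B I\<bar>" using B[of I x] I x by auto
        also have "\<dots> \<le> (\<Sum>I\<in>?I. \<bar>B I\<bar>)" using I by (intro member_le_sum fin) auto
        finally show "norm (\<omega> x I) \<le> (\<Sum>I\<in>?I. \<bar>B I\<bar>)" .
      qed
    qed
  qed
qed

text \<open>
  Linearity and vanishing on repeated arguments are closed conditions, so they pass to pointwise limits.
\<close>

lemma alternating_limit:
  fixes f :: "'a::real_vector list \<Rightarrow> 'b::real_normed_vector"
  assumes F: "\<And>N. alternating_multilinear k (F N)" and lim: "\<And>vs. length vs = k \<Longrightarrow> (\<lambda>N. F N vs) \<longlonglongrightarrow> f vs"
  shows "alternating_multilinear k f"
  unfolding alternating_multilinear_def
proof (intro allI impI conjI)
  fix vs :: "'a list" assume l: "length vs = k"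
  show "f vs = 0" if "\<not> distinct vs"
    using lim[OF l] alternating_not_distinct[OF F l that] by (simp add: LIMSEQ_const_iff)
  fix i assume i: "i < k"
  note L = alternating_linear[OF F l i]
  show "linear (\<lambda>v. f (vs[i := v]))"
  proof (rule linearI)
    fix u w :: 'a and r :: real
    have "(\<lambda>N. F N (vs[i := u + w])) \<longlonglongrightarrow> f (vs[i := u]) + f (vs[i := w])"
      unfolding linear_add[OF L] by (intro tendsto_add lim) (use l in auto)
    then show "f (vs[i := u + w]) = f (vs[i := u]) + f (vs[i := w])"
      using LIMSEQ_unique lim[of "vs[i := u + w]"] l by auto
    have "(\<lambda>N. F N (vs[i := r *\<^sub>R u])) \<longlonglongrightarrow> r *\<^sub>R f (vs[i := u])"
      unfolding linear_cmul[OF L] by (intro tendsto_scaleR tendsto_const lim) (use l in auto)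
    then show "f (vs[i := r *\<^sub>R u]) = r *\<^sub>R f (vs[i := u])"
      using LIMSEQ_unique lim[of "vs[i := r *\<^sub>R u]"] l by auto
  qed
qed

section \<open>The operator iterated in the series\<close>

definition homotopy_wedge :: "'a::euclidean_space \<Rightarrow> nat \<Rightarrow> ('a, 'v::euclidean_space \<Rightarrow>\<^sub>L 'v) dform \<Rightarrow> ('a, 'v) dform \<Rightarrow> ('a, 'v) dform" where
  "homotopy_wedge x0 k A \<omega> = homotopy_op x0 (Suc k) (wedge A \<omega>)"

definition series_partial :: "'a::euclidean_space \<Rightarrow> nat \<Rightarrow> ('a, 'v::euclidean_space \<Rightarrow>\<^sub>L 'v) dform \<Rightarrow> ('a, 'v) dform \<Rightarrow> nat \<Rightarrow> ('a, 'v) dform" where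
  "series_partial x0 k A c N = (\<lambda>x vs. \<Sum>l<N. series_term x0 k A c l x vs)"

lemma series_term_eq: "series_term x0 k A c l = (\<lambda>x vs. (-1) ^ l *\<^sub>R (homotopy_wedge x0 k A ^^ l) c x vs)"
  by (simp add: series_term_def homotopy_wedge_def[abs_def])

locale star_connection =
  fixes U :: "'a::euclidean_space set" and x0 :: 'a and k :: nat and A :: "('a, 'v::euclidean_space \<Rightarrow>\<^sub>L 'v) dform"
  assumes U: "open U" "star_at x0 U" and A: "A \<in> dforms 1 0 U"
begin

abbreviation "T \<equiv> homotopy_wedge x0 k A"

abbreviation "P \<equiv> series_partial x0 k A"

lemma T_dforms: "\<omega> \<in> dforms k 0 U \<Longrightarrow> T \<omega> \<in> dforms k 0 U"
  unfolding homotopy_wedge_def by (intro homotopy_op_dforms U wedge_dforms A)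

lemma T_pow_dforms: "\<omega> \<in> dforms k 0 U \<Longrightarrow> (T ^^ l) \<omega> \<in> dforms k 0 U"
  by (induction l) (auto intro: T_dforms)

lemma T_lincomb:
  assumes "x \<in> U" "\<omega> \<in> dforms k 0 U" "\<eta> \<in> dforms k 0 U" "length vs = k"
  shows "T (\<lambda>x vs. a *\<^sub>R \<omega> x vs + b *\<^sub>R \<eta> x vs) x vs = a *\<^sub>R T \<omega> x vs + b *\<^sub>R T \<eta> x vs"
  unfolding homotopy_wedge_def using homotopy_op_lincomb[OF U(2) assms(1) wedge_dforms[OF A assms(2)] wedge_dforms[OF A assms(3)] assms(4)]
  by (simp add: wedge_lincomb[abs_def])

lemma T_cong:
  assumes "form_eq k U \<omega> \<eta>"
  shows "form_eq k U (T \<omega>) (T \<eta>)"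
  unfolding form_eq_def homotopy_wedge_def using homotopy_op_cong[OF U(2) _ wedge_cong[OF assms]] by blast

lemma T_eq_zero:
  assumes "form_eq (Suc k) U (wedge A \<omega>) zero_form"
  shows "form_eq k U (T \<omega>) zero_form"
  using homotopy_op_cong[OF U(2) _ assms]
  by (simp add: form_eq_def homotopy_wedge_def homotopy_op_eq[of _ _ zero_form] ray_integral_def)

text \<open>
  The gain 1 / (l + 1) is the integral of t^l: at the point x0 + t (x - x0) of the ray, a form that is
  bounded by |x - x0|^l is smaller by t^l. The factor k + 1 counts the summands of the wedge product, and
  the additional power of |x - x0| comes from inserting x - x0 as an argument.
\<close>

lemma T_bound_step:
  assumes S: "S \<subseteq> U" "star_at x0 S" and a: "form_bound 1 S a A" "0 \<le> a" and M: "0 \<le> M" and \<omega>: "\<omega> \<in> dforms k 0 U"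
    and b: "\<And>y ws. y \<in> S \<Longrightarrow> length ws = k \<Longrightarrow> norm (\<omega> y ws) \<le> M * l1_norm (y - x0) ^ l * l1_prod ws"
    and x: "x \<in> S" and l: "length vs = k"
  shows "norm (T \<omega> x vs) \<le> (M * (real (Suc k) * a) / (real l + 1)) * l1_norm (x - x0) ^ Suc l * l1_prod vs"
proof -
  let ?u = "x - x0"
  let ?B = "real (Suc k) * (a * M) * l1_norm ?u ^ Suc l * l1_prod vs"
  have "norm (ray_integral x0 k (\<lambda>y. wedge A \<omega> y (?u # vs)) x) \<le> ?B / (real l + 1)"
  proof (rule norm_ray_integral_le[OF S(2) _ x])
    show "continuous_on S (\<lambda>y. wedge A \<omega> y (?u # vs))"
      using dforms_continuous[OF wedge_dforms[OF A \<omega>]] l by (intro continuous_on_subset[OF _ S(1)]) auto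
    show "0 \<le> ?B" using a M by simp
    fix t :: real assume t: "0 \<le> t" "t \<le> 1"
    define y where "y = x0 + t *\<^sub>R ?u"
    have y: "y \<in> S" "l1_norm (y - x0) = t * l1_norm ?u" using star_atD[OF S(2) x] t by (auto simp: y_def l1_norm_scaleR)
    have "norm (wedge A \<omega> y (?u # vs)) \<le> real (length (?u # vs)) * (a * (M * l1_norm (y - x0) ^ l)) * l1_prod (?u # vs)"
    proof (rule norm_wedge_le[OF a(1) y(1) a(2)])
      show "0 \<le> M * l1_norm (y - x0) ^ l" using M by simp
      show "norm (\<omega> y ws) \<le> M * l1_norm (y - x0) ^ l * l1_prod ws" if "length ws + 1 = length (?u # vs)" for ws
        using b[OF y(1)] that l by simp
    qed
    also have "\<dots> = ?B * t ^ l" using l by (simp add: y power_mult_distrib mult_ac del: of_nat_Suc)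
    finally show "norm (wedge A \<omega> (x0 + t *\<^sub>R ?u) (?u # vs)) \<le> ?B * t ^ l" by (simp add: y_def)
  qed
  then show ?thesis by (simp add: homotopy_wedge_def homotopy_op_eq mult_ac)
qed

lemma T_pow_bound:
  assumes S: "S \<subseteq> U" "star_at x0 S" and a: "form_bound 1 S a A" "0 \<le> a" and \<omega>: "\<omega> \<in> dforms k 0 U"
    and M: "0 \<le> M" "form_bound k S M \<omega>"
  shows "x \<in> S \<Longrightarrow> length vs = k \<Longrightarrow>
     norm ((T ^^ l) \<omega> x vs) \<le> (M * (real (Suc k) * a) ^ l / fact l) * l1_norm (x - x0) ^ l * l1_prod vs"
proof (induction l arbitrary: x vs)
  case 0
  then show ?case using form_boundD[OF M(2)] by simp
next
  case (Suc l)
  have "norm (T ((T ^^ l) \<omega>) x vs) \<le> ((M * (real (Suc k) * a) ^ l / fact l) * (real (Suc k) * a) / (real l + 1)) * l1_norm (x - x0) ^ Suc l * l1_prod vs"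
    using a(2) M(1) by (intro T_bound_step[OF S a _ T_pow_dforms[OF \<omega>] Suc.IH Suc.prems]) auto
  then show ?case by (simp add: mult_ac add_ac)
qed

lemma T_pow_form_bound:
  assumes S: "S \<subseteq> U" "star_at x0 S" and a: "form_bound 1 S a A" "0 \<le> a" and \<omega>: "\<omega> \<in> dforms k 0 U"
    and M: "0 \<le> M" "form_bound k S M \<omega>" and R: "\<forall>x\<in>S. l1_norm (x - x0) \<le> R"
  shows "form_bound k S (M * ((real (Suc k) * a * R) ^ l /\<^sub>R fact l)) ((T ^^ l) \<omega>)"
  unfolding form_bound_def
proof (intro ballI allI impI)
  fix x and vs :: "'a list" assume x: "x \<in> S" and l: "length vs = k"
  have "norm ((T ^^ l) \<omega> x vs) \<le> (M * (real (Suc k) * a) ^ l / fact l) * l1_norm (x - x0) ^ l * l1_prod vs"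
    by (rule T_pow_bound[OF S a \<omega> M x l])
  also have "\<dots> \<le> (M * (real (Suc k) * a) ^ l / fact l) * R ^ l * l1_prod vs"
    using R x a M by (intro mult_right_mono mult_left_mono power_mono) auto
  finally show "norm ((T ^^ l) \<omega> x vs) \<le> M * ((real (Suc k) * a * R) ^ l /\<^sub>R fact l) * l1_prod vs"
    by (simp add: power_mult_distrib divide_inverse mult_ac)
qed

lemma compact_data:
  assumes "compact K" "K \<subseteq> U"
  obtains S a R where "compact S" "K \<subseteq> S" "S \<subseteq> U" "star_at x0 S" "form_bound 1 S a A" "0 \<le> a" 
    "0 \<le> R" "\<forall>x\<in>S. l1_norm (x - x0) \<le> R"
proof -
  obtain S where S: "compact S" "S \<subseteq> U" "K \<subseteq> S" "star_at x0 S" using compact_ray_hull[OF U(2) assms] .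
  obtain a where a: "0 \<le> a" "form_bound 1 S a A" using compact_form_bound[OF S(1,2) A] .
  obtain R where R: "0 \<le> R" "\<And>x. x \<in> S \<Longrightarrow> l1_norm (x - x0) \<le> R" using compact_l1_bound[OF S(1), of x0] by blast
  then have "\<forall>x\<in>S. l1_norm (x - x0) \<le> R" by blast
  with R(1) show ?thesis by (rule that[OF S(1,3,2,4) a(2,1)])
qed

text \<open>
  If T\<psi> = - \<psi>, then T^l \<psi> = (-1)^l \<psi>, so \<psi> is bounded by every member of a null sequence of the form M C^l / l!.
\<close>

lemma fixed_point_unique_zero:
  assumes \<psi>: "\<psi> \<in> dforms k 0 U" and eq: "form_eq k U (T \<psi>) (uminus_form \<psi>)"
  shows "form_eq k U \<psi> zero_form"
  unfolding form_eq_def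
proof (intro ballI allI impI)
  fix x and vs :: "'a list" assume x: "x \<in> U" and l: "length vs = k"
  have pow: "form_eq k U ((T ^^ l) \<psi>) (\<lambda>x vs. (-1) ^ l *\<^sub>R \<psi> x vs)" for l
  proof (induction l)
    case (Suc l)
    have "T (\<lambda>x vs. (-1) ^ l *\<^sub>R \<psi> x vs) x vs = (-1) ^ l *\<^sub>R T \<psi> x vs" if "x \<in> U" "length vs = k" for x vs
      using T_lincomb[OF that(1) \<psi> \<psi> that(2), of "(-1) ^ l" 0] by simp
    then show ?case using T_cong[OF Suc] eq by (simp add: form_eq_def)
  qed (simp add: form_eq_def)
  have K: "compact {x}" "{x} \<subseteq> U" using x by auto
  obtain S a R where S: "compact S" "{x} \<subseteq> S" "S \<subseteq> U" "star_at x0 S" "form_bound 1 S a A" "0 \<le> a"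
    "0 \<le> R" "\<forall>x\<in>S. l1_norm (x - x0) \<le> R" using compact_data[OF K] .
  obtain M where M: "0 \<le> M" "form_bound k S M \<psi>" using compact_form_bound[OF S(1,3) \<psi>] .
  have bnd: "norm (\<psi> x vs) \<le> M * ((real (Suc k) * a * R) ^ n /\<^sub>R fact n) * l1_prod vs" for n
    using form_boundD[OF T_pow_form_bound[OF S(3-6) \<psi> M S(8)], of x vs n] pow[of n] x l S(2)
    by (simp add: form_eq_def power_abs)
  have lim: "(\<lambda>n. M * ((real (Suc k) * a * R) ^ n /\<^sub>R fact n) * l1_prod vs) \<longlonglongrightarrow> M * 0 * l1_prod vs"
    by (intro tendsto_intros summable_LIMSEQ_zero summable_exp_generic)
  have "norm (\<psi> x vs) \<le> M * 0 * l1_prod vs"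
    by (rule LIMSEQ_le_const[OF lim]) (use bnd in blast)
  then show "\<psi> x vs = 0" by simp
qed

definition solves_fixed_point :: "('a, 'v) dform \<Rightarrow> ('a, 'v) dform \<Rightarrow> bool" where
  "solves_fixed_point c \<phi> \<longleftrightarrow> \<phi> \<in> dforms k 0 U \<and> form_eq k U (add_form \<phi> (T \<phi>)) c"

lemma fixed_point_unique:
  assumes "solves_fixed_point c \<phi>1" "solves_fixed_point c \<phi>2"
  shows "form_eq k U \<phi>1 \<phi>2"
proof -
  have f: "\<phi>1 \<in> dforms k 0 U" "\<phi>2 \<in> dforms k 0 U" using assms by (auto simp: solves_fixed_point_def)
  let ?\<psi> = "\<lambda>x vs. 1 *\<^sub>R \<phi>1 x vs + (- 1) *\<^sub>R \<phi>2 x vs"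
  have "form_eq k U ?\<psi> zero_form"
  proof (rule fixed_point_unique_zero[OF dforms_lincomb[OF U(1) f]])
    show "form_eq k U (T ?\<psi>) (uminus_form ?\<psi>)"
      unfolding form_eq_def
    proof (intro ballI allI impI)
      fix x and vs :: "'a list" assume x: "x \<in> U" "length vs = k"
      have "\<phi>1 x vs + T \<phi>1 x vs = \<phi>2 x vs + T \<phi>2 x vs"
        using assms x by (simp add: solves_fixed_point_def form_eq_def)
      then have "T \<phi>1 x vs - T \<phi>2 x vs = \<phi>2 x vs - \<phi>1 x vs" by (simp add: algebra_simps)
      then show "T ?\<psi> x vs = - ?\<psi> x vs" by (subst T_lincomb[OF x(1) f x(2)]) simp
    qed
  qed
  then show ?thesis by (simp add: form_eq_def)
qed

lemma fixed_point_diff: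
  assumes "solves_fixed_point c1 \<phi>1" "solves_fixed_point c2 \<phi>2"
  shows "solves_fixed_point (diff_form c1 c2) (diff_form \<phi>1 \<phi>2)"
proof -
  have f: "\<phi>1 \<in> dforms k 0 U" "\<phi>2 \<in> dforms k 0 U" using assms by (auto simp: solves_fixed_point_def)
  have "T (diff_form \<phi>1 \<phi>2) x vs = T \<phi>1 x vs - T \<phi>2 x vs" if "x \<in> U" "length vs = k" for x vs
    using T_lincomb[OF that(1) f that(2), of 1 "-1"] by simp
  moreover have "diff_form \<phi>1 \<phi>2 \<in> dforms k 0 U" using dforms_lincomb[OF U(1) f, of 1 "-1"] by simp
  moreover have "\<phi>1 x vs + T \<phi>1 x vs = c1 x vs" "\<phi>2 x vs + T \<phi>2 x vs = c2 x vs" if "x \<in> U" "length vs = k" for x vs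
    using assms that by (simp_all add: solves_fixed_point_def form_eq_def)
  ultimately show ?thesis
    unfolding solves_fixed_point_def form_eq_def by (metis (no_types, lifting) add_diff_add)
qed

text \<open>
  A form in the kernel of the wedge product with A is annihilated by T.
\<close>

lemma fixed_point_gauge:
  assumes "g \<in> dforms k 0 U" "form_eq (Suc k) U (wedge A g) zero_form"
  shows "solves_fixed_point g g"
  using assms T_eq_zero[OF assms(2)] by (simp add: solves_fixed_point_def form_eq_def)

section \<open>Convergence of the series\<close>

lemma series_partial_Suc: "P c (Suc N) = (\<lambda>x vs. 1 *\<^sub>R P c N x vs + (-1) ^ N *\<^sub>R (T ^^ N) c x vs)"
  by (simp add: series_partial_def series_term_eq)

lemma series_partial_dforms: 
  assumes c: "c \<in> dforms k 0 U" shows "P c N \<in> dforms k 0 U"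
proof (induction N)
  case 0
  then show ?case using dforms_zero[OF U(1)] by (simp add: series_partial_def)
next
  case (Suc N)
  show ?case unfolding series_partial_Suc by (rule dforms_lincomb[OF U(1) Suc T_pow_dforms[OF c]])
qed

text \<open>
  Telescoping: T maps each term to minus the next one.
\<close>

lemma T_series_partial:
  assumes c: "c \<in> dforms k 0 U" and x: "x \<in> U" "length vs = k"
  shows "T (P c N) x vs = c x vs - P c (Suc N) x vs"
proof (induction N)
  case 0
  have "T (P c 0) x vs = 0"
    using T_lincomb[OF x(1) c c x(2), of 0 0] by (simp add: series_partial_def)
  then show ?case by (simp add: series_partial_def series_term_eq)
next
  case (Suc N)
  have "T (P c (Suc N)) x vs = 1 *\<^sub>R T (P c N) x vs + (-1) ^ N *\<^sub>R T ((T ^^ N) c) x vs"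
    unfolding series_partial_Suc by (rule T_lincomb[OF x(1) series_partial_dforms[OF c] T_pow_dforms[OF c] x(2)])
  then show ?case by (simp add: Suc series_partial_Suc[of c "Suc N"])
qed

text \<open>
  The exponential series with argument (k + 1) a R dominates the terms, and its tails bound the error of
  the partial sums.
\<close>

lemma series_tail:
  assumes S: "S \<subseteq> U" "star_at x0 S" and a: "form_bound 1 S a A" "0 \<le> a" and c: "c \<in> dforms k 0 U"
    and M: "0 \<le> M" "form_bound k S M c" and R: "\<forall>x\<in>S. l1_norm (x - x0) \<le> R"
  obtains e where "e \<longlonglongrightarrow> 0" "\<forall>N. 0 \<le> e N"
    "\<forall>N. form_bound k S (e N) (diff_form (P c N) (series_sum x0 k A c))"
    "\<forall>x\<in>S. \<forall>vs. length vs = k \<longrightarrow> summable (\<lambda>l. series_term x0 k A c l x vs)"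
proof -
  define b where "b = (\<lambda>l. M * ((real (Suc k) * a * R) ^ l /\<^sub>R fact l))"
  have R0: "0 \<le> R" using R S(2) by (force simp: star_at_def l1_norm_def)
  have C0: "0 \<le> real (Suc k) * a * R" using a(2) R0 by (intro mult_nonneg_nonneg) auto
  have b: "summable b" unfolding b_def by (intro summable_mult summable_exp_generic)
  have b0: "0 \<le> b l" for l unfolding b_def
    by (intro mult_nonneg_nonneg[OF M(1)] scaleR_nonneg_nonneg zero_le_power C0) simp
  have tb: "norm (series_term x0 k A c l x vs) \<le> b l * l1_prod vs" if "x \<in> S" "length vs = k" for l x vs
    using form_boundD[OF T_pow_form_bound[OF S a c M R] that] by (simp add: series_term_eq b_def power_abs)
  have sb: "summable (\<lambda>l. b l * l1_prod vs)" for vs by (rule summable_mult2[OF b])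
  have sn: "summable (\<lambda>l. norm (series_term x0 k A c l x vs))" if "x \<in> S" "length vs = k" for x vs
    by (rule summable_comparison_test'[OF sb[of vs]]) (use tb[OF that] in simp)
  define e where "e = (\<lambda>N. \<Sum>l. b (l + N))"
  show ?thesis
  proof
    show "\<forall>x\<in>S. \<forall>vs. length vs = k \<longrightarrow> summable (\<lambda>l. series_term x0 k A c l x vs)"
      using summable_norm_cancel[OF sn] by blast
    show "\<forall>N. 0 \<le> e N" unfolding e_def by (intro allI suminf_nonneg summable_ignore_initial_segment b b0)
    have "(\<lambda>N. suminf b - sum b {..<N}) \<longlonglongrightarrow> suminf b - suminf b"
      by (intro tendsto_intros summable_LIMSEQ b)
    then show "e \<longlonglongrightarrow> 0" by (simp add: e_def suminf_minus_initial_segment[OF b])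
    show "\<forall>N. form_bound k S (e N) (diff_form (P c N) (series_sum x0 k A c))"
      unfolding form_bound_def
    proof (intro ballI allI impI)
      fix N x and vs :: "'a list" assume x: "x \<in> S" "length vs = k"
      let ?t = "\<lambda>l. series_term x0 k A c l x vs"
      have "norm (P c N x vs - series_sum x0 k A c x vs) = norm (\<Sum>l. ?t (l + N))"
        unfolding series_partial_def series_sum_def
        by (subst suminf_minus_initial_segment[OF summable_norm_cancel[OF sn[OF x]]]) (rule norm_minus_commute)
      also have "\<dots> \<le> (\<Sum>l. norm (?t (l + N)))"
        by (intro summable_norm) (use summable_ignore_initial_segment[OF sn[OF x]] in simp)
      also have "\<dots> \<le> (\<Sum>l. b (l + N) * l1_prod vs)"
        by (intro suminf_le tb x summable_ignore_initial_segment[OF sn[OF x]] summable_ignore_initial_segment[OF sb])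
      also have "\<dots> = e N * l1_prod vs"
        unfolding e_def by (rule suminf_mult2[symmetric, OF summable_ignore_initial_segment[OF b]])
      finally show "norm (P c N x vs - series_sum x0 k A c x vs) \<le> e N * l1_prod vs" .
    qed
  qed
qed

lemma series_unif_conv:
  assumes S: "S \<subseteq> U" "star_at x0 S" and a: "form_bound 1 S a A" "0 \<le> a" and c: "c \<in> dforms k 0 U"
    and M: "0 \<le> M" "form_bound k S M c" and R: "\<forall>x\<in>S. l1_norm (x - x0) \<le> R" and K: "K \<subseteq> S"
  shows "series_unif_conv_on K x0 k A c"
proof -
  obtain e where e: "e \<longlonglongrightarrow> 0" "\<forall>N. 0 \<le> e N"
    "\<forall>N. form_bound k S (e N) (diff_form (P c N) (series_sum x0 k A c))"
    "\<forall>x\<in>S. \<forall>vs. length vs = k \<longrightarrow> summable (\<lambda>l. series_term x0 k A c l x vs)"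
    using series_tail[OF S a c M R] .
  have "(\<lambda>N. ennreal (e N)) \<longlonglongrightarrow> ennreal 0" by (intro tendsto_ennrealI e)
  then have "(\<lambda>N. ennreal (e N)) \<longlonglongrightarrow> 0" by simp
  from tendsto_sandwich[OF _ _ tendsto_const this]
  show ?thesis unfolding series_unif_conv_on_def 
    using form_norm_le_of_bound[OF form_bound_mono[OF e(3)[rule_format] order_refl K]]
    by (simp add: series_partial_def)
qed

lemma series_compact:
  assumes c: "c \<in> dforms k 0 U" and K: "compact K" "K \<subseteq> U"
  obtains S a e where "K \<subseteq> S" "S \<subseteq> U" "star_at x0 S" "form_bound 1 S a A" "0 \<le> a"
    "e \<longlonglongrightarrow> 0" "\<forall>N. 0 \<le> e N" "\<forall>N. form_bound k S (e N) (diff_form (P c N) (series_sum x0 k A c))"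
    "\<forall>x\<in>S. \<forall>vs. length vs = k \<longrightarrow> summable (\<lambda>l. series_term x0 k A c l x vs)"
proof -
  obtain S a R where S: "compact S" "K \<subseteq> S" "S \<subseteq> U" "star_at x0 S" "form_bound 1 S a A" "0 \<le> a" 
    "0 \<le> R" "\<forall>x\<in>S. l1_norm (x - x0) \<le> R" using compact_data[OF K] .
  obtain M where M: "0 \<le> M" "form_bound k S M c" using compact_form_bound[OF S(1,3) c] .
  obtain e where e: "e \<longlonglongrightarrow> 0" "\<forall>N. 0 \<le> e N"
    "\<forall>N. form_bound k S (e N) (diff_form (P c N) (series_sum x0 k A c))"
    "\<forall>x\<in>S. \<forall>vs. length vs = k \<longrightarrow> summable (\<lambda>l. series_term x0 k A c l x vs)"
    using series_tail[OF S(3-6) c M S(8)] .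
  show ?thesis by (rule that[OF S(2-6) e])
qed

lemma series_summable:
  assumes c: "c \<in> dforms k 0 U" and x: "x \<in> U" "length vs = k"
  shows "summable (\<lambda>l. series_term x0 k A c l x vs)"
proof -
  have K: "compact {x}" "{x} \<subseteq> U" using x by auto
  obtain S a e where S: "{x} \<subseteq> S" "S \<subseteq> U" "star_at x0 S" "form_bound 1 S a A" "0 \<le> a"
    "e \<longlonglongrightarrow> 0" "\<forall>N. 0 \<le> e N" "\<forall>N. form_bound k S (e N) (diff_form (P c N) (series_sum x0 k A c))"
    "\<forall>x\<in>S. \<forall>vs. length vs = k \<longrightarrow> summable (\<lambda>l. series_term x0 k A c l x vs)"
    using series_compact[OF c K] .
  show ?thesis using S(1,9) x(2) by auto
qed

lemma series_unif_conv_compact: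
  assumes c: "c \<in> dforms k 0 U" and K: "compact K" "K \<subseteq> U"
  shows "series_unif_conv_on K x0 k A c"
proof -
  obtain S a R where S: "compact S" "K \<subseteq> S" "S \<subseteq> U" "star_at x0 S" "form_bound 1 S a A" "0 \<le> a" 
    "0 \<le> R" "\<forall>x\<in>S. l1_norm (x - x0) \<le> R" using compact_data[OF K] .
  obtain M where M: "0 \<le> M" "form_bound k S M c" using compact_form_bound[OF S(1,3) c] .
  show ?thesis by (rule series_unif_conv[OF S(3-6) c M S(8) S(2)])
qed

lemma series_partial_tendsto:
  assumes c: "c \<in> dforms k 0 U" and x: "x \<in> U" "length vs = k"
  shows "(\<lambda>N. P c N x vs) \<longlonglongrightarrow> series_sum x0 k A c x vs"
  unfolding series_partial_def series_sum_def by (rule summable_LIMSEQ[OF series_summable[OF assms]])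

lemma series_sum_dforms:
  assumes c: "c \<in> dforms k 0 U"
  shows "series_sum x0 k A c \<in> dforms k 0 U"
  unfolding dforms_0_iff
proof (intro conjI ballI allI impI)
  show "alternating_multilinear k (series_sum x0 k A c x)" if "x \<in> U" for x
    by (rule alternating_limit[OF dforms_alternating[OF series_partial_dforms[OF c] that] series_partial_tendsto[OF c that]])
  fix vs :: "'a list" assume l: "length vs = k"
  show "continuous_on U (\<lambda>x. series_sum x0 k A c x vs)"
  proof (rule continuous_at_imp_continuous_on, rule ballI)
    fix x assume x: "x \<in> U"
    then obtain r where r: "r > 0" "cball x r \<subseteq> U" using U(1) open_contains_cball by blast
    obtain S a e where S: "cball x r \<subseteq> S" "S \<subseteq> U" "star_at x0 S" "form_bound 1 S a A" "0 \<le> a"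
      "e \<longlonglongrightarrow> 0" "\<forall>N. 0 \<le> e N" "\<forall>N. form_bound k S (e N) (diff_form (P c N) (series_sum x0 k A c))"
      "\<forall>x\<in>S. \<forall>vs. length vs = k \<longrightarrow> summable (\<lambda>l. series_term x0 k A c l x vs)"
      using series_compact[OF c compact_cball r(2)] .
    have "uniform_limit (cball x r) (\<lambda>N y. P c N y vs) (\<lambda>y. series_sum x0 k A c y vs) sequentially"
    proof (rule uniform_limitI)
      fix \<epsilon> :: real assume \<epsilon>: "\<epsilon> > 0"
      have "(\<lambda>N. e N * l1_prod vs) \<longlonglongrightarrow> 0 * l1_prod vs" by (intro tendsto_intros S(6))
      then have "\<forall>\<^sub>F N in sequentially. e N * l1_prod vs < \<epsilon>" using \<epsilon> by (intro order_tendstoD) auto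
      then show "\<forall>\<^sub>F N in sequentially. \<forall>y\<in>cball x r. dist (P c N y vs) (series_sum x0 k A c y vs) < \<epsilon>"
      proof eventually_elim
        case (elim N)
        have "norm (P c N y vs - series_sum x0 k A c y vs) < \<epsilon>" if "y \<in> cball x r" for y
          using form_boundD[OF S(8)[rule_format, of N] _ l, of y] S(1) that elim by force
        then show ?case by (simp add: dist_norm)
      qed
    qed
    then have "continuous_on (cball x r) (\<lambda>y. series_sum x0 k A c y vs)"
      by (rule uniform_limit_theorem[rotated])
        (auto intro!: always_eventually continuous_on_subset[OF dforms_continuous[OF series_partial_dforms[OF c] l] r(2)])
    then show "isCont (\<lambda>x. series_sum x0 k A c x vs) x"
      using r(1) continuous_on_interior[of "cball x r" _ x] by (simp add: interior_cball)
  qed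
qed

text \<open>
  Pass to the limit in T (P N) = c - P (N + 1). On the left-hand side this uses the uniform error bound
  on a set that contains the whole ray from x0 to x.
\<close>

lemma series_solves_fixed_point:
  assumes c: "c \<in> dforms k 0 U"
  shows "solves_fixed_point c (series_sum x0 k A c)"
  unfolding solves_fixed_point_def
proof
  let ?\<phi> = "series_sum x0 k A c"
  show \<phi>: "?\<phi> \<in> dforms k 0 U" by (rule series_sum_dforms[OF c])
  show "form_eq k U (add_form ?\<phi> (T ?\<phi>)) c"
    unfolding form_eq_def
  proof (intro ballI allI impI)
    fix x and vs :: "'a list" assume x: "x \<in> U" and l: "length vs = k"
    have K: "compact {x}" "{x} \<subseteq> U" using x by auto
    obtain S a e where S: "{x} \<subseteq> S" "S \<subseteq> U" "star_at x0 S" "form_bound 1 S a A" "0 \<le> a"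
      "e \<longlonglongrightarrow> 0" "\<forall>N. 0 \<le> e N" "\<forall>N. form_bound k S (e N) (diff_form (P c N) ?\<phi>)"
      "\<forall>x\<in>S. \<forall>vs. length vs = k \<longrightarrow> summable (\<lambda>l. series_term x0 k A c l x vs)"
      using series_compact[OF c K] .
    let ?C = "real (Suc k) * a / (real 0 + 1) * l1_norm (x - x0) ^ Suc 0 * l1_prod vs"
    have "norm (T (P c N) x vs - T ?\<phi> x vs) \<le> e N * ?C" for N
    proof -
      have "norm (T (diff_form (P c N) ?\<phi>) x vs) \<le> (e N * (real (Suc k) * a) / (real 0 + 1)) * l1_norm (x - x0) ^ Suc 0 * l1_prod vs"
        using dforms_lincomb[OF U(1) series_partial_dforms[OF c] \<phi>, of 1 N "-1"] form_boundD[OF S(8)[rule_format]] S(1) l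
        by (intro T_bound_step[OF S(2-5) S(7)[rule_format]]) auto
      then show ?thesis
        using T_lincomb[OF x series_partial_dforms[OF c] \<phi> l, of 1 N "-1"] by (simp add: mult_ac)
    qed
    then have "\<forall>\<^sub>F N in sequentially. norm (T (P c N) x vs - T ?\<phi> x vs) \<le> e N * ?C"
      by (intro always_eventually allI)
    moreover have "(\<lambda>N. e N * ?C) \<longlonglongrightarrow> 0" by (rule tendsto_mult_left_zero[OF S(6)])
    ultimately have "(\<lambda>N. T (P c N) x vs - T ?\<phi> x vs) \<longlonglongrightarrow> 0"
      by (rule Lim_null_comparison)
    then have "(\<lambda>N. T (P c N) x vs) \<longlonglongrightarrow> T ?\<phi> x vs" by (rule LIM_zero_cancel)
    moreover have "(\<lambda>N. T (P c N) x vs) \<longlonglongrightarrow> c x vs - ?\<phi> x vs"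
      unfolding T_series_partial[OF c x l]
      by (intro tendsto_intros LIMSEQ_Suc series_partial_tendsto[OF c x l])
    ultimately have "T ?\<phi> x vs = c x vs - ?\<phi> x vs" by (rule LIMSEQ_unique)
    then show "?\<phi> x vs + T ?\<phi> x vs = c x vs" by simp
  qed
qed

end

section \<open>Solutions as fixed points\<close>

lemma homotopy_op_zero: "homotopy_op x0 k zero_form = (zero_form :: ('a::euclidean_space, 'v::euclidean_space) dform)"
  by (simp add: homotopy_op_def fun_eq_iff)

lemma wedge_zero: "wedge A zero_form = zero_form"
  by (simp add: wedge_def fun_eq_iff)

lemma closed_forms_dforms: "c \<in> closed_forms k U \<Longrightarrow> c \<in> dforms k 0 U"
  by (simp add: closed_forms_def has_ext_deriv_on_def)

lemma closed_forms_homotopy: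
  assumes "open U" "star_at x0 U" "c \<in> closed_forms (Suc m) U"
  shows "has_ext_deriv_on m U (homotopy_op x0 (Suc m) c) c"
  using has_ext_deriv_on_homotopy[OF assms(1,2), of m c zero_form] assms(3)
  by (simp add: closed_forms_def homotopy_op_zero)

lemma closed_forms_lincomb:
  assumes "open U" "c1 \<in> closed_forms k U" "c2 \<in> closed_forms k U"
  shows "(\<lambda>x vs. a *\<^sub>R c1 x vs + b *\<^sub>R c2 x vs) \<in> closed_forms k U"
  using has_ext_deriv_on_lincomb[OF assms(1), of k c1 zero_form c2 zero_form] assms(2,3) by (simp add: closed_forms_def)

lemma closed_forms_cong:
  assumes "open U" "form_eq k U c1 c2" "c1 \<in> closed_forms k U"
  shows "c2 \<in> closed_forms k U"
  using has_ext_deriv_on_cong[OF assms(1) _ assms(2), of zero_form zero_form] assms(3)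
  by (simp add: closed_forms_def form_eq_def)

lemma ker_wedge_cong:
  assumes "form_eq k U \<omega> \<eta>" "\<omega> \<in> ker_wedge k U A"
  shows "\<eta> \<in> ker_wedge k U A"
  using assms dforms_cong[OF assms(1)] wedge_cong[OF assms(1), of A]
  by (simp add: ker_wedge_def form_eq_def)

text \<open>
  Along the ray to x both homotopy operators insert multiples of the same vector x - x0 into the form.
\<close>

lemma homotopy_homotopy:
  fixes \<beta> :: "('a::euclidean_space, 'v::euclidean_space) dform"
  assumes U: "star_at x0 U" "x \<in> U" and \<beta>: "\<beta> \<in> dforms (Suc (Suc m)) 0 U" and l: "length vs = m"
  shows "homotopy_op x0 (Suc m) (homotopy_op x0 (Suc (Suc m)) \<beta>) x vs = 0"
proof -
  have "homotopy_op x0 (Suc (Suc m)) \<beta> (x0 + t *\<^sub>R (x - x0)) ((x - x0) # vs) = 0" if t: "t \<in> {0..1}" for t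
  proof -
    let ?u = "x - x0" and ?y = "x0 + t *\<^sub>R (x - x0)"
    have y: "?y \<in> U" using star_atD[OF U] t by auto
    have "\<beta> z ((?y - x0) # ?u # vs) = 0" if z: "z \<in> U" for z
    proof -
      have "\<beta> z ((t *\<^sub>R ?u) # ?u # vs) = t *\<^sub>R \<beta> z (?u # ?u # vs)"
        using linear_cmul[OF alternating_linear_Cons[OF dforms_alternating[OF \<beta> z]], of "?u # vs"] l by simp
      also have "\<beta> z (?u # ?u # vs) = 0" using alternating_not_distinct[OF dforms_alternating[OF \<beta> z]] l by simp
      finally show ?thesis by simp
    qed
    then have "ray_integral x0 (Suc m) (\<lambda>z. \<beta> z ((?y - x0) # ?u # vs)) ?y = ray_integral x0 (Suc m) (\<lambda>z. 0) ?y"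
      by (intro ray_integral_cong[OF U(1) y])
    then show ?thesis by (simp add: homotopy_op_eq[of x0 "Suc m"] ray_integral_def[of _ _ "\<lambda>z. 0"])
  qed
  then have "integral {0..1} (\<lambda>t. t ^ m *\<^sub>R homotopy_op x0 (Suc (Suc m)) \<beta> (x0 + t *\<^sub>R (x - x0)) ((x - x0) # vs)) = integral {0..1} (\<lambda>t::real. 0)"
    by (intro integral_cong) simp
  then show ?thesis by (simp add: homotopy_op_eq[of x0 m] ray_integral_def)
qed

lemma conn_norm_bound:
  fixes A :: "('a::euclidean_space, 'v::euclidean_space \<Rightarrow>\<^sub>L 'v) dform"
  assumes "conn_norm S A < \<infinity>" "\<And>x. x \<in> S \<Longrightarrow> alternating_multilinear 1 (A x)"
  obtains a where "0 \<le> a" "form_bound 1 S a A"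
proof -
  define C where "C = enn2real (conn_norm S A)"
  have C: "conn_norm S A = ennreal C" "0 \<le> C" using assms(1) by (auto simp: C_def)
  have coeff: "\<bar>blinfun_apply (A x [b]) j \<bullet> i\<bar> \<le> C" if "x \<in> S" "b \<in> Basis" "j \<in> Basis" "i \<in> Basis" for x b j i
  proof -
    have "ennreal \<bar>blinfun_apply (A x [b]) j \<bullet> i\<bar> \<le> conn_norm S A"
      unfolding conn_norm_def using that
      by (intro SUP_upper2[of i] SUP_upper2[of j] SUP_upper2[of b] SUP_upper2[of x]) auto
    then show ?thesis using C by simp
  qed
  let ?d = "real DIM('v)"
  have op: "norm (A x [b]) \<le> ?d * (?d * C)" if "x \<in> S" "b \<in> Basis" for x b
  proof -
    have "norm (A x [b]) \<le> (\<Sum>j\<in>Basis. norm (blinfun_apply (A x [b]) j))" by (rule norm_blinfun_euclidean_le)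
    also have "\<dots> \<le> (\<Sum>j\<in>(Basis::'v set). ?d * C)"
    proof (rule sum_mono)
      fix j :: 'v assume j: "j \<in> Basis"
      have "norm (blinfun_apply (A x [b]) j) \<le> (\<Sum>i\<in>Basis. \<bar>blinfun_apply (A x [b]) j \<bullet> i\<bar>)" by (rule norm_le_l1)
      also have "\<dots> \<le> (\<Sum>i\<in>(Basis::'v set). C)" by (intro sum_mono coeff that j)
      finally show "norm (blinfun_apply (A x [b]) j) \<le> ?d * C" by simp
    qed
    finally show ?thesis by simp
  qed
  show ?thesis
  proof
    show "0 \<le> ?d * (?d * C)" using C by simp
    show "form_bound 1 S (?d * (?d * C)) A"
      unfolding form_bound_def
    proof (intro ballI allI impI)
      fix x and vs :: "'a list" assume x: "x \<in> S" and l: "length vs = 1"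
      show "norm (A x vs) \<le> ?d * (?d * C) * l1_prod vs"
      proof (rule alternating_bound_of_Basis[OF assms(2)[OF x] _ l])
        show "norm (A x I) \<le> ?d * (?d * C)" if "set I \<subseteq> Basis" "length I = 1" for I
          using op[OF x] that by (auto simp: length_Suc_conv)
      qed
    qed
  qed
qed

text \<open>
  The equation that determines the radius of the ball forces the norm of A on the ball to be finite, because
  infinity times a positive number is infinite.
\<close>

lemma conn_norm_finite:
  assumes "r > 0" "k > 0" "ennreal r * conn_norm S A / of_nat k = 1"
  shows "conn_norm S A < \<infinity>"
proof (rule ccontr)
  assume "\<not> ?thesis"
  then have "conn_norm S A = top" unfolding infinity_ennreal_def using top.not_eq_extremum by blast
  then have "ennreal r * conn_norm S A / of_nat k = top"
    using assms(1) by (simp add: ennreal_mult_top ennreal_top_divide)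
  then show False using assms(3) by simp
qed

context star_connection
begin

lemma fixed_point_in_ker:
  assumes "solves_fixed_point c \<phi>" "\<phi> \<in> ker_wedge k U A"
  shows "form_eq k U \<phi> c"
  using assms T_eq_zero[of \<phi>] by (simp add: solves_fixed_point_def ker_wedge_def form_eq_def)

lemma fixed_point_not_in_ker:
  assumes "solves_fixed_point c \<phi>" "c \<notin> ker_wedge k U A"
  shows "\<phi> \<in> dforms k 0 U - ker_wedge k U A" "\<not> form_eq k U \<phi> zero_form"
proof -
  have n: "\<phi> \<notin> ker_wedge k U A"
    using fixed_point_in_ker[OF assms(1)] ker_wedge_cong assms(2) by blast
  moreover have \<phi>: "\<phi> \<in> dforms k 0 U" using assms(1) by (simp add: solves_fixed_point_def)
  ultimately show "\<phi> \<in> dforms k 0 U - ker_wedge k U A" by simp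
  show "\<not> form_eq k U \<phi> zero_form"
  proof
    assume "form_eq k U \<phi> zero_form"
    from wedge_cong[OF this, of A] have "\<phi> \<in> ker_wedge k U A" using \<phi> by (simp add: ker_wedge_def wedge_zero)
    with n show False by simp
  qed
qed

text \<open>
  Applying H to \<phi> + T\<phi> = c gives H\<phi> = Hc, since T\<phi> lies in the range of H and H H = 0. The form c, being closed,
  is the exterior derivative of Hc.
\<close>

lemma fixed_point_side_condition:
  assumes k: "k > 0" and s: "solves_fixed_point c \<phi>" and c: "c \<in> closed_forms k U"
  shows "has_ext_deriv_on (k - 1) U (homotopy_op x0 k \<phi>) c"
proof -
  obtain m where m: "k = Suc m" using k by (cases k) auto
  have \<phi>: "\<phi> \<in> dforms k 0 U" using s by (simp add: solves_fixed_point_def)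
  have "homotopy_op x0 k c x vs = homotopy_op x0 k \<phi> x vs" if x: "x \<in> U" and l: "length vs = m" for x vs
  proof -
    have "form_eq (Suc m) U (\<lambda>x vs. 1 *\<^sub>R \<phi> x vs + 1 *\<^sub>R T \<phi> x vs) c"
      using s unfolding solves_fixed_point_def m[symmetric] by simp
    from homotopy_op_cong[OF U(2) x this l]
    have "homotopy_op x0 k c x vs = homotopy_op x0 k (\<lambda>x vs. 1 *\<^sub>R \<phi> x vs + 1 *\<^sub>R T \<phi> x vs) x vs"
      by (simp add: m)
    also have "\<dots> = 1 *\<^sub>R homotopy_op x0 k \<phi> x vs + 1 *\<^sub>R homotopy_op x0 k (T \<phi>) x vs"
      unfolding m by (rule homotopy_op_lincomb[OF U(2) x _ _ l]) (use \<phi> T_dforms[OF \<phi>] m in auto)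
    also have "homotopy_op x0 k (T \<phi>) x vs = 0"
      using homotopy_homotopy[OF U(2) x _ l, of "wedge A \<phi>"] wedge_dforms[OF A \<phi>] by (simp add: m homotopy_wedge_def)
    finally show ?thesis by simp
  qed
  then have "form_eq m U (homotopy_op x0 k c) (homotopy_op x0 k \<phi>)" by (simp add: form_eq_def)
  moreover have "has_ext_deriv_on m U (homotopy_op x0 k c) c"
    using closed_forms_homotopy[OF U, of c m] c m by simp
  ultimately show ?thesis
    using has_ext_deriv_on_cong[OF U(1), of m "homotopy_op x0 k c" c] m by (simp add: form_eq_def)
qed

text \<open>
  If A \<and> \<phi> is closed, then T\<phi> = H (A \<and> \<phi>) has the exterior derivative A \<and> \<phi>, and so \<phi> = c - T\<phi> has
  - A \<and> \<phi>. For the other direction, A \<and> \<phi> is minus an exterior derivative and hence closed.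
\<close>

lemma fixed_point_cov_constant_iff:
  assumes s: "solves_fixed_point c \<phi>" and c: "c \<in> closed_forms k U"
  shows "cov_constant k U A \<phi> \<longleftrightarrow> wedge A \<phi> \<in> closed_forms (Suc k) U"
proof
  assume "cov_constant k U A \<phi>"
  then obtain \<eta> where \<eta>: "has_ext_deriv_on k U \<phi> \<eta>" "form_eq (Suc k) U (add_form \<eta> (wedge A \<phi>)) zero_form"
    by (auto simp: cov_constant_def)
  note cl = has_ext_deriv_on_imp_closed[OF U(1) \<eta>(1)]
  have "form_eq (Suc k) U (\<lambda>x vs. (- 1) *\<^sub>R \<eta> x vs + 0 *\<^sub>R \<eta> x vs) (wedge A \<phi>)"
    using \<eta>(2) by (simp add: form_eq_def minus_equation_iff add_eq_0_iff)
  then show "wedge A \<phi> \<in> closed_forms (Suc k) U"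
    by (rule closed_forms_cong[OF U(1) _ closed_forms_lincomb[OF U(1) cl cl]])
next
  assume "wedge A \<phi> \<in> closed_forms (Suc k) U"
  then have h: "has_ext_deriv_on k U (T \<phi>) (wedge A \<phi>)"
    unfolding homotopy_wedge_def by (rule closed_forms_homotopy[OF U])
  have "has_ext_deriv_on k U c zero_form" using c by (simp add: closed_forms_def)
  note has_ext_deriv_on_lincomb[OF U(1) this h, of 1 "-1"]
  moreover have "form_eq k U (\<lambda>x vs. 1 *\<^sub>R c x vs + (- 1) *\<^sub>R T \<phi> x vs) \<phi>"
    using s by (simp add: solves_fixed_point_def form_eq_def algebra_simps)
  moreover have "form_eq (Suc k) U (\<lambda>x vs. 1 *\<^sub>R 0 + (- 1) *\<^sub>R wedge A \<phi> x vs) (uminus_form (wedge A \<phi>))"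
    by (simp add: form_eq_def)
  ultimately have "has_ext_deriv_on k U \<phi> (uminus_form (wedge A \<phi>))"
    by (rule has_ext_deriv_on_cong[OF U(1)])
  moreover have "form_eq (Suc k) U (add_form (uminus_form (wedge A \<phi>)) (wedge A \<phi>)) zero_form"
    by (simp add: form_eq_def)
  ultimately show "cov_constant k U A \<phi>" unfolding cov_constant_def by blast
qed

lemma cov_constant_ext_deriv:
  assumes "cov_constant k U A \<phi>"
  shows "has_ext_deriv_on k U \<phi> (uminus_form (wedge A \<phi>))"
proof -
  obtain \<eta> where \<eta>: "has_ext_deriv_on k U \<phi> \<eta>" "form_eq (Suc k) U (add_form \<eta> (wedge A \<phi>)) zero_form"
    using assms by (auto simp: cov_constant_def)
  show ?thesis
    by (rule has_ext_deriv_on_cong[OF U(1) \<eta>(1)]) (use \<eta>(2) in \<open>auto simp: form_eq_def eq_neg_iff_add_eq_0\<close>)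
qed

text \<open>
  By the homotopy formula \<phi> + T\<phi> is an exterior derivative of H\<phi>, and so is c by the side condition.
\<close>

lemma solution_solves_fixed_point:
  assumes k: "k > 0" and s: "solution_with_datum k U x0 A c \<phi>"
  shows "solves_fixed_point c \<phi>"
proof -
  obtain m where m: "k = Suc m" using k by (cases k) auto
  have h: "has_ext_deriv_on k U \<phi> (uminus_form (wedge A \<phi>))"
    using cov_constant_ext_deriv s by (simp add: solution_with_datum_def)
  note \<phi> = has_ext_deriv_on_dforms(1)[OF h]
  have H: "homotopy_op x0 (Suc k) (uminus_form (wedge A \<phi>)) x vs = - T \<phi> x vs" if "x \<in> U" "length vs = k" for x vs
    using homotopy_op_lincomb[OF U(2) that(1) wedge_dforms[OF A \<phi>] wedge_dforms[OF A \<phi>] that(2), of "-1" 0]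
    by (simp add: homotopy_wedge_def)
  have "has_ext_deriv_on m U (homotopy_op x0 k \<phi>) (diff_form \<phi> (homotopy_op x0 (Suc k) (uminus_form (wedge A \<phi>))))"
    using has_ext_deriv_on_homotopy[OF U, of m \<phi>] h by (simp add: m)
  moreover have "has_ext_deriv_on m U (homotopy_op x0 k \<phi>) c" using s m by (simp add: solution_with_datum_def)
  ultimately have "form_eq k U (diff_form \<phi> (homotopy_op x0 (Suc k) (uminus_form (wedge A \<phi>)))) c"
    using has_ext_deriv_on_unique[OF U(1), of m] m by blast
  then show ?thesis using \<phi> H by (simp add: solves_fixed_point_def form_eq_def)
qed

lemma gauge_mode_solution:
  assumes k: "k > 0" and c: "c \<in> closed_forms k U" "c \<in> ker_wedge k U A"
  shows "form_eq k U (series_sum x0 k A c) c" "solution_with_datum k U x0 A c c" "c \<in> exact_gauge_modes k U A"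
proof -
  have s: "solves_fixed_point c c" using c(2) by (intro fixed_point_gauge) (auto simp: ker_wedge_def)
  show "form_eq k U (series_sum x0 k A c) c"
    by (rule fixed_point_unique[OF series_solves_fixed_point[OF closed_forms_dforms[OF c(1)]] s])
  have "wedge A c \<in> closed_forms (Suc k) U"
    using closed_forms_cong[OF U(1), of "Suc k" zero_form "wedge A c"] c(2) 
      closed_forms_lincomb[OF U(1) has_ext_deriv_on_imp_closed[OF U(1)] has_ext_deriv_on_imp_closed[OF U(1)], of k c zero_form c zero_form 0 0] c(1)
    by (simp add: ker_wedge_def form_eq_def closed_forms_def)
  then have "cov_constant k U A c" using fixed_point_cov_constant_iff[OF s c(1)] by simp
  then show "solution_with_datum k U x0 A c c" "c \<in> exact_gauge_modes k U A"
    using fixed_point_side_condition[OF k s c(1)] c by (auto simp: solution_with_datum_def exact_gauge_modes_def)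
qed

text \<open>
  The difference is the fixed point for the datum c1 - c2; either membership in the kernel makes the
  difference equal to that datum.
\<close>

lemma solution_diff:
  assumes k: "k > 0" and c: "c1 \<in> closed_forms k U" "c2 \<in> closed_forms k U"
    and s: "solution_with_datum k U x0 A c1 \<phi>1" "solution_with_datum k U x0 A c2 \<phi>2"
  shows "diff_form \<phi>1 \<phi>2 \<in> exact_gauge_modes k U A \<longleftrightarrow> diff_form c1 c2 \<in> ker_wedge k U A"
    "diff_form c1 c2 \<in> ker_wedge k U A \<Longrightarrow> form_eq k U (diff_form \<phi>1 \<phi>2) (diff_form c1 c2)"
proof -
  have d: "solves_fixed_point (diff_form c1 c2) (diff_form \<phi>1 \<phi>2)"
    by (intro fixed_point_diff solution_solves_fixed_point k s)
  have cl: "diff_form c1 c2 \<in> closed_forms k U"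
    using closed_forms_lincomb[OF U(1) c, of 1 "-1"] by simp
  show eq: "form_eq k U (diff_form \<phi>1 \<phi>2) (diff_form c1 c2)" if "diff_form c1 c2 \<in> ker_wedge k U A"
  proof (rule fixed_point_unique[OF d fixed_point_gauge])
    show "diff_form c1 c2 \<in> dforms k 0 U" by (rule closed_forms_dforms[OF cl])
    show "form_eq (Suc k) U (wedge A (diff_form c1 c2)) zero_form" using that by (simp add: ker_wedge_def)
  qed
  show "diff_form \<phi>1 \<phi>2 \<in> exact_gauge_modes k U A \<longleftrightarrow> diff_form c1 c2 \<in> ker_wedge k U A"
  proof
    assume "diff_form \<phi>1 \<phi>2 \<in> exact_gauge_modes k U A"
    then have "diff_form \<phi>1 \<phi>2 \<in> ker_wedge k U A" by (simp add: exact_gauge_modes_def)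
    then show "diff_form c1 c2 \<in> ker_wedge k U A" using fixed_point_in_ker[OF d] ker_wedge_cong by blast
  next
    assume "diff_form c1 c2 \<in> ker_wedge k U A"
    from form_eq_sym[OF eq[OF this]] this show "diff_form \<phi>1 \<phi>2 \<in> exact_gauge_modes k U A"
      by (intro gauge_mode_solution(3)[OF k]) (auto intro: closed_forms_cong[OF U(1) _ cl] ker_wedge_cong)
  qed
qed

lemma solution_add_gauge_mode:
  assumes k: "k > 0" and g: "g \<in> exact_gauge_modes k U A" and s: "solution_with_datum k U x0 A c \<phi>"
  shows "solution_with_datum k U x0 A (add_form c g) (add_form \<phi> g)"
  unfolding solution_with_datum_def
proof
  obtain m where m: "k = Suc m" using k by (cases k) auto
  have g': "g \<in> closed_forms k U" "form_eq (Suc k) U (wedge A g) zero_form"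
    using g by (auto simp: exact_gauge_modes_def ker_wedge_def)
  have hg: "has_ext_deriv_on k U g zero_form" using g' by (simp add: closed_forms_def)
  obtain \<eta> where \<eta>: "has_ext_deriv_on k U \<phi> \<eta>" "form_eq (Suc k) U (add_form \<eta> (wedge A \<phi>)) zero_form"
    using s by (auto simp: solution_with_datum_def cov_constant_def)
  have "has_ext_deriv_on k U (add_form \<phi> g) \<eta>"
    using has_ext_deriv_on_lincomb[OF U(1) \<eta>(1) hg, of 1 1] by simp
  moreover have "form_eq (Suc k) U (add_form \<eta> (wedge A (add_form \<phi> g))) zero_form"
    using \<eta>(2) g'(2) wedge_lincomb[of A 1 \<phi> 1 g] by (simp add: form_eq_def)
  ultimately show "cov_constant k U A (add_form \<phi> g)" unfolding cov_constant_def by blast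
  have d: "\<phi> \<in> dforms (Suc m) 0 U" "g \<in> dforms (Suc m) 0 U"
    using has_ext_deriv_on_dforms[OF \<eta>(1)] has_ext_deriv_on_dforms[OF hg] m by auto
  have "has_ext_deriv_on m U (homotopy_op x0 k \<phi>) c" using s m by (simp add: solution_with_datum_def)
  moreover have "has_ext_deriv_on m U (homotopy_op x0 k g) g"
    using closed_forms_homotopy[OF U, of g m] g' m by simp
  ultimately have "has_ext_deriv_on m U (\<lambda>x vs. 1 *\<^sub>R homotopy_op x0 k \<phi> x vs + 1 *\<^sub>R homotopy_op x0 k g x vs)
      (\<lambda>x vs. 1 *\<^sub>R c x vs + 1 *\<^sub>R g x vs)"
    by (rule has_ext_deriv_on_lincomb[OF U(1)])
  then have "has_ext_deriv_on m U (homotopy_op x0 k (add_form \<phi> g)) (add_form c g)"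
    by (rule has_ext_deriv_on_cong[OF U(1)])
      (use homotopy_op_lincomb[OF U(2) _ d, of _ _ 1 1] in \<open>auto simp: form_eq_def m\<close>)
  then show "has_ext_deriv_on (k - 1) U (homotopy_op x0 k (add_form \<phi> g)) (add_form c g)" by (simp add: m)
qed

text \<open>
  The intersection of U with the ball is star-shaped, and A, c and |x - x0| are bounded on it, so the
  dominating exponential series applies to the whole intersection.
\<close>

lemma series_unif_conv_ball:
  assumes c: "c \<in> dforms k 0 U" and fin: "conn_norm (U \<inter> ball x0 r) A < \<infinity>" "form_norm k (U \<inter> ball x0 r) c < \<infinity>" and r: "r > 0"
  shows "series_unif_conv_on (U \<inter> ball x0 r) x0 k A c"
proof -
  let ?S = "U \<inter> ball x0 r"
  have st: "star_at x0 ?S"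
    using U(2) convex_imp_star_at[OF convex_ball, of x0 x0 r] r by (auto simp: star_at_def)
  obtain a where a: "0 \<le> a" "form_bound 1 ?S a A"
    using conn_norm_bound[OF fin(1)] dforms_alternating[OF A] by blast
  have "form_norm k ?S c \<le> ennreal (enn2real (form_norm k ?S c))" using fin(2) by simp
  then have M: "form_bound k ?S (real DIM('v) * enn2real (form_norm k ?S c)) c"
    by (rule bound_of_form_norm) (use dforms_alternating[OF c] in auto)
  have R: "\<forall>x\<in>?S. l1_norm (x - x0) \<le> real DIM('a) * r"
  proof
    fix x assume "x \<in> ?S"
    then have "norm (x - x0) \<le> r" by (simp add: dist_norm norm_minus_commute)
    then show "l1_norm (x - x0) \<le> real DIM('a) * r"
      using l1_norm_le[of "x - x0"] by (meson mult_left_mono of_nat_0_le_iff order_trans)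
  qed
  show ?thesis by (rule series_unif_conv[OF _ st a(2,1) c _ M R]) auto
qed

end

theorem theorem1:
  fixes U :: "'a::euclidean_space set" and x0 :: 'a and k :: nat
    and A :: "('a, 'v::euclidean_space \<Rightarrow>\<^sub>L 'v) dform"
  assumes "open U" and "bounded U" and "x0 \<in> U"
    and "\<And>x. x \<in> U \<Longrightarrow> closed_segment x0 x \<subseteq> U"
    and "A \<in> dforms 1 \<infinity> U" and "k > 0"
  shows
    "(\<forall>c \<in> closed_forms k U - ker_wedge k U A. \<not> form_eq k U c zero_form \<longrightarrow>
        \<comment> \<open>the solution is unique, nontrivial and given by the series\<close>
        (\<forall>x\<in>U. \<forall>vs. length vs = k \<longrightarrow> summable (\<lambda>l. series_term x0 k A c l x vs)) \<and>
        (\<forall>\<phi>. solution_with_datum k U x0 A c \<phi> \<longrightarrow>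
           form_eq k U \<phi> (series_sum x0 k A c) \<and> \<not> form_eq k U \<phi> zero_form \<and>
           \<phi> \<in> dforms k 0 U - ker_wedge k U A \<and>
           has_ext_deriv_on k U \<phi> (uminus_form (wedge A \<phi>))) \<and>
        \<comment> \<open>the series satisfies the side condition, and solves the equation whenever this is
            compatible with d d = 0, that is, whenever its product with A is closed\<close>
        has_ext_deriv_on (k - 1) U (homotopy_op x0 k (series_sum x0 k A c)) c \<and>
        (solution_with_datum k U x0 A c (series_sum x0 k A c) \<longleftrightarrow>
           wedge A (series_sum x0 k A c) \<in> closed_forms (Suc k) U) \<and>
        \<comment> \<open>convergence inside the ball\<close>
        (\<forall>r>0. ennreal r * conn_norm (U \<inter> ball x0 r) A / of_nat k = 1 \<longrightarrow>
           (\<forall>K. compact K \<and> K \<subseteq> U \<inter> ball x0 r \<longrightarrow> series_unif_conv_on K x0 k A c) \<and>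
           (form_norm k (U \<inter> ball x0 r) c < \<infinity> \<longrightarrow>
              series_unif_conv_on (U \<inter> ball x0 r) x0 k A c)) \<and>
        series_sum x0 k A c \<in> dforms k 0 U - ker_wedge k U A \<and>
        wedge A (series_sum x0 k A c) \<in> dforms (Suc k) 0 U) \<and>
     \<comment> \<open>exact gauge modes\<close>
     (\<forall>c \<in> closed_forms k U \<inter> ker_wedge k U A.
        form_eq k U (series_sum x0 k A c) c \<and> solution_with_datum k U x0 A c c \<and>
        c \<in> exact_gauge_modes k U A) \<and>
     (\<forall>c1 \<in> closed_forms k U - ker_wedge k U A. \<forall>c2 \<in> closed_forms k U - ker_wedge k U A. \<forall>\<phi>1 \<phi>2.
        solution_with_datum k U x0 A c1 \<phi>1 \<and> solution_with_datum k U x0 A c2 \<phi>2 \<longrightarrow>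
        (diff_form \<phi>1 \<phi>2 \<in> exact_gauge_modes k U A \<longleftrightarrow> diff_form c1 c2 \<in> ker_wedge k U A) \<and>
        (diff_form c1 c2 \<in> ker_wedge k U A \<longrightarrow>
           form_eq k U (diff_form \<phi>1 \<phi>2) (diff_form c1 c2))) \<and>
     (\<forall>c \<in> closed_forms k U - ker_wedge k U A. \<forall>\<phi>. \<forall>g \<in> exact_gauge_modes k U A.
        solution_with_datum k U x0 A c \<phi> \<longrightarrow>
        solution_with_datum k U x0 A (add_form c g) (add_form \<phi> g))"
proof -
  have star: "star_at x0 U"
    unfolding star_at_def
  proof (intro conjI ballI)
    fix x and t :: real assume x: "x \<in> U" and t: "t \<in> {0..1}"
    have "x0 + t *\<^sub>R (x - x0) = (1 - t) *\<^sub>R x0 + t *\<^sub>R x" by (simp add: algebra_simps)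
    then have "x0 + t *\<^sub>R (x - x0) \<in> closed_segment x0 x" using t unfolding in_segment by auto
    then show "x0 + t *\<^sub>R (x - x0) \<in> U" using assms(4)[OF x] by blast
  qed (fact assms(3))
  interpret star_connection U x0 k A
    by unfold_locales (use assms(1) star dforms_imp_continuous[OF assms(5)] in auto)
  note k = assms(6)
  show ?thesis
  proof (intro conjI ballI impI allI)
    fix c assume c: "c \<in> closed_forms k U - ker_wedge k U A"
    then have c': "c \<in> closed_forms k U" "c \<notin> ker_wedge k U A" by auto
    note dc = closed_forms_dforms[OF c'(1)]
    note fp = series_solves_fixed_point[OF dc]
    show "summable (\<lambda>l. series_term x0 k A c l x vs)" if "x \<in> U" "length vs = k" for x vs
      by (rule series_summable[OF dc that])
    {
      fix \<phi> assume s: "solution_with_datum k U x0 A c \<phi>"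
      note f = solution_solves_fixed_point[OF k s]
      show "form_eq k U \<phi> (series_sum x0 k A c)" by (rule fixed_point_unique[OF f fp])
      show "\<not> form_eq k U \<phi> zero_form" "\<phi> \<in> dforms k 0 U - ker_wedge k U A"
        using fixed_point_not_in_ker[OF f c'(2)] by auto
      show "has_ext_deriv_on k U \<phi> (uminus_form (wedge A \<phi>))"
        using s by (intro cov_constant_ext_deriv) (simp add: solution_with_datum_def)
    }
    show side: "has_ext_deriv_on (k - 1) U (homotopy_op x0 k (series_sum x0 k A c)) c"
      by (rule fixed_point_side_condition[OF k fp c'(1)])
    show "solution_with_datum k U x0 A c (series_sum x0 k A c) \<longleftrightarrow>
        wedge A (series_sum x0 k A c) \<in> closed_forms (Suc k) U"
      using side fixed_point_cov_constant_iff[OF fp c'(1)] by (simp add: solution_with_datum_def)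
    show "series_unif_conv_on K x0 k A c" if "compact K \<and> K \<subseteq> U \<inter> ball x0 r" for K r
      using that by (intro series_unif_conv_compact[OF dc]) auto
    show "series_unif_conv_on (U \<inter> ball x0 r) x0 k A c"
      if "r > 0" "ennreal r * conn_norm (U \<inter> ball x0 r) A / of_nat k = 1" "form_norm k (U \<inter> ball x0 r) c < \<infinity>" for r
      by (rule series_unif_conv_ball[OF dc conn_norm_finite[OF that(1) k that(2)] that(3,1)])
    show "series_sum x0 k A c \<in> dforms k 0 U - ker_wedge k U A"
      by (rule fixed_point_not_in_ker(1)[OF fp c'(2)])
    show "wedge A (series_sum x0 k A c) \<in> dforms (Suc k) 0 U"
      by (rule wedge_dforms[OF A series_sum_dforms[OF dc]])
  next
    fix c assume "c \<in> closed_forms k U \<inter> ker_wedge k U A"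
    then show "form_eq k U (series_sum x0 k A c) c" "solution_with_datum k U x0 A c c" "c \<in> exact_gauge_modes k U A"
      using gauge_mode_solution[OF k] by auto
  next
    fix c1 c2 \<phi>1 \<phi>2
    assume c: "c1 \<in> closed_forms k U - ker_wedge k U A" "c2 \<in> closed_forms k U - ker_wedge k U A"
      and s: "solution_with_datum k U x0 A c1 \<phi>1 \<and> solution_with_datum k U x0 A c2 \<phi>2"
    then have *: "c1 \<in> closed_forms k U" "c2 \<in> closed_forms k U" by auto
    show "diff_form \<phi>1 \<phi>2 \<in> exact_gauge_modes k U A \<longleftrightarrow> diff_form c1 c2 \<in> ker_wedge k U A"
      by (rule solution_diff(1)[OF k * conjunct1[OF s] conjunct2[OF s]])
    show "form_eq k U (diff_form \<phi>1 \<phi>2) (diff_form c1 c2)" if "diff_form c1 c2 \<in> ker_wedge k U A"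
      by (rule solution_diff(2)[OF k * conjunct1[OF s] conjunct2[OF s] that])
  next
    fix c \<phi> g
    assume "g \<in> exact_gauge_modes k U A" "solution_with_datum k U x0 A c \<phi>"
    then show "solution_with_datum k U x0 A (add_form c g) (add_form \<phi> g)"
      by (rule solution_add_gauge_mode[OF k])
  qed
qed

end
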